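(* Consider the full dynamic model described in the context, a constant command $x_{0_d}\in\mathbb R^3$, and smooth desired first body-fixed directions $b_{1_i}(t)\in\mathsf S^2$ (not parallel to $b_{3_i}$). Let the controller gains $K_{x_i},K_{\dot x_i}\in\mathbb R^{3\times D_{\mathbf x}}$ be chosen such that the zero equilibrium of the linear system $\mathbf M\ddot{\mathbf x}+\mathbf G\mathbf x=\mathbf B\,\delta u$ with $\delta u=-K_x\mathbf x-K_{\dot x}\dot{\mathbf x}$ is asymptotically stable, where $K_x=[K_{x_1}^T,\dots,K_{x_n}^T]^T$ and $K_{\dot x}=[K_{\dot x_1}^T,\dots,K_{\dot x_n}^T]^T$, and let $k_R,k_\Omega>0$. Let the control inputs of the quadrotors be $$f_i=-A_i\cdot R_ie_3,$$ $$M_i=-k_Re_{R_i}-k_\Omega e_{\Omega_i}+(R_i^TR_{i_c}\Omega_{i_c})^\wedge J_iR_i^TR_{i_c}\Omega_{i_c}+J_iR_i^TR_{i_c}\dot\Omega_{i_c},$$ with $A_i,R_{i_c},\Omega_{i_c}$ as defined in the context. Then the equilibrium of zero tracking errors for $e_{x_0},\dot e_{x_0},e_{R_0},e_{\Omega_0},e_{q_{ij}},e_{\omega_{ij}},e_{R_i},e_{\Omega_i}$ (corresponding to $x_0=x_{0_d}$, $R_0=I$, $q_{ij}=e_3$, $R_i=R_{i_c}$, with zero velocity errors) is exponentially stable.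
   Context: Notation: $e_1,e_2,e_3$ is the standard basis of $\mathbb R^3$, $e_3$ pointing along gravity, $g>0$. The hat map (also written $(\cdot)^\wedge$) is $\hat xy=x\times y$, with inverse $\vee:\mathfrak{so}(3)\to\mathbb R^3$. $C=[e_1,e_2]\in\mathbb R^{3\times2}$. System: a payload with mass $m_0>0$, inertia $J_0$ (symmetric positive definite), position $x_0\in\mathbb R^3$, attitude $R_0\in\mathsf{SO}(3)$, $\dot R_0=R_0\hat\Omega_0$; $n$ quadrotors with masses $m_i>0$, inertias $J_i$ (symmetric positive definite), attitudes $R_i\in\mathsf{SO}(3)$, $\dot R_i=R_i\hat\Omega_i$; cable $i$ consists of $n_i$ links with masses $m_{ij}>0$, lengths $l_{ij}>0$, directions $q_{ij}\in\mathsf S^2$, $\dot q_{ij}=\omega_{ij}\times q_{ij}$, $\omega_{ij}\cdot q_{ij}=0$; $\rho_i\in\mathbb R^3$ is the attachment point of cable $i$ in the payload body frame. Constants: $M_{iT}=m_i+\sum_jm_{ij}$, $M_T=m_0+\sum_iM_{iT}$, $M_{0ij}=m_i+\sum_{a=1}^{j-1}m_{ia}$, $\bar J_0=J_0-\sum_iM_{iT}\hat\rho_i^2$; $M_{0i\min(j,k)}$ denotes $M_{0ip}$ with $p=\min(j,k)$. Full dynamic model (inputs $f_i\in\mathbb R$, $M_i\in\mathbb R^3$), for all $i,j$: $$M_T\ddot x_0-\sum_{i}\sum_{j}M_{0ij}l_{ij}\ddot q_{ij}-\sum_{i}M_{iT}R_0\hat\rho_i\dot\Omega_0=M_Tge_3-\sum_{i}f_iR_ie_3-\sum_{i}M_{iT}R_0\hat\Omega_0^2\rho_i,$$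 $$\bar J_0\dot\Omega_0+\sum_{i}M_{iT}\hat\rho_iR_0^T\ddot x_0-\sum_{i}\sum_{j}M_{0ij}l_{ij}\hat\rho_iR_0^T\ddot q_{ij}=\sum_{i}\hat\rho_iR_0^T(-f_iR_ie_3+M_{iT}ge_3)-\hat\Omega_0\bar J_0\Omega_0,$$ $$\sum_{k=1}^{n_i}M_{0i\min(j,k)}l_{ik}\hat q_{ij}^2\ddot q_{ik}-M_{0ij}\hat q_{ij}^2\ddot x_0+M_{0ij}\hat q_{ij}^2R_0\hat\rho_i\dot\Omega_0=M_{0ij}\hat q_{ij}^2R_0\hat\Omega_0^2\rho_i-\hat q_{ij}^2(M_{0ij}ge_3-f_iR_ie_3),$$ $$J_i\dot\Omega_i+\Omega_i\times J_i\Omega_i=M_i.$$ Standing assumption: the desired configuration $x_0=x_{0_d}$, $R_0=I_3$, $q_{ij}=e_3$ with thrusts $u_i^*=-(M_{iT}+\frac{m_0}{n})ge_3$ is an equilibrium of the payload and link dynamics, i.e. $(\sum_i\rho_i)\times e_3=0$. Linear system matrices ($D_{\mathbf x}=6+2\sum_in_i$): $$\mathbf M=\begin{bmatrix}M_TI_3&\mathbf M_{x_0\Omega_0}&\mathbf M_{x_01}&\cdots&\mathbf M_{x_0n}\\ \mathbf M_{\Omega_0x_0}&\bar J_0&\mathbf M_{\Omega_01}&\cdots&\mathbf M_{\Omega_0n}\\ \mathbf M_{1x_0}&\mathbf M_{1\Omega_0}&\mathbf M_{qq1}&\cdots&0\\ \vdots&\vdots&\vdots&\ddots&\vdots\\ \mathbf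 M_{nx_0}&\mathbf M_{n\Omega_0}&0&\cdots&\mathbf M_{qqn}\end{bmatrix},\qquad \mathbf B=\begin{bmatrix}I_3&\cdots&I_3\\ \hat\rho_1&\cdots&\hat\rho_n\\ \mathbf B_1&\cdots&0\\ \vdots&\ddots&\vdots\\ 0&\cdots&\mathbf B_n\end{bmatrix},$$ with $\mathbf M_{x_0\Omega_0}=-\sum_iM_{iT}\hat\rho_i$; $\mathbf M_{\Omega_0x_0}=\mathbf M_{x_0\Omega_0}^T$; $\mathbf M_{x_0i}$ the row of blocks $M_{0ij}l_{ij}\hat e_3C$; $\mathbf M_{\Omega_0i}$ the row of blocks $M_{0ij}l_{ij}\hat\rho_i\hat e_3C$; $\mathbf M_{ix_0}$ the column of blocks $-M_{0ij}C^T\hat e_3$; $\mathbf M_{i\Omega_0}$ the column of blocks $M_{0ij}C^T\hat e_3\hat\rho_i$ ($j=1,\dots,n_i$ in each); $\mathbf M_{qqi}$ with $(j,k)$ block $M_{0i\min(j,k)}l_{ik}I_2$; $\mathbf B_i\in\mathbb R^{2n_i\times3}$ the column of $n_i$ blocks $-C^T\hat e_3$; and $\mathbf G=\mathrm{diag}[0_{3\times3},\sum_i\frac{m_0}{n}g\hat\rho_i\hat e_3,\mathbf G_1,\dots,\mathbf G_n]$ with $\mathbf G_i$ block diagonal with $j$-th block $(M_{iT}+\frac{m_0}{n}-M_{0ij})gI_2$. Payload and link tracking errors: $e_{x_0}=x_0-x_{0_d}$, $e_{R_0}=\frac12(R_0-R_0^T)^\vee$, $e_{\Omega_0}=\Omega_0$,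 $e_{q_{ij}}=q_{ij}-e_3$, $e_{\omega_{ij}}=\omega_{ij}$. In the nonlinear system the state vector used for feedback is $\mathbf x=(e_{x_0},e_{R_0},C^T(e_3\times q_{11}),\dots,C^T(e_3\times q_{nn_n}))\in\mathbb R^{D_{\mathbf x}}$ (links ordered by $i$, then $j$) and $\dot{\mathbf x}$ is its time derivative. Controller quantities: $A_i=-K_{x_i}\mathbf x-K_{\dot x_i}\dot{\mathbf x}+u_i^*$; $b_{3_i}=-A_i/\|A_i\|$; $$R_{i_c}=\left[-\frac{(\hat b_{3_i})^2b_{1_i}}{\|(\hat b_{3_i})^2b_{1_i}\|},\ \frac{\hat b_{3_i}b_{1_i}}{\|\hat b_{3_i}b_{1_i}\|},\ b_{3_i}\right]\in\mathsf{SO}(3),\qquad\Omega_{i_c}=(R_{i_c}^T\dot R_{i_c})^\vee.$$ Quadrotor errors: $e_{R_i}=\frac12(R_{i_c}^TR_i-R_i^TR_{i_c})^\vee$, $e_{\Omega_i}=\Omega_i-R_i^TR_{i_c}\Omega_{i_c}$. Exponential stability is the usual (local) notion: let $E(t)$ be the sum of the norms of all the listed tracking errors (over all $i,j$). There are constants $\delta,c,\lambda>0$ such that for every initial time $t_0\ge0$ and every initial condition with $E(t_0)<\delta$, $\frac12\mathrm{tr}[I-R_0(t_0)]<1$ and $\frac12\mathrm{tr}[I-R_{i_c}(t_0)^TR_i(t_0)]<1$ for all $i$, one has $E(t)\le c\,e^{-\lambda(t-t_0)}E(t_0)$ for all $t\ge t_0$.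
   Formalization: The directions b_{1_i}(t) are assumed to have bounded time derivative and to stay uniformly non-parallel to b_{3_i} = e_3 at the equilibrium; without this the t_0-uniform exponential rate fails (e.g. b_1 = (cos t², sin t², 0), J_i = I) or R_{i_c} is undefined arbitrarily near the equilibrium. *)

theory Defs
  imports "HOL-Analysis.Analysis"
begin

unbundle cross3_syntax

section \<open>Rotations and the hat map\<close>

abbreviation e1 :: "real^3" where "e1 \<equiv> axis 1 1"
abbreviation e2 :: "real^3" where "e2 \<equiv> axis 2 1"
abbreviation e3 :: "real^3" where "e3 \<equiv> axis 3 1"

text \<open>\<^typ>\<open>real^2^3\<close> is the type of matrices with 3 rows and 2 columns.\<close>

definition Cmat :: "real^2^3" where
  "Cmat = transpose (vector [e1, e2])"

definition hat :: "real^3 \<Rightarrow> real^3^3" where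
  "hat x = matrix (\<lambda>y. x \<times> y)"

text \<open>The inverse of the hat map; it is meaningful on skew-symmetric matrices only.\<close>

definition vee :: "real^3^3 \<Rightarrow> real^3" where
  "vee A = vector [A$3$2, A$1$3, A$2$1]"

lemma hat_mult: "hat x *v y = x \<times> y"
  unfolding hat_def matrix_def matrix_vector_mult_def
  by (simp add: cross3_def axis_def vec_eq_iff forall_3 sum_3)

lemma vee_hat: "vee (hat x) = x"
  unfolding vee_def hat_def matrix_def
  by (simp add: cross3_def axis_def vec_eq_iff forall_3)

lemma hat_vee:
  assumes "transpose A = - A"
  shows "hat (vee A) = A"
proof -
  have *: "A $ j $ i = - A $ i $ j" for i j
    using assms by (metis (no_types) transpose_def vec_lambda_beta uminus_vec_def vector_uminus_component)
  show ?thesis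
    using *[of 1 1] *[of 2 2] *[of 3 3] *[of 1 2] *[of 1 3] *[of 2 3]
    unfolding vee_def hat_def matrix_def
    by (simp add: cross3_def axis_def vec_eq_iff forall_3)
qed


section \<open>The plant\<close>

text \<open>
  The quadrotors (and cables) are indexed by a finite type \<^typ>\<open>'n\<close>, so that the number of
  quadrotors is \<open>CARD('n)\<close>; the links of cable \<open>i\<close> are indexed by \<open>1, \<dots>, nlinks P i\<close>.
\<close>

record 'n plant =
  mass0 :: real
  inertia0 :: "real^3^3"
  massQ :: "'n \<Rightarrow> real"
  inertiaQ :: "'n \<Rightarrow> real^3^3"
  nlinks :: "'n \<Rightarrow> nat"
  mlink :: "'n \<Rightarrow> nat \<Rightarrow> real"
  llink :: "'n \<Rightarrow> nat \<Rightarrow> real"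
  rho :: "'n \<Rightarrow> real^3"
  grav :: real

abbreviation links :: "'n plant \<Rightarrow> 'n \<Rightarrow> nat set" where
  "links P i \<equiv> {1..nlinks P i}"

definition sym_pos_def :: "real^3^3 \<Rightarrow> bool" where
  "sym_pos_def A \<longleftrightarrow> transpose A = A \<and> (\<forall>v. v \<noteq> 0 \<longrightarrow> v \<bullet> (A *v v) > 0)"

definition admissible_plant :: "'n plant \<Rightarrow> bool" where
  "admissible_plant P \<longleftrightarrow>
     mass0 P > 0 \<and> sym_pos_def (inertia0 P) \<and> grav P > 0 \<and>
     (\<forall>i. massQ P i > 0 \<and> sym_pos_def (inertiaQ P i) \<and> nlinks P i \<ge> 1 \<and>
          (\<forall>j\<in>links P i. mlink P i j > 0 \<and> llink P i j > 0))"

definition MiT :: "'n plant \<Rightarrow> 'n \<Rightarrow> real" where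
  "MiT P i = massQ P i + (\<Sum>j\<in>links P i. mlink P i j)"

definition MT :: "'n::finite plant \<Rightarrow> real" where
  "MT P = mass0 P + (\<Sum>i\<in>UNIV. MiT P i)"

definition M0 :: "'n plant \<Rightarrow> 'n \<Rightarrow> nat \<Rightarrow> real" where
  "M0 P i j = massQ P i + (\<Sum>a\<in>{1..<j}. mlink P i a)"

definition Jbar :: "'n::finite plant \<Rightarrow> real^3^3" where
  "Jbar P = inertia0 P - (\<Sum>i\<in>UNIV. MiT P i *\<^sub>R (hat (rho P i) ** hat (rho P i)))"

definition u_star :: "'n::finite plant \<Rightarrow> 'n \<Rightarrow> real^3" where
  "u_star P i = - (((MiT P i + mass0 P / real CARD('n)) * grav P) *\<^sub>R e3)"


section \<open>Trajectories and the full dynamic model\<close>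

text \<open>
  The suffixes \<open>0\<close>, \<open>L\<close>, \<open>Q\<close> stand for payload, links and quadrotors. The angular velocities
  \<open>angv0\<close> and \<open>angvQ\<close> are in the body frame, \<open>angvL\<close> is in the inertial frame.
\<close>

record 'n trajectory =
  pos0 :: "real \<Rightarrow> real^3"
  att0 :: "real \<Rightarrow> real^3^3"
  angv0 :: "real \<Rightarrow> real^3"
  dirL :: "'n \<Rightarrow> nat \<Rightarrow> real \<Rightarrow> real^3"
  angvL :: "'n \<Rightarrow> nat \<Rightarrow> real \<Rightarrow> real^3"
  attQ :: "'n \<Rightarrow> real \<Rightarrow> real^3^3"
  angvQ :: "'n \<Rightarrow> real \<Rightarrow> real^3"

text \<open>
  Time derivative relative to the time interval \<open>S\<close> on which a motion is defined
  (one-sided at the initial time).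
\<close>

definition ddt :: "real set \<Rightarrow> (real \<Rightarrow> 'a::real_normed_vector) \<Rightarrow> real \<Rightarrow> 'a" where
  "ddt S f t = vector_derivative f (at t within S)"

definition diff_on :: "real set \<Rightarrow> (real \<Rightarrow> 'a::real_normed_vector) \<Rightarrow> bool" where
  "diff_on S f \<longleftrightarrow> (\<forall>t\<in>S. f differentiable (at t within S))"

definition kinematics :: "'n plant \<Rightarrow> real set \<Rightarrow> 'n trajectory \<Rightarrow> bool" where
  "kinematics P S T \<longleftrightarrow>
     (\<forall>t\<in>S. rotation_matrix (att0 T t) \<and>
        (att0 T has_vector_derivative att0 T t ** hat (angv0 T t)) (at t within S)) \<and>
     (\<forall>i. \<forall>t\<in>S. rotation_matrix (attQ T i t) \<and>
        (attQ T i has_vector_derivative attQ T i t ** hat (angvQ T i t)) (at t within S)) \<and>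
     (\<forall>i. \<forall>j\<in>links P i. \<forall>t\<in>S. norm (dirL T i j t) = 1 \<and> angvL T i j t \<bullet> dirL T i j t = 0 \<and>
        (dirL T i j has_vector_derivative angvL T i j t \<times> dirL T i j t) (at t within S))"

definition regular_trajectory :: "'n plant \<Rightarrow> real set \<Rightarrow> 'n trajectory \<Rightarrow> bool" where
  "regular_trajectory P S T \<longleftrightarrow>
     diff_on S (pos0 T) \<and> diff_on S (ddt S (pos0 T)) \<and> diff_on S (angv0 T) \<and>
     (\<forall>i. \<forall>j\<in>links P i. diff_on S (ddt S (dirL T i j))) \<and>
     (\<forall>i. diff_on S (angvQ T i))"

definition payload_translation ::
  "'n::finite plant \<Rightarrow> real set \<Rightarrow> 'n trajectory \<Rightarrow> ('n \<Rightarrow> real) \<Rightarrow> real \<Rightarrow> bool" where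
  "payload_translation P S T f t \<longleftrightarrow>
     MT P *\<^sub>R ddt S (ddt S (pos0 T)) t
     - (\<Sum>i\<in>UNIV. \<Sum>j\<in>links P i. (M0 P i j * llink P i j) *\<^sub>R ddt S (ddt S (dirL T i j)) t)
     - (\<Sum>i\<in>UNIV. MiT P i *\<^sub>R ((att0 T t ** hat (rho P i)) *v ddt S (angv0 T) t))
     = (MT P * grav P) *\<^sub>R e3
     - (\<Sum>i\<in>UNIV. f i *\<^sub>R (attQ T i t *v e3))
     - (\<Sum>i\<in>UNIV. MiT P i *\<^sub>R ((att0 T t ** hat (angv0 T t) ** hat (angv0 T t)) *v rho P i))"

definition payload_rotation ::
  "'n::finite plant \<Rightarrow> real set \<Rightarrow> 'n trajectory \<Rightarrow> ('n \<Rightarrow> real) \<Rightarrow> real \<Rightarrow> bool" where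
  "payload_rotation P S T f t \<longleftrightarrow>
     Jbar P *v ddt S (angv0 T) t
     + (\<Sum>i\<in>UNIV. MiT P i *\<^sub>R ((hat (rho P i) ** transpose (att0 T t)) *v ddt S (ddt S (pos0 T)) t))
     - (\<Sum>i\<in>UNIV. \<Sum>j\<in>links P i. (M0 P i j * llink P i j) *\<^sub>R
          ((hat (rho P i) ** transpose (att0 T t)) *v ddt S (ddt S (dirL T i j)) t))
     = (\<Sum>i\<in>UNIV. (hat (rho P i) ** transpose (att0 T t)) *v
          (- (f i *\<^sub>R (attQ T i t *v e3)) + (MiT P i * grav P) *\<^sub>R e3))
     - (hat (angv0 T t) ** Jbar P) *v angv0 T t"

definition link_dynamics ::
  "'n plant \<Rightarrow> real set \<Rightarrow> 'n trajectory \<Rightarrow> ('n \<Rightarrow> real) \<Rightarrow> real \<Rightarrow> 'n \<Rightarrow> nat \<Rightarrow> bool" where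
  "link_dynamics P S T f t i j \<longleftrightarrow> (let Q2 = hat (dirL T i j t) ** hat (dirL T i j t) in
     (\<Sum>k\<in>links P i. (M0 P i (min j k) * llink P i k) *\<^sub>R (Q2 *v ddt S (ddt S (dirL T i k)) t))
     - M0 P i j *\<^sub>R (Q2 *v ddt S (ddt S (pos0 T)) t)
     + M0 P i j *\<^sub>R ((Q2 ** att0 T t ** hat (rho P i)) *v ddt S (angv0 T) t)
     = M0 P i j *\<^sub>R ((Q2 ** att0 T t ** hat (angv0 T t) ** hat (angv0 T t)) *v rho P i)
     - Q2 *v ((M0 P i j * grav P) *\<^sub>R e3 - f i *\<^sub>R (attQ T i t *v e3)))"

definition quadrotor_rotation ::
  "'n plant \<Rightarrow> real set \<Rightarrow> 'n trajectory \<Rightarrow> ('n \<Rightarrow> real^3) \<Rightarrow> real \<Rightarrow> 'n \<Rightarrow> bool" where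
  "quadrotor_rotation P S T M t i \<longleftrightarrow>
     inertiaQ P i *v ddt S (angvQ T i) t + angvQ T i t \<times> (inertiaQ P i *v angvQ T i t) = M i"

definition full_model ::
  "'n::finite plant \<Rightarrow> real set \<Rightarrow> 'n trajectory \<Rightarrow> (real \<Rightarrow> 'n \<Rightarrow> real) \<Rightarrow> (real \<Rightarrow> 'n \<Rightarrow> real^3) \<Rightarrow> bool"
  where
  "full_model P S T f M \<longleftrightarrow>
     kinematics P S T \<and> regular_trajectory P S T \<and>
     (\<forall>t\<in>S. payload_translation P S T (f t) t \<and> payload_rotation P S T (f t) t \<and>
        (\<forall>i. \<forall>j\<in>links P i. link_dynamics P S T (f t) t i j) \<and>
        (\<forall>i. quadrotor_rotation P S T (M t) t i))"


section \<open>The linear system\<close>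

text \<open>
  The coordinates of a vector in \<open>\<real>\<^sup>D\<close>, \<open>D = 6 + 2 \<Sum>\<^sub>i n\<^sub>i\<close>, are labelled by the set \<open>coords P\<close>.
  Vectors are functions on labels and matrices are functions on pairs of labels (row label
  first), of which only the values on \<open>coords P\<close> matter. The order of the labels is irrelevant.
\<close>

datatype 'n coord = Pos 3 | Att 3 | Link 'n nat 2

definition coords :: "'n plant \<Rightarrow> 'n coord set" where
  "coords P = range Pos \<union> range Att \<union> {Link i j a | i j a. j \<in> links P i}"

lemma coords_eq_image:
  "coords P = range Pos \<union> range Att \<union>
     (\<lambda>(i, j, a). Link i j a) ` (SIGMA i:UNIV. SIGMA j:links P i. UNIV)"
  unfolding coords_def by (auto simp: image_iff)

lemma finite_coords: "finite (coords P)" for P :: "'n::finite plant"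
  unfolding coords_eq_image by (intro finite_UnI finite_imageI finite_SigmaI) auto

lemma card_coords: "card (coords P) = 6 + 2 * (\<Sum>i\<in>UNIV. nlinks P i)" for P :: "'n::finite plant"
proof -
  let ?L = "SIGMA i:(UNIV::'n set). SIGMA j:links P i. (UNIV::2 set)"
  let ?h = "\<lambda>(i, j, a). Link i j a"
  have "card (?h ` ?L) = card ?L"
    by (rule card_image) (auto simp: inj_on_def)
  also have "\<dots> = 2 * (\<Sum>i\<in>UNIV. nlinks P i)"
    by (simp add: sum_distrib_left mult.commute)
  finally have L: "card (?h ` ?L) = 2 * (\<Sum>i\<in>UNIV. nlinks P i)" .
  have fin: "finite (?h ` ?L)"
    by (intro finite_imageI finite_SigmaI) auto
  have pa: "card (range Pos :: 'n coord set) = 3" "card (range Att :: 'n coord set) = 3"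
    by (simp_all add: card_image inj_on_def)
  have "card (range Pos \<union> range Att :: 'n coord set) = 6"
    by (subst card_Un_disjoint) (auto simp: pa)
  moreover have "card ((range Pos \<union> range Att) \<union> ?h ` ?L)
      = card (range Pos \<union> range Att :: 'n coord set) + card (?h ` ?L)"
    using fin by (intro card_Un_disjoint) auto
  ultimately show ?thesis
    unfolding coords_eq_image L by presburger
qed

definition mat_app :: "'c set \<Rightarrow> ('r \<Rightarrow> 'c \<Rightarrow> real) \<Rightarrow> ('c \<Rightarrow> real) \<Rightarrow> 'r \<Rightarrow> real" where
  "mat_app I A x r = (\<Sum>c\<in>I. A r c * x c)"

definition M_x0W0 :: "'n::finite plant \<Rightarrow> real^3^3" where
  "M_x0W0 P = - (\<Sum>i\<in>UNIV. MiT P i *\<^sub>R hat (rho P i))"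

fun Mmat :: "'n::finite plant \<Rightarrow> 'n coord \<Rightarrow> 'n coord \<Rightarrow> real" where
  "Mmat P (Pos a) (Pos b) = (MT P *\<^sub>R mat 1 :: real^3^3) $ a $ b"
| "Mmat P (Pos a) (Att b) = M_x0W0 P $ a $ b"
| "Mmat P (Pos a) (Link i j b) = ((M0 P i j * llink P i j) *\<^sub>R (hat e3 ** Cmat)) $ a $ b"
| "Mmat P (Att a) (Pos b) = transpose (M_x0W0 P) $ a $ b"
| "Mmat P (Att a) (Att b) = Jbar P $ a $ b"
| "Mmat P (Att a) (Link i j b) =
     ((M0 P i j * llink P i j) *\<^sub>R (hat (rho P i) ** hat e3 ** Cmat)) $ a $ b"
| "Mmat P (Link i j a) (Pos b) = (- (M0 P i j *\<^sub>R (transpose Cmat ** hat e3))) $ a $ b"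
| "Mmat P (Link i j a) (Att b) =
     (M0 P i j *\<^sub>R (transpose Cmat ** hat e3 ** hat (rho P i))) $ a $ b"
| "Mmat P (Link i j a) (Link i' k b) =
     (if i' = i then ((M0 P i (min j k) * llink P i k) *\<^sub>R mat 1 :: real^2^2) $ a $ b else 0)"

fun Gmat :: "'n::finite plant \<Rightarrow> 'n coord \<Rightarrow> 'n coord \<Rightarrow> real" where
  "Gmat P (Att a) (Att b) =
     (\<Sum>i\<in>UNIV. (mass0 P / real CARD('n) * grav P) *\<^sub>R (hat (rho P i) ** hat e3)) $ a $ b"
| "Gmat P (Link i j a) (Link i' k b) =
     (if i' = i \<and> k = j
      then (((MiT P i + mass0 P / real CARD('n) - M0 P i j) * grav P) *\<^sub>R mat 1 :: real^2^2) $ a $ b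
      else 0)"
| "Gmat P _ _ = 0"

text \<open>The columns of \<open>B\<close> are labelled by a quadrotor and one of its three force components.\<close>

fun Bmat :: "'n::finite plant \<Rightarrow> 'n coord \<Rightarrow> 'n \<times> 3 \<Rightarrow> real" where
  "Bmat P (Pos a) (i, b) = (mat 1 :: real^3^3) $ a $ b"
| "Bmat P (Att a) (i, b) = hat (rho P i) $ a $ b"
| "Bmat P (Link i' j a) (i, b) = (if i' = i then (- (transpose Cmat ** hat e3)) $ a $ b else 0)"

text \<open>
  A gain gives for every quadrotor a matrix with 3 rows and columns labelled by coordinates.
  Stacking these matrices yields the matrix with rows labelled by \<^typ>\<open>'n \<times> 3\<close>.
\<close>

type_synonym 'n gain = "'n \<Rightarrow> 3 \<Rightarrow> 'n coord \<Rightarrow> real"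

definition stacked :: "'n gain \<Rightarrow> 'n \<times> 3 \<Rightarrow> 'n coord \<Rightarrow> real" where
  "stacked K = (\<lambda>(i, a). K i a)"

definition lin_input ::
  "'n plant \<Rightarrow> 'n gain \<Rightarrow> 'n gain \<Rightarrow> ('n coord \<Rightarrow> real) \<Rightarrow> ('n coord \<Rightarrow> real) \<Rightarrow> 'n \<times> 3 \<Rightarrow> real" where
  "lin_input P Kx Kv x v r =
     - mat_app (coords P) (stacked Kx) x r - mat_app (coords P) (stacked Kv) v r"

text \<open>\<open>v\<close> is the velocity of \<open>x\<close> and \<open>a\<close> its acceleration.\<close>

definition lin_solution ::
  "'n::finite plant \<Rightarrow> 'n gain \<Rightarrow> 'n gain \<Rightarrow>
   (real \<Rightarrow> 'n coord \<Rightarrow> real) \<Rightarrow> (real \<Rightarrow> 'n coord \<Rightarrow> real) \<Rightarrow> bool" where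
  "lin_solution P Kx Kv x v \<longleftrightarrow> (\<forall>t\<ge>0. \<exists>a.
     (\<forall>s\<in>coords P.
        ((\<lambda>\<tau>. x \<tau> s) has_real_derivative v t s) (at t within {0..}) \<and>
        ((\<lambda>\<tau>. v \<tau> s) has_real_derivative a s) (at t within {0..})) \<and>
     (\<forall>s\<in>coords P.
        mat_app (coords P) (Mmat P) a s + mat_app (coords P) (Gmat P) (x t) s
        = mat_app UNIV (Bmat P) (lin_input P Kx Kv (x t) (v t)) s))"

definition phase_norm :: "'n plant \<Rightarrow> ('n coord \<Rightarrow> real) \<Rightarrow> ('n coord \<Rightarrow> real) \<Rightarrow> real" where
  "phase_norm P x v = L2_set x (coords P) + L2_set v (coords P)"

definition lin_asymptotically_stable ::
  "'n::finite plant \<Rightarrow> 'n gain \<Rightarrow> 'n gain \<Rightarrow> bool" where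
  "lin_asymptotically_stable P Kx Kv \<longleftrightarrow>
     (\<forall>\<epsilon>>0. \<exists>\<delta>>0. \<forall>x v. lin_solution P Kx Kv x v \<longrightarrow> phase_norm P (x 0) (v 0) < \<delta> \<longrightarrow>
        (\<forall>t\<ge>0. phase_norm P (x t) (v t) < \<epsilon>)) \<and>
     (\<exists>\<delta>>0. \<forall>x v. lin_solution P Kx Kv x v \<longrightarrow> phase_norm P (x 0) (v 0) < \<delta> \<longrightarrow>
        ((\<lambda>t. phase_norm P (x t) (v t)) \<longlongrightarrow> 0) at_top)"


section \<open>Controller\<close>

definition eR0 :: "'n trajectory \<Rightarrow> real \<Rightarrow> real^3" where
  "eR0 T t = (1/2) *\<^sub>R vee (att0 T t - transpose (att0 T t))"

primrec state :: "real^3 \<Rightarrow> 'n trajectory \<Rightarrow> real \<Rightarrow> 'n coord \<Rightarrow> real" where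
  "state xd T t (Pos a) = (pos0 T t - xd) $ a"
| "state xd T t (Att a) = eR0 T t $ a"
| "state xd T t (Link i j a) = (transpose Cmat *v (e3 \<times> dirL T i j t)) $ a"

definition state_dot :: "real set \<Rightarrow> real^3 \<Rightarrow> 'n trajectory \<Rightarrow> real \<Rightarrow> 'n coord \<Rightarrow> real" where
  "state_dot S xd T t s = ddt S (\<lambda>\<tau>. state xd T \<tau> s) t"

definition force ::
  "'n::finite plant \<Rightarrow> 'n gain \<Rightarrow> 'n gain \<Rightarrow> 'n \<Rightarrow> ('n coord \<Rightarrow> real) \<Rightarrow> ('n coord \<Rightarrow> real) \<Rightarrow> real^3" where
  "force P Kx Kv i x v =
     - (\<chi> a. mat_app (coords P) (Kx i) x a) - (\<chi> a. mat_app (coords P) (Kv i) v a) + u_star P i"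

definition thrust_dir :: "real^3 \<Rightarrow> real^3" where
  "thrust_dir a = - (a /\<^sub>R norm a)"

lemma thrust_dir_equilibrium:
  assumes "admissible_plant P"
  shows "thrust_dir (force P Kx Kv i (\<lambda>_. 0) (\<lambda>_. 0)) = e3"
proof -
  have "MiT P i > 0"
    using assms unfolding admissible_plant_def MiT_def
    by (meson add_pos_nonneg less_imp_le sum_nonneg)
  define k where "k = (MiT P i + mass0 P / real CARD('a)) * grav P"
  have "k > 0"
    using assms \<open>MiT P i > 0\<close>
    by (auto simp: k_def admissible_plant_def intro!: mult_pos_pos add_pos_pos divide_pos_pos)
  moreover have "force P Kx Kv i (\<lambda>_. 0) (\<lambda>_. 0) = - (k *\<^sub>R e3)"
    unfolding force_def u_star_def k_def by (simp add: mat_app_def vec_eq_iff)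
  ultimately show ?thesis
    by (simp add: thrust_dir_def)
qed

text \<open>The matrix with columns built from the thrust direction \<open>b3\<close> and the heading \<open>b1\<close>.\<close>

definition attitude_of :: "real^3 \<Rightarrow> real^3 \<Rightarrow> real^3^3" where
  "attitude_of b3 b1 = (let c1 = (hat b3 ** hat b3) *v b1; c2 = hat b3 *v b1 in
     transpose (vector [- (c1 /\<^sub>R norm c1), c2 /\<^sub>R norm c2, b3]))"

record 'n controller =
  Kpos :: "'n gain"
  Kvel :: "'n gain"
  k_R :: real
  k_Omega :: real
  pos_cmd :: "real^3"
  heading :: "'n \<Rightarrow> real \<Rightarrow> real^3"

definition ctrl_force ::
  "'n::finite plant \<Rightarrow> 'n controller \<Rightarrow> real set \<Rightarrow> 'n trajectory \<Rightarrow> 'n \<Rightarrow> real \<Rightarrow> real^3" where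
  "ctrl_force P c S T i t =
     force P (Kpos c) (Kvel c) i (state (pos_cmd c) T t) (state_dot S (pos_cmd c) T t)"

definition Rc ::
  "'n::finite plant \<Rightarrow> 'n controller \<Rightarrow> real set \<Rightarrow> 'n trajectory \<Rightarrow> 'n \<Rightarrow> real \<Rightarrow> real^3^3" where
  "Rc P c S T i t = attitude_of (thrust_dir (ctrl_force P c S T i t)) (heading c i t)"

definition Omega_c ::
  "'n::finite plant \<Rightarrow> 'n controller \<Rightarrow> real set \<Rightarrow> 'n trajectory \<Rightarrow> 'n \<Rightarrow> real \<Rightarrow> real^3" where
  "Omega_c P c S T i t = vee (transpose (Rc P c S T i t) ** ddt S (Rc P c S T i) t)"

definition eR ::
  "'n::finite plant \<Rightarrow> 'n controller \<Rightarrow> real set \<Rightarrow> 'n trajectory \<Rightarrow> 'n \<Rightarrow> real \<Rightarrow> real^3" where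
  "eR P c S T i t = (1/2) *\<^sub>R
     vee (transpose (Rc P c S T i t) ** attQ T i t - transpose (attQ T i t) ** Rc P c S T i t)"

definition eOmega ::
  "'n::finite plant \<Rightarrow> 'n controller \<Rightarrow> real set \<Rightarrow> 'n trajectory \<Rightarrow> 'n \<Rightarrow> real \<Rightarrow> real^3" where
  "eOmega P c S T i t =
     angvQ T i t - (transpose (attQ T i t) ** Rc P c S T i t) *v Omega_c P c S T i t"

definition thrust_input ::
  "'n::finite plant \<Rightarrow> 'n controller \<Rightarrow> real set \<Rightarrow> 'n trajectory \<Rightarrow> real \<Rightarrow> 'n \<Rightarrow> real" where
  "thrust_input P c S T t i = - (ctrl_force P c S T i t \<bullet> (attQ T i t *v e3))"

definition moment_input ::
  "'n::finite plant \<Rightarrow> 'n controller \<Rightarrow> real set \<Rightarrow> 'n trajectory \<Rightarrow> real \<Rightarrow> 'n \<Rightarrow> real^3" where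
  "moment_input P c S T t i = (let Q = transpose (attQ T i t) ** Rc P c S T i t in
     - (k_R c *\<^sub>R eR P c S T i t) - k_Omega c *\<^sub>R eOmega P c S T i t
     + (hat (Q *v Omega_c P c S T i t) ** inertiaQ P i ** Q) *v Omega_c P c S T i t
     + (inertiaQ P i ** Q) *v ddt S (Omega_c P c S T i) t)"

text \<open>
  A closed-loop motion on \<open>S\<close>. The last conjunct requires the time derivatives of \<open>R\<^sub>i\<^sub>c\<close> and
  \<open>\<Omega>\<^sub>i\<^sub>c\<close> that occur in the moment to exist, so that the moment is meaningful.
\<close>

definition closed_loop ::
  "'n::finite plant \<Rightarrow> 'n controller \<Rightarrow> real set \<Rightarrow> 'n trajectory \<Rightarrow> bool" where
  "closed_loop P c S T \<longleftrightarrow>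
     full_model P S T (thrust_input P c S T) (moment_input P c S T) \<and>
     (\<forall>i. diff_on S (Rc P c S T i) \<and> diff_on S (Omega_c P c S T i))"

definition total_error ::
  "'n::finite plant \<Rightarrow> 'n controller \<Rightarrow> real set \<Rightarrow> 'n trajectory \<Rightarrow> real \<Rightarrow> real" where
  "total_error P c S T t =
     norm (pos0 T t - pos_cmd c) + norm (ddt S (\<lambda>\<tau>. pos0 T \<tau> - pos_cmd c) t)
     + norm (eR0 T t) + norm (angv0 T t)
     + (\<Sum>i\<in>UNIV. \<Sum>j\<in>links P i. norm (dirL T i j t - e3) + norm (angvL T i j t))
     + (\<Sum>i\<in>UNIV. norm (eR P c S T i t) + norm (eOmega P c S T i t))"

text \<open>
  The domains of motions starting at time \<open>t0\<close>. Bounded ones are included, so that a statement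
  about all of them also covers motions that might cease to exist in finite time.
\<close>

definition motion_interval :: "real \<Rightarrow> real set \<Rightarrow> bool" where
  "motion_interval t0 S \<longleftrightarrow> S = {t0..} \<or> (\<exists>t1>t0. S = {t0..<t1})"

text \<open>Infinite differentiability on \<open>[0, \<infinity>)\<close>.\<close>

definition smooth_command :: "(real \<Rightarrow> real^3) \<Rightarrow> bool" where
  "smooth_command b \<longleftrightarrow> (\<forall>k. diff_on {0..} ((ddt {0..} ^^ k) b))"

end

theory Submission
  imports Defs
begin

text \<open>
  In the coordinates of the linear system the payload and link dynamics read
  \<open>M a + G x = B \<delta>u + h\<close>, where \<open>h\<close> is of second order in the payload and link errors plus a
  term bounded by the attitude errors of the quadrotors, because a thrust misses the commanded
  force by at most twice the commanded magnitude times the attitude error. The matrix \<open>M\<close> is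
  invertible since it represents the kinetic energy, and the asymptotically stable linear closed
  loop has a quadratic Lyapunov function. For each quadrotor, kinetic energy plus attitude
  potential plus a small cross term decays, as the commanded angular velocities are bounded near
  the equilibrium. A weighted sum \<open>W\<close> of these functions is equivalent to the squared total error
  and satisfies \<open>W' \<le> - 2 r W\<close> as long as the error is small; a continuity argument shows that it
  stays small.
\<close>


section \<open>Linear systems on a finite index set\<close>

text \<open>The number of coordinates depends on the plant and not on a type; linear algebra, the
  matrix exponential and the Lyapunov equation are therefore developed for functions on a finite set
  of labels. The equations of motion are implicit in the accelerations, so \<open>h\<close> contains
  products of deviations with accelerations. Bounding \<open>h\<close> needs a bound on the
  accelerations, which in turn needs \<open>h\<close>; the circle is broken by absorbing these
  products when the deviation is small. To leading order the coupling runs one way: attitude errors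
  of the quadrotors disturb the payload at first order, whereas the payload motion affects the decay
  of the attitude errors only through a bound on the commanded angular velocities. This is why large
  weights on the attitude functions suffice. Attitudes are measured by the distance to the identity
  and not by the error vectors, which vanish at half turns as well. The trace conditions at the
  initial time compare the two measures; afterwards the smallness of the distance itself is
  propagated.\<close>

lemma underdetermined_system:
  fixes A :: "'r \<Rightarrow> 'c \<Rightarrow> real"
  assumes "finite F" "finite I" "card F < card I"
  shows "\<exists>x. (\<exists>c\<in>I. x c \<noteq> 0) \<and> (\<forall>r\<in>F. (\<Sum>c\<in>I. A r c * x c) = 0)"
  using assms
proof (induction F arbitrary: I A rule: finite_induct)
  case empty
  then obtain c where "c \<in> I" by fastforce
  then show ?case by (intro exI[of _ "\<lambda>_. 1"]) auto
next
  case (insert r F)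
  show ?case
  proof (cases "\<forall>c\<in>I. A r c = 0")
    case True
    have "card F < card I" using insert by simp
    from insert.IH[OF insert.prems(1) this, of A] obtain x where
      "\<exists>c\<in>I. x c \<noteq> 0" "\<forall>r\<in>F. (\<Sum>c\<in>I. A r c * x c) = 0" by blast
    with True show ?thesis by (intro exI[of _ x]) auto
  next
    case False
    then obtain c0 where c0: "c0 \<in> I" "A r c0 \<noteq> 0" by blast
    let ?J = "I - {c0}"
    \<comment> \<open>Gaussian elimination with pivot \<open>A r c0\<close>: the other rows lose the
      unknown \<open>c0\<close>, so there is one equation and one unknown less.\<close>
    define B where "B r' c = A r' c - A r' c0 * A r c / A r c0" for r' c
    have "card F < card ?J" using insert c0 by simp
    from insert.IH[of ?J B] this insert.prems obtain y where
      y: "\<exists>c\<in>?J. y c \<noteq> 0" "\<forall>r'\<in>F. (\<Sum>c\<in>?J. B r' c * y c) = 0" by blast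
    define s where "s = (\<Sum>c\<in>?J. A r c * y c)"
    \<comment> \<open>The value at \<open>c0\<close> is the one that makes row \<open>r\<close>
      vanish.\<close>
    define x where "x = y(c0 := - s / A r c0)"
    have split: "(\<Sum>c\<in>I. A r' c * x c) = A r' c0 * (- s / A r c0) + (\<Sum>c\<in>?J. A r' c * y c)" for r'
      by (subst sum.remove[OF insert.prems(1) c0(1)]) (auto simp: x_def intro!: sum.cong)
    have "(\<Sum>c\<in>?J. B r' c * y c) = (\<Sum>c\<in>?J. A r' c * y c) - A r' c0 / A r c0 * s" for r'
      by (simp add: B_def s_def sum_subtractf sum_distrib_left algebra_simps)
    then have "(\<Sum>c\<in>I. A r' c * x c) = 0" if "r' \<in> F" for r'
      using y(2) that by (simp add: split)
    moreover have "(\<Sum>c\<in>I. A r c * x c) = 0"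
      using c0(2) by (simp add: split s_def)
    moreover have "\<exists>c\<in>I. x c \<noteq> 0"
      using y(1) by (auto simp: x_def)
    ultimately show ?thesis by blast
  qed
qed

text \<open>With the negated right-hand side as an extra column, labelled \<open>None\<close>, the
  system is underdetermined. By injectivity a nontrivial solution has a nonzero entry at that
  column, and dividing by this entry solves the original system.\<close>

lemma injective_system_solvable:
  fixes A :: "'c \<Rightarrow> 'c \<Rightarrow> real"
  assumes I: "finite I"
    and inj: "\<And>x. (\<And>r. r \<in> I \<Longrightarrow> mat_app I A x r = 0) \<Longrightarrow> \<forall>c\<in>I. x c = 0"
  shows "\<exists>x. \<forall>r\<in>I. mat_app I A x r = b r"
proof -
  let ?I = "insert None (Some ` I)"
  let ?A = "\<lambda>r c. case c of None \<Rightarrow> - b r | Some d \<Rightarrow> A r d"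
  have fin: "finite ?I" using I by simp
  have "card I < card ?I" using I by (simp add: card_insert_if card_image)
  from underdetermined_system[OF I fin this, of ?A] obtain x where
    x: "\<exists>c\<in>?I. x c \<noteq> 0" "\<forall>r\<in>I. (\<Sum>c\<in>?I. ?A r c * x c) = 0" by blast
  have eq: "mat_app I A (x \<circ> Some) r = b r * x None" if "r \<in> I" for r
    using x(2)[rule_format, OF that] I
    by (simp add: mat_app_def sum.reindex image_iff)
  have "x None \<noteq> 0"
  proof
    assume 0: "x None = 0"
    have "\<forall>c\<in>I. (x \<circ> Some) c = 0" by (rule inj) (use 0 in \<open>simp add: eq del: o_apply comp_apply\<close>)
    with x(1) 0 show False by auto
  qed
  then have "mat_app I A (\<lambda>c. x (Some c) / x None) r = b r" if "r \<in> I" for r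
    using eq[OF that] by (simp add: mat_app_def sum_divide_distrib[symmetric] field_simps)
  then show ?thesis by (intro exI[of _ "\<lambda>c. x (Some c) / x None"]) blast
qed

text \<open>The columns of \<open>N\<close> solve the system for the unit vectors, which makes
  \<open>N\<close> a right inverse; injectivity turns it into a left inverse.\<close>

lemma injective_system_inverse:
  fixes A :: "'c \<Rightarrow> 'c \<Rightarrow> real"
  assumes I: "finite I"
    and inj: "\<And>x. (\<And>r. r \<in> I \<Longrightarrow> mat_app I A x r = 0) \<Longrightarrow> \<forall>c\<in>I. x c = 0"
  obtains N where "\<And>x c. c \<in> I \<Longrightarrow> mat_app I N (mat_app I A x) c = x c"
    and "\<And>b r. r \<in> I \<Longrightarrow> mat_app I A (mat_app I N b) r = b r"
proof -
  have "\<forall>s. \<exists>x. \<forall>r\<in>I. mat_app I A x r = (if r = s then 1 else 0)"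
    by (rule allI, rule injective_system_solvable[OF I]) (rule inj)
  then obtain y where y: "\<And>s r. r \<in> I \<Longrightarrow> mat_app I A (y s) r = (if r = s then 1 else 0)"
    by metis
  define N where "N c s = y s c" for c s
  have right: "mat_app I A (mat_app I N b) r = b r" if r: "r \<in> I" for b r
  proof -
    have "mat_app I A (mat_app I N b) r = (\<Sum>c\<in>I. \<Sum>s\<in>I. A r c * (y s c * b s))"
      by (simp add: mat_app_def N_def sum_distrib_left)
    also have "\<dots> = (\<Sum>s\<in>I. mat_app I A (y s) r * b s)"
      by (subst sum.swap) (simp add: mat_app_def sum_distrib_left sum_distrib_right mult_ac)
    also have "\<dots> = (\<Sum>s\<in>I. if r = s then b s else 0)"
      using r by (intro sum.cong) (auto simp: y)
    finally show ?thesis using r I by simp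
  qed
  have left: "mat_app I N (mat_app I A x) c = x c" if c: "c \<in> I" for x c
  proof -
    let ?d = "\<lambda>c. mat_app I N (mat_app I A x) c - x c"
    have "mat_app I A ?d r = 0" if "r \<in> I" for r
      using right[OF that, of "mat_app I A x"]
      by (simp add: mat_app_def right_diff_distrib sum_subtractf)
    then have "\<forall>c\<in>I. ?d c = 0" by (rule inj)
    with c show ?thesis by simp
  qed
  show ?thesis using that left right by blast
qed

text \<open>The solution is the power series of \<open>exp (t A) z0\<close>: \<open>p k\<close> is
  \<open>A^k z0\<close>, and the sum \<open>a\<close> of the absolute entries bounds its growth by
  \<open>a ^ k\<close>, so that the series converges for every \<open>t\<close>.\<close>

lemma linear_ode_solution_exists:
  fixes A :: "'c \<Rightarrow> 'c \<Rightarrow> real"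
  assumes I: "finite I"
  obtains z where "\<And>c. z 0 c = z0 c"
    and "\<And>t c. c \<in> I \<Longrightarrow> ((\<lambda>t. z t c) has_real_derivative mat_app I A (z t) c) (at t)"
proof -
  define p where "p k = (mat_app I A ^^ k) z0" for k
  define a where "a = (\<Sum>c\<in>I. \<Sum>d\<in>I. \<bar>A c d\<bar>)"
  define b where "b = (\<Sum>c\<in>I. \<bar>z0 c\<bar>)"
  have pSuc: "p (Suc k) = mat_app I A (p k)" for k by (simp add: p_def)
  have b0: "b \<ge> 0" and a0: "a \<ge> 0" by (simp_all add: b_def a_def sum_nonneg)
  have bound: "\<forall>c\<in>I. \<bar>p k c\<bar> \<le> a ^ k * b" for k
  proof (induction k)
    case 0
    show ?case using I by (auto simp: p_def b_def intro: member_le_sum)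
  next
    case (Suc k)
    show ?case
    proof
      fix c assume c: "c \<in> I"
      have "\<bar>p (Suc k) c\<bar> \<le> (\<Sum>d\<in>I. \<bar>A c d\<bar> * \<bar>p k d\<bar>)"
        unfolding pSuc mat_app_def by (rule order_trans[OF sum_abs]) (simp add: abs_mult)
      also have "\<dots> \<le> (\<Sum>d\<in>I. \<bar>A c d\<bar> * (a ^ k * b))"
        using Suc by (intro sum_mono mult_left_mono) auto
      also have "\<dots> = (\<Sum>d\<in>I. \<bar>A c d\<bar>) * (a ^ k * b)" by (simp add: sum_distrib_right)
      also have "\<dots> \<le> a * (a ^ k * b)"
        using I c a0 b0 unfolding a_def
        by (intro mult_right_mono member_le_sum[where f = "\<lambda>c. \<Sum>d\<in>I. \<bar>A c d\<bar>"])
          (auto intro!: sum_nonneg mult_nonneg_nonneg)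
      finally show "\<bar>p (Suc k) c\<bar> \<le> a ^ Suc k * b" by (simp add: mult_ac)
    qed
  qed
  have sm: "summable (\<lambda>k. p k c / fact k * t ^ k)" if c: "c \<in> I" for c t
  proof (rule summable_comparison_test[OF _ summable_mult[OF summable_exp[of "a * \<bar>t\<bar>"], of b]],
      intro exI allI impI)
    fix k :: nat
    have "norm (p k c / fact k * t ^ k) = \<bar>p k c\<bar> * (inverse (fact k) * \<bar>t\<bar> ^ k)"
      by (simp add: abs_mult power_abs field_simps)
    also have "\<dots> \<le> (a ^ k * b) * (inverse (fact k) * \<bar>t\<bar> ^ k)"
      using bound c by (intro mult_right_mono) auto
    finally show "norm (p k c / fact k * t ^ k) \<le> b * (inverse (fact k) * (a * \<bar>t\<bar>) ^ k)"
      by (simp add: power_mult_distrib mult_ac)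
  qed
  define z where "z t c = (\<Sum>k. p k c / fact k * t ^ k)" for t c
  have z0: "z 0 c = z0 c" for c
    using suminf_finite[of "{0::nat}" "\<lambda>k. p k c / fact k * 0 ^ k"] by (simp add: z_def p_def)
  have "((\<lambda>t. z t c) has_real_derivative mat_app I A (z t) c) (at t)" if c: "c \<in> I" for t c
  proof -
    have "((\<lambda>t. z t c) has_real_derivative (\<Sum>k. diffs (\<lambda>k. p k c / fact k) k * t ^ k)) (at t)"
      unfolding z_def by (rule termdiffs_strong_converges_everywhere) (rule sm[OF c])
    moreover have "diffs (\<lambda>k. p k c / fact k) k * t ^ k = (\<Sum>d\<in>I. A c d * (p k d / fact k * t ^ k))" for k
      by (simp add: diffs_def pSuc mat_app_def sum_divide_distrib sum_distrib_left sum_distrib_right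
          field_simps del: of_nat_Suc)
    moreover have "(\<Sum>k. \<Sum>d\<in>I. A c d * (p k d / fact k * t ^ k)) = mat_app I A (z t) c"
      unfolding mat_app_def z_def
      by (subst suminf_sum) (auto intro!: sum.cong suminf_mult summable_mult sm simp del: times_divide_eq_left times_divide_eq_right)
    ultimately show ?thesis by (simp only:)
  qed
  with z0 show ?thesis using that by blast
qed

text \<open>Serves to bound a quadratic form from below: along a decaying solution the form tends to
  0, and if it decreases on the way it must have started nonnegative.\<close>

lemma decreasing_to_zero_nonneg:
  fixes f :: "real \<Rightarrow> real"
  assumes der: "\<And>t. t \<ge> 0 \<Longrightarrow> (f has_real_derivative f' t) (at t)"
    and le: "\<And>t. t \<ge> 0 \<Longrightarrow> f' t \<le> 0"
    and lim: "(f \<longlongrightarrow> 0) at_top"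
  shows "f 0 \<ge> 0"
proof -
  have "f t \<le> f 0" if "t \<ge> 0" for t
    by (rule DERIV_nonpos_imp_nonincreasing[OF that]) (use der le in blast)
  then have "eventually (\<lambda>t. f t \<le> f 0) at_top"
    using eventually_ge_at_top[of 0] by (rule eventually_mono[rotated])
  then show ?thesis by (rule tendsto_upperbound[OF lim]) simp
qed

section \<open>Bilinear forms and the Lyapunov equation\<close>

definition bilin :: "'c set \<Rightarrow> ('c \<Rightarrow> 'c \<Rightarrow> real) \<Rightarrow> ('c \<Rightarrow> real) \<Rightarrow> ('c \<Rightarrow> real) \<Rightarrow> real" where
  "bilin I H x y = (\<Sum>c\<in>I. \<Sum>d\<in>I. H c d * x c * y d)"

lemma bilin_has_derivative:
  assumes "\<And>c. c \<in> I \<Longrightarrow> ((\<lambda>t. x t c) has_real_derivative x' c) (at t within S)"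
    and "\<And>c. c \<in> I \<Longrightarrow> ((\<lambda>t. y t c) has_real_derivative y' c) (at t within S)"
  shows "((\<lambda>t. bilin I H (x t) (y t)) has_real_derivative
    bilin I H x' (y t) + bilin I H (x t) y') (at t within S)"
proof -
  have "((\<lambda>t. \<Sum>c\<in>I. \<Sum>d\<in>I. H c d * x t c * y t d) has_real_derivative
    (\<Sum>c\<in>I. \<Sum>d\<in>I. H c d * x' c * y t d + H c d * x t c * y' d)) (at t within S)"
    by (intro DERIV_sum) (auto intro!: derivative_eq_intros assms simp: algebra_simps)
  then show ?thesis by (simp add: bilin_def sum.distrib)
qed

lemma bilin_add_left: "bilin I H (\<lambda>c. x c + y c) z = bilin I H x z + bilin I H y z"
  by (simp add: bilin_def algebra_simps sum.distrib)

lemma bilin_add_right: "bilin I H z (\<lambda>c. x c + y c) = bilin I H z x + bilin I H z y"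
  by (simp add: bilin_def algebra_simps sum.distrib)

lemma bilin_cong:
  "(\<And>c. c \<in> I \<Longrightarrow> x c = x' c) \<Longrightarrow> (\<And>c. c \<in> I \<Longrightarrow> y c = y' c) \<Longrightarrow> bilin I H x y = bilin I H x' y'"
  by (simp add: bilin_def)

lemma bilin_bound:
  assumes I: "finite I"
  shows "\<bar>bilin I H x y\<bar> \<le> (\<Sum>c\<in>I. \<Sum>d\<in>I. \<bar>H c d\<bar>) * L2_set x I * L2_set y I"
proof -
  have mem: "\<bar>f c\<bar> \<le> L2_set f I" if "c \<in> I" for f c
    using member_le_L2_set[OF I that, of "\<lambda>c. \<bar>f c\<bar>"] by (simp add: L2_set_def)
  have "\<bar>bilin I H x y\<bar> \<le> (\<Sum>c\<in>I. \<Sum>d\<in>I. \<bar>H c d * x c * y d\<bar>)"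
    unfolding bilin_def by (rule order_trans[OF sum_abs]) (intro sum_mono sum_abs)
  also have "\<dots> \<le> (\<Sum>c\<in>I. \<Sum>d\<in>I. \<bar>H c d\<bar> * L2_set x I * L2_set y I)"
    by (intro sum_mono) (auto simp: abs_mult intro!: mult_mono mem)
  finally show ?thesis by (simp add: sum_distrib_right)
qed

lemma bilin_delta:
  assumes "finite I" "c \<in> I" "d \<in> I"
  shows "bilin I H (\<lambda>e. if e = c then 1 else 0) (\<lambda>e. if e = d then 1 else 0) = H c d"
proof -
  have "bilin I H (\<lambda>e. if e = c then 1 else 0) (\<lambda>e. if e = d then 1 else 0)
    = (\<Sum>e\<in>I. \<Sum>f\<in>I. if f = d then (if e = c then H e f else 0) else 0)"
    unfolding bilin_def by (intro sum.cong) auto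
  then show ?thesis using assms by simp
qed

text \<open>The matrix on the right is \<open>A^T H + H A\<close> in entries; the left side is the
  derivative of the form along two solutions of \<open>z' = A z\<close>.\<close>

lemma bilin_mat_app:
  assumes I: "finite I"
  shows "bilin I H (mat_app I A x) y + bilin I H x (mat_app I A y)
    = bilin I (\<lambda>c d. \<Sum>e\<in>I. A e c * H e d + H c e * A e d) x y"
proof -
  have "bilin I H (mat_app I A x) y = (\<Sum>e\<in>I. \<Sum>d\<in>I. \<Sum>c\<in>I. A e c * H e d * x c * y d)"
    by (simp add: bilin_def mat_app_def sum_distrib_left sum_distrib_right mult_ac)
  also have "\<dots> = (\<Sum>d\<in>I. \<Sum>e\<in>I. \<Sum>c\<in>I. A e c * H e d * x c * y d)"
    by (rule sum.swap)
  also have "\<dots> = (\<Sum>d\<in>I. \<Sum>c\<in>I. \<Sum>e\<in>I. A e c * H e d * x c * y d)"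
    by (intro sum.cong refl sum.swap)
  also have "\<dots> = (\<Sum>c\<in>I. \<Sum>d\<in>I. \<Sum>e\<in>I. A e c * H e d * x c * y d)"
    by (rule sum.swap)
  finally have 1: "bilin I H (mat_app I A x) y = \<dots>" .
  have "bilin I H x (mat_app I A y) = (\<Sum>c\<in>I. \<Sum>e\<in>I. \<Sum>d\<in>I. H c e * A e d * x c * y d)"
    by (simp add: bilin_def mat_app_def sum_distrib_left sum_distrib_right mult_ac)
  also have "\<dots> = (\<Sum>c\<in>I. \<Sum>d\<in>I. \<Sum>e\<in>I. H c e * A e d * x c * y d)"
    by (intro sum.cong refl sum.swap)
  finally have 2: "bilin I H x (mat_app I A y) = \<dots>" .
  show ?thesis unfolding 1 2
    by (simp add: bilin_def sum_distrib_right sum.distrib[symmetric] distrib_right)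
qed

text \<open>The equation \<open>A^T H + H A = - I\<close> together with positive definiteness. Only
  the quadratic form is constrained, so \<open>H\<close> is not asked to be symmetric.\<close>

definition lyapunov_form :: "'c set \<Rightarrow> ('c \<Rightarrow> 'c \<Rightarrow> real) \<Rightarrow> ('c \<Rightarrow> 'c \<Rightarrow> real) \<Rightarrow> bool" where
  "lyapunov_form I A H \<longleftrightarrow>
     (\<exists>p>0. \<forall>z. p * (L2_set z I)\<^sup>2 \<le> bilin I H z z) \<and>
     (\<forall>z. bilin I H (mat_app I A z) z + bilin I H z (mat_app I A z) = - (L2_set z I)\<^sup>2)"

text \<open>
  The Lyapunov equation is a square linear system for \<open>H\<close>, so it is solvable because its
  homogeneous version is only solved by forms that are constant, hence zero, along decaying solutions.
\<close>

theorem lyapunov_form_exists: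
  fixes A :: "'c \<Rightarrow> 'c \<Rightarrow> real"
  assumes I: "finite I"
    and decay: "\<And>z. (\<And>t c. t \<ge> 0 \<Longrightarrow> c \<in> I \<Longrightarrow>
        ((\<lambda>t. z t c) has_real_derivative mat_app I A (z t) c) (at t)) \<Longrightarrow>
        \<forall>c\<in>I. ((\<lambda>t. z t c) \<longlongrightarrow> 0) at_top"
  obtains H where "lyapunov_form I A H"
proof -
  define Lop where "Lop H c d = (\<Sum>e\<in>I. A e c * H e d + H c e * A e d)" for H c d
  have Lop: "bilin I H (mat_app I A x) y + bilin I H x (mat_app I A y) = bilin I (Lop H) x y" for H x y
    unfolding Lop_def by (rule bilin_mat_app[OF I])
  have bilin_lim: "((\<lambda>t. bilin I H (z t) (y t)) \<longlongrightarrow> 0) at_top"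
    if "\<And>c. c \<in> I \<Longrightarrow> ((\<lambda>t. z t c) \<longlongrightarrow> 0) at_top" "\<And>c. c \<in> I \<Longrightarrow> ((\<lambda>t. y t c) \<longlongrightarrow> 0) at_top"
    for H z y
    unfolding bilin_def using that
    by (intro tendsto_null_sum tendsto_mult_zero tendsto_mult_right_zero)
  \<comment> \<open>The matrix of the linear map taking \<open>H\<close> to
    \<open>A^T H + H A\<close>, with rows and columns labelled by pairs, so that the solvability
    criterion for square systems applies to it.\<close>
  define K where "K = (\<lambda>(c, d) (e, f). A e c * (if f = d then 1 else 0) + (if e = c then 1 else 0) * A f d)"
  have K: "mat_app ((SIGMA c:I. I)) K h (c, d) = Lop (\<lambda>e f. h (e, f)) c d" if "c \<in> I" "d \<in> I" for h c d
  proof -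
    have "mat_app ((SIGMA c:I. I)) K h (c, d) = (\<Sum>e\<in>I. \<Sum>f\<in>I. (if f = d then A e c * h (e, f) else 0)
        + (if e = c then A f d * h (e, f) else 0))"
      unfolding mat_app_def K_def sum.cartesian_product
      by (intro sum.cong refl) (auto simp: distrib_right split: prod.splits)
    also have "\<dots> = (\<Sum>e\<in>I. A e c * h (e, d)) + (\<Sum>f\<in>I. A f d * h (c, f))"
    proof -
      have "(\<Sum>e\<in>I. \<Sum>f\<in>I. if e = c then A f d * h (e, f) else 0)
        = (\<Sum>e\<in>I. if e = c then (\<Sum>f\<in>I. A f d * h (e, f)) else 0)"
        by (intro sum.cong) auto
      then show ?thesis using that I by (simp add: sum.distrib)
    qed
    finally show ?thesis by (simp add: Lop_def sum.distrib mult_ac)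
  qed
  have inj: "\<forall>p\<in>(SIGMA c:I. I). h p = 0" if h: "\<And>r. r \<in> (SIGMA c:I. I) \<Longrightarrow> mat_app ((SIGMA c:I. I)) K h r = 0" for h
  proof clarify
    fix c d assume cd: "c \<in> I" "d \<in> I"
    let ?H = "\<lambda>e f. h (e, f)"
    have L0: "bilin I (Lop ?H) x y = 0" for x y
      unfolding bilin_def by (intro sum.neutral ballI) (use h K in auto)
    \<comment> \<open>Two solutions start at the unit vectors \<open>c\<close> and \<open>d\<close>.
      The form evaluated on them is constant, equals \<open>h (c, d)\<close> at time 0 and tends to
      0.\<close>
    obtain z where z: "\<And>e. z 0 e = (if e = c then 1 else 0)"
      "\<And>t e. e \<in> I \<Longrightarrow> ((\<lambda>t. z t e) has_real_derivative mat_app I A (z t) e) (at t)"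
      using linear_ode_solution_exists[OF I, of "\<lambda>e. if e = c then 1 else 0" A] by blast
    obtain y where y: "\<And>e. y 0 e = (if e = d then 1 else 0)"
      "\<And>t e. e \<in> I \<Longrightarrow> ((\<lambda>t. y t e) has_real_derivative mat_app I A (y t) e) (at t)"
      using linear_ode_solution_exists[OF I, of "\<lambda>e. if e = d then 1 else 0" A] by blast
    let ?f = "\<lambda>t. bilin I ?H (z t) (y t)"
    have "(?f has_real_derivative 0) (at t)" for t
      using bilin_has_derivative[of I z "mat_app I A (z t)" t UNIV y "mat_app I A (y t)" ?H] z(2) y(2)
      by (simp add: Lop L0)
    then have const: "?f = (\<lambda>t. ?f 0)"
      by (intro ext DERIV_isconst_all) blast
    have "(?f \<longlongrightarrow> 0) at_top"
      using decay z(2) y(2) by (intro bilin_lim) auto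
    then have "((\<lambda>t::real. ?f 0) \<longlongrightarrow> 0) at_top"
      using const by metis
    then have "?f 0 = 0" by (subst (asm) tendsto_const_iff) auto
    then show "h (c, d) = 0" using bilin_delta[OF I cd, of ?H] by (simp add: z(1) y(1) bilin_def)
  qed
  obtain h where h: "\<forall>r\<in>(SIGMA c:I. I). mat_app ((SIGMA c:I. I)) K h r = (case r of (c, d) \<Rightarrow> if c = d then - 1 else 0)"
    using injective_system_solvable[of "(SIGMA c:I. I)" K] inj I by blast
  define H where "H c d = h (c, d)" for c d
  have LH: "bilin I (Lop H) z z = - (L2_set z I)\<^sup>2" for z
  proof -
    have "bilin I (Lop H) z z = (\<Sum>c\<in>I. \<Sum>d\<in>I. if d = c then - (z c)\<^sup>2 else 0)"
      unfolding bilin_def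
    proof (intro sum.cong refl)
      fix c d assume cd: "c \<in> I" "d \<in> I"
      have "Lop H c d = (if c = d then - 1 else 0)"
        using h[rule_format, of "(c, d)"] cd by (simp add: K H_def[abs_def])
      then show "Lop H c d * z c * z d = (if d = c then - (z c)\<^sup>2 else 0)"
        by (simp add: power2_eq_square)
    qed
    then show ?thesis using I
      by (simp add: L2_set_def sum_negf sum_nonneg)
  qed
  \<comment> \<open>\<open>a\<close> exceeds the rate at which the squared norm can shrink along a
    solution. Hence the form minus \<open>1 / a\<close> times the squared norm is nonincreasing and
    tends to 0, so it is nonnegative at the start.\<close>
  define a where "a = 1 + 2 * (\<Sum>c\<in>I. \<Sum>d\<in>I. \<bar>A c d\<bar>)"
  have a: "a > 0" unfolding a_def by (intro add_pos_nonneg) (auto intro!: sum_nonneg)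
  have low: "(1 / a) * (L2_set z0 I)\<^sup>2 \<le> bilin I H z0 z0" for z0
  proof -
    obtain z where z: "\<And>e. z 0 e = z0 e"
      "\<And>t e. e \<in> I \<Longrightarrow> ((\<lambda>t. z t e) has_real_derivative mat_app I A (z t) e) (at t)"
      using linear_ode_solution_exists[OF I] by blast
    define one :: "'c \<Rightarrow> 'c \<Rightarrow> real" where "one c d = (if c = d then 1 else 0)" for c d
    have one: "bilin I one x y = (\<Sum>c\<in>I. x c * y c)" for x y
    proof -
      have "bilin I one x y = (\<Sum>c\<in>I. \<Sum>d\<in>I. if d = c then x c * y c else 0)"
        unfolding bilin_def one_def by (intro sum.cong) auto
      then show ?thesis using I by simp
    qed
    have one2: "bilin I one x x = (L2_set x I)\<^sup>2" for x
      by (simp add: one L2_set_def sum_nonneg power2_eq_square)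
    let ?f = "\<lambda>t. bilin I H (z t) (z t) - (1 / a) * bilin I one (z t) (z t)"
    let ?f' = "\<lambda>t. - (L2_set (z t) I)\<^sup>2 - (1 / a) * (2 * bilin I one (z t) (mat_app I A (z t)))"
    have "?f 0 \<ge> 0"
    proof (rule decreasing_to_zero_nonneg[where f' = ?f'])
      fix t :: real
      have sym: "bilin I one (mat_app I A (z t)) (z t) = bilin I one (z t) (mat_app I A (z t))"
        by (simp add: one mult_ac)
      have B: "((\<lambda>t. bilin I G (z t) (z t)) has_real_derivative
          bilin I G (mat_app I A (z t)) (z t) + bilin I G (z t) (mat_app I A (z t))) (at t)" for G
        by (rule bilin_has_derivative) (rule z(2), assumption)+
      show "(?f has_real_derivative ?f' t) (at t)"
        using DERIV_diff[OF B[of H] DERIV_cmult[OF B[of one], of "1 / a"]] by (simp add: Lop LH sym)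
      have "bilin I one (z t) (mat_app I A (z t)) = bilin I (\<lambda>c d. A c d) (z t) (z t)"
        unfolding one by (simp add: bilin_def mat_app_def sum_distrib_left mult_ac)
      moreover have "\<bar>bilin I A (z t) (z t)\<bar> \<le> (a - 1) / 2 * (L2_set (z t) I)\<^sup>2"
        using bilin_bound[OF I, of A "z t" "z t"] unfolding a_def
        by (simp add: power2_eq_square mult.assoc)
      ultimately have "- (2 * bilin I one (z t) (mat_app I A (z t))) \<le> (a - 1) * (L2_set (z t) I)\<^sup>2"
        by linarith
      also have "\<dots> \<le> a * (L2_set (z t) I)\<^sup>2" by (intro mult_right_mono) auto
      finally show "?f' t \<le> 0" using a by (simp add: field_simps)
    next
      have "(?f \<longlongrightarrow> 0 - (1 / a) * 0) at_top"
        using decay z(2) by (intro tendsto_diff tendsto_mult_left bilin_lim) auto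
      then show "(?f \<longlongrightarrow> 0) at_top" by simp
    qed
    then show ?thesis
      using z(1) bilin_cong[of I "z 0" z0 "z 0" z0] by (simp add: one2[symmetric])
  qed
  have "lyapunov_form I A H"
    unfolding lyapunov_form_def
  proof (intro conjI exI[of _ "1 / a"] allI)
    show "1 / a > 0" using a by simp
  qed (use low LH Lop in auto)
  then show ?thesis using that by blast
qed

section \<open>The linear system in vector form\<close>

declare transpose_matrix_vector [simp del]

definition posv :: "('n coord \<Rightarrow> real) \<Rightarrow> real^3" where "posv a = (\<chi> b. a (Pos b))"
definition attv :: "('n coord \<Rightarrow> real) \<Rightarrow> real^3" where "attv a = (\<chi> b. a (Att b))"
definition linkv :: "('n coord \<Rightarrow> real) \<Rightarrow> 'n \<Rightarrow> nat \<Rightarrow> real^2" where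
  "linkv a i j = (\<chi> b. a (Link i j b))"

text \<open>The horizontal vector \<open>u\<close> with \<open>C^T (e3 x u) = s\<close>. Link
  coordinates have the form of the right-hand side, so this recovers from them the horizontal
  displacement of a link.\<close>

definition horiz :: "real^2 \<Rightarrow> real^3" where "horiz s = - (e3 \<times> (Cmat *v s))"

lemma transpose_hat: "transpose (hat x) = - hat x"
  by (simp add: hat_def matrix_def transpose_def cross3_def axis_def vec_eq_iff forall_3)

lemma Cmat_mult: "Cmat *v s = vector [s $ 1, s $ 2, 0]"
  by (simp add: Cmat_def matrix_vector_mult_def transpose_def vec_eq_iff forall_3 sum_2 axis_def)

lemma Cmat_transpose_mult: "transpose Cmat *v v = vector [v $ 1, v $ 2]"
  by (simp add: Cmat_def matrix_vector_mult_def vec_eq_iff forall_2 sum_3 axis_def)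

lemma horiz_eq: "horiz s = vector [s $ 2, - s $ 1, 0]"
  by (simp add: horiz_def Cmat_mult cross3_def axis_def vec_eq_iff forall_3)

lemma sum_coords:
  fixes P :: "'n::finite plant"
  shows "sum f (coords P) = (\<Sum>b\<in>UNIV. f (Pos b)) + (\<Sum>b\<in>UNIV. f (Att b))
    + (\<Sum>i\<in>UNIV. \<Sum>j\<in>links P i. \<Sum>b\<in>UNIV. f (Link i j b))"
proof -
  let ?L = "SIGMA i:(UNIV::'n set). SIGMA j:links P i. (UNIV::2 set)"
  let ?h = "\<lambda>(i, j, a). Link i j a"
  have fin: "finite (?h ` ?L)" by (intro finite_imageI finite_SigmaI) auto
  have "sum f (coords P) = sum f (range Pos \<union> range Att) + sum f (?h ` ?L)"
    unfolding coords_eq_image using fin by (intro sum.union_disjoint) auto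
  also have "sum f (range Pos \<union> range Att) = sum f (range Pos) + sum f (range Att)"
    by (intro sum.union_disjoint) auto
  also have "sum f (?h ` ?L) = sum (f \<circ> ?h) ?L"
    by (rule sum.reindex) (auto simp: inj_on_def)
  also have "\<dots> = (\<Sum>i\<in>UNIV. \<Sum>j\<in>links P i. \<Sum>b\<in>UNIV. f (Link i j b))"
    by (simp add: sum.Sigma split_def comp_def)
  finally show ?thesis by (simp add: sum.reindex inj_on_def)
qed

lemma matrix_vector_mult_component:
  fixes A :: "real^'c^'r"
  shows "(\<Sum>b\<in>UNIV. A $ r $ b * x b) = (A *v (\<chi> b. x b)) $ r"
  by (simp add: matrix_vector_mult_def)

lemmas mat_vec_simps = matrix_vector_mul_assoc[symmetric] hat_mult scaleR_matrix_vector_assoc[symmetric]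
  matrix_vector_mult_diff_rdistrib matrix_vector_mult_add_rdistrib

lemma matrix_vector_mult_uminus_left: "(- A) *v x = - (A *v (x :: real^'c))"
  by (simp add: matrix_vector_mult_def vec_eq_iff sum_negf)

lemma matrix_vector_mult_sum_left:
  "(\<Sum>i\<in>I. A i) *v (x :: real^'c) = (\<Sum>i\<in>I. A i *v x)"
  by (induction I rule: infinite_finite_induct) (simp_all add: matrix_vector_mult_add_rdistrib)

text \<open>The rows of the block matrix are restated with cross products, the form in which the
  equations of motion will be linearized; the link block \<open>hat e3 ** Cmat\<close> turns into
  minus \<open>horiz\<close>.\<close>

lemma mass_matrix_Pos:
  "mat_app (coords P) (Mmat P) a (Pos r) = (MT P *\<^sub>R posv a
     - (\<Sum>i\<in>UNIV. MiT P i *\<^sub>R (rho P i \<times> attv a))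
     - (\<Sum>i\<in>UNIV. \<Sum>j\<in>links P i. (M0 P i j * llink P i j) *\<^sub>R horiz (linkv a i j))) $ r"
  unfolding mat_app_def sum_coords Mmat.simps matrix_vector_mult_component M_x0W0_def
    posv_def[symmetric] attv_def[symmetric] linkv_def[symmetric]
  by (simp add: mat_vec_simps horiz_def matrix_vector_mult_uminus_left matrix_vector_mult_sum_left sum_negf)

lemma mass_matrix_Att:
  "mat_app (coords P) (Mmat P) a (Att r) = (Jbar P *v attv a
     + (\<Sum>i\<in>UNIV. MiT P i *\<^sub>R (rho P i \<times> posv a))
     - (\<Sum>i\<in>UNIV. \<Sum>j\<in>links P i. (M0 P i j * llink P i j) *\<^sub>R (rho P i \<times> horiz (linkv a i j)))) $ r"
proof -
  have "transpose (M_x0W0 P) = (\<Sum>i\<in>UNIV. MiT P i *\<^sub>R hat (rho P i))"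
  proof -
    have "transpose (\<Sum>i\<in>I. MiT P i *\<^sub>R hat (rho P i)) = - (\<Sum>i\<in>I. MiT P i *\<^sub>R hat (rho P i))" for I
    proof (induction I rule: infinite_finite_induct)
      case (insert i I)
      have "transpose (A + B) = transpose A + transpose B" for A B :: "real^3^3"
        by (simp add: transpose_def vec_eq_iff)
      moreover have "transpose (k *\<^sub>R A) = k *\<^sub>R transpose A" for A :: "real^3^3" and k
        by (simp add: transpose_def vec_eq_iff)
      ultimately show ?case using insert by (simp add: transpose_hat)
    qed (simp_all add: transpose_def vec_eq_iff)
    moreover have "transpose (- A) = - transpose A" for A :: "real^3^3"
      by (simp add: transpose_def vec_eq_iff)
    ultimately show ?thesis by (simp add: M_x0W0_def)
  qed
  then show ?thesis
    unfolding mat_app_def sum_coords Mmat.simps matrix_vector_mult_component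
      posv_def[symmetric] attv_def[symmetric] linkv_def[symmetric]
    by (simp add: mat_vec_simps horiz_def matrix_vector_mult_sum_left cross_minus_right sum_negf)
qed

lemma mass_matrix_Link:
  assumes "j \<in> links P i"
  shows "mat_app (coords P) (Mmat P) a (Link i j r) = (
     - (M0 P i j *\<^sub>R (transpose Cmat *v (e3 \<times> posv a)))
     + M0 P i j *\<^sub>R (transpose Cmat *v (e3 \<times> (rho P i \<times> attv a)))
     + (\<Sum>k\<in>links P i. (M0 P i (min j k) * llink P i k) *\<^sub>R linkv a i k)) $ r"
proof -
  have "(\<Sum>i'\<in>UNIV. \<Sum>k\<in>links P i'. \<Sum>b\<in>UNIV. Mmat P (Link i j r) (Link i' k b) * a (Link i' k b))
    = (\<Sum>i'\<in>UNIV. if i' = i then (\<Sum>k\<in>links P i. \<Sum>b\<in>UNIV. ((M0 P i (min j k) * llink P i k) *\<^sub>R mat 1 :: real^2^2) $ r $ b * a (Link i k b)) else 0)"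
    by (intro sum.cong) auto
  also have "\<dots> = (\<Sum>k\<in>links P i. \<Sum>b\<in>UNIV. ((M0 P i (min j k) * llink P i k) *\<^sub>R mat 1 :: real^2^2) $ r $ b * a (Link i k b))"
    by simp
  finally show ?thesis
    unfolding mat_app_def sum_coords
    unfolding Mmat.simps matrix_vector_mult_component
      posv_def[symmetric] attv_def[symmetric] linkv_def[symmetric]
    by (simp add: mat_vec_simps matrix_vector_mult_uminus_left)
qed

lemma stiffness_matrix_Pos: "mat_app (coords P) (Gmat P) x (Pos r) = 0"
  by (simp add: mat_app_def sum_coords)

lemma stiffness_matrix_Att:
  fixes P :: "'n::finite plant"
  shows "mat_app (coords P) (Gmat P) x (Att r) =
    (\<Sum>i\<in>UNIV. (mass0 P / real CARD('n) * grav P) *\<^sub>R (rho P i \<times> (e3 \<times> attv x))) $ r"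
  unfolding mat_app_def sum_coords Gmat.simps matrix_vector_mult_component
    posv_def[symmetric] attv_def[symmetric] linkv_def[symmetric]
  by (simp add: mat_vec_simps matrix_vector_mult_sum_left)

lemma stiffness_matrix_Link:
  fixes P :: "'n::finite plant"
  assumes "j \<in> links P i"
  shows "mat_app (coords P) (Gmat P) x (Link i j r) =
    (((MiT P i + mass0 P / real CARD('n) - M0 P i j) * grav P) *\<^sub>R linkv x i j) $ r"
proof -
  let ?g = "(MiT P i + mass0 P / real CARD('n) - M0 P i j) * grav P"
  let ?T = "\<Sum>b\<in>UNIV. (?g *\<^sub>R mat 1 :: real^2^2) $ r $ b * x (Link i j b)"
  have "(\<Sum>k\<in>links P i'. \<Sum>b\<in>UNIV. Gmat P (Link i j r) (Link i' k b) * x (Link i' k b))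
    = (\<Sum>k\<in>links P i'. if k = j then if i' = i then ?T else 0 else 0)" for i'
    by (rule sum.cong[OF refl]) auto
  also have "\<dots> i' = (if i' = i then ?T else 0)" for i'
    by (subst sum.delta, simp) (use assms in auto)
  finally have "(\<Sum>i'\<in>UNIV. \<Sum>k\<in>links P i'. \<Sum>b\<in>UNIV. Gmat P (Link i j r) (Link i' k b) * x (Link i' k b)) = ?T"
    by simp
  then show ?thesis
    unfolding mat_app_def sum_coords
    unfolding matrix_vector_mult_component linkv_def[symmetric]
    by (simp add: mat_vec_simps)
qed

definition inputv :: "('n \<times> 3 \<Rightarrow> real) \<Rightarrow> 'n \<Rightarrow> real^3" where "inputv u i = (\<chi> b. u (i, b))"

lemma sum_UNIV_prod:
  fixes f :: "'n::finite \<times> 3 \<Rightarrow> real"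
  shows "sum f UNIV = (\<Sum>i\<in>UNIV. \<Sum>b\<in>UNIV. f (i, b))"
  by (simp add: sum.cartesian_product UNIV_Times_UNIV[symmetric] del: UNIV_Times_UNIV)

lemma input_matrix_Pos: "mat_app UNIV (Bmat P) u (Pos r) = (\<Sum>i\<in>UNIV. inputv u i) $ r"
  unfolding mat_app_def sum_UNIV_prod Bmat.simps matrix_vector_mult_component inputv_def[symmetric]
  by simp

lemma input_matrix_Att:
  "mat_app UNIV (Bmat P) u (Att r) = (\<Sum>i\<in>UNIV. rho P i \<times> inputv u i) $ r"
  unfolding mat_app_def sum_UNIV_prod Bmat.simps matrix_vector_mult_component inputv_def[symmetric]
  by (simp add: hat_mult)

lemma input_matrix_Link:
  "mat_app UNIV (Bmat P) u (Link i j r) = - (transpose Cmat *v (e3 \<times> inputv u i)) $ r"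
proof -
  have "mat_app UNIV (Bmat P) u (Link i j r)
    = (\<Sum>i'\<in>UNIV. if i' = i then (\<Sum>b\<in>UNIV. (- (transpose Cmat ** hat e3)) $ r $ b * u (i, b)) else 0)"
    unfolding mat_app_def sum_UNIV_prod by (intro sum.cong) auto
  also have "\<dots> = (\<Sum>b\<in>UNIV. (- (transpose Cmat ** hat e3)) $ r $ b * u (i, b))" by simp
  finally show ?thesis
    unfolding matrix_vector_mult_component inputv_def[symmetric]
    by (simp add: mat_vec_simps matrix_vector_mult_uminus_left)
qed

section \<open>Kinetic energy\<close>

text \<open>
  The masses at the joints of a cable: the quadrotor is joint 0. Joint \<open>a\<close> is displaced by
  all links with index larger than \<open>a\<close>.
\<close>

definition joint_mass :: "'n plant \<Rightarrow> 'n \<Rightarrow> nat \<Rightarrow> real" where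
  "joint_mass P i a = (if a = 0 then massQ P i else mlink P i a)"

text \<open>Link \<open>b\<close> carries along exactly the joints \<open>0, ..., b - 1\<close>, and
  \<open>M0 P i b\<close> is their total mass.\<close>

lemma M0_joint_mass:
  assumes "b \<in> links P i"
  shows "M0 P i b = (\<Sum>a\<in>{0..nlinks P i}. if a < b then joint_mass P i a else 0)"
proof -
  have "(\<Sum>a\<in>{0..nlinks P i}. if a < b then joint_mass P i a else 0) = (\<Sum>a\<in>{0..<b}. joint_mass P i a)"
    using assms by (intro sum.mono_neutral_cong_right) auto
  also have "\<dots> = joint_mass P i 0 + (\<Sum>a\<in>{1..<b}. joint_mass P i a)"
    using assms by (subst sum.atLeast_Suc_lessThan) auto
  also have "(\<Sum>a\<in>{1..<b}. joint_mass P i a) = (\<Sum>a\<in>{1..<b}. mlink P i a)"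
    by (intro sum.cong) (auto simp: joint_mass_def)
  finally show ?thesis by (simp add: M0_def joint_mass_def)
qed

lemma MiT_joint_mass: "MiT P i = (\<Sum>a\<in>{0..nlinks P i}. joint_mass P i a)"
  unfolding MiT_def by (subst sum.atLeast_Suc_atMost) (auto simp: joint_mass_def intro!: sum.cong)

text \<open>With \<open>V\<close> the velocity of the attachment point and \<open>w b\<close> the
  contribution of link \<open>b\<close>, joint \<open>a\<close> moves with \<open>V\<close> minus
  the contributions of the links beyond \<open>a\<close>. When the squares are expanded, links
  \<open>b\<close> and \<open>c\<close> act together on the joints below \<open>min b c\<close>;
  this explains the mass index in the link block.\<close>

lemma cable_energy:
  fixes V :: "'v::real_inner"
  shows "MiT P i * (V \<bullet> V) - 2 * (\<Sum>b\<in>links P i. M0 P i b * (w b \<bullet> V))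
    + (\<Sum>b\<in>links P i. \<Sum>c\<in>links P i. M0 P i (min b c) * (w b \<bullet> w c))
    = (\<Sum>a\<in>{0..nlinks P i}. joint_mass P i a * (norm (V - (\<Sum>b\<in>links P i. if a < b then w b else 0)))\<^sup>2)"
proof -
  let ?J = "{0..nlinks P i}" and ?L = "links P i" and ?m = "joint_mass P i"
  have 1: "(\<Sum>b\<in>?L. M0 P i b * (w b \<bullet> V)) = (\<Sum>a\<in>?J. ?m a * (\<Sum>b\<in>?L. (if a < b then w b else 0) \<bullet> V))"
  proof -
    have "(\<Sum>b\<in>?L. M0 P i b * (w b \<bullet> V)) = (\<Sum>b\<in>?L. \<Sum>a\<in>?J. ?m a * ((if a < b then w b else 0) \<bullet> V))"
      by (intro sum.cong refl) (auto simp: M0_joint_mass sum_distrib_right intro!: sum.cong)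
    then show ?thesis by (subst (asm) sum.swap) (simp add: sum_distrib_left)
  qed
  have 2: "(\<Sum>b\<in>?L. \<Sum>c\<in>?L. M0 P i (min b c) * (w b \<bullet> w c))
    = (\<Sum>a\<in>?J. ?m a * (\<Sum>b\<in>?L. \<Sum>c\<in>?L. (if a < b then w b else 0) \<bullet> (if a < c then w c else 0)))"
  proof -
    have "(\<Sum>b\<in>?L. \<Sum>c\<in>?L. M0 P i (min b c) * (w b \<bullet> w c))
      = (\<Sum>b\<in>?L. \<Sum>c\<in>?L. \<Sum>a\<in>?J. ?m a * ((if a < b then w b else 0) \<bullet> (if a < c then w c else 0)))"
    proof (intro sum.cong refl)
      fix b c assume "b \<in> ?L" "c \<in> ?L"
      then have "min b c \<in> ?L" by auto
      then show "M0 P i (min b c) * (w b \<bullet> w c)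
        = (\<Sum>a\<in>?J. ?m a * ((if a < b then w b else 0) \<bullet> (if a < c then w c else 0)))"
        by (auto simp: M0_joint_mass sum_distrib_right intro!: sum.cong)
    qed
    also have "\<dots> = (\<Sum>b\<in>?L. \<Sum>a\<in>?J. \<Sum>c\<in>?L. ?m a * ((if a < b then w b else 0) \<bullet> (if a < c then w c else 0)))"
      by (intro sum.cong refl sum.swap)
    also have "\<dots> = (\<Sum>a\<in>?J. \<Sum>b\<in>?L. \<Sum>c\<in>?L. ?m a * ((if a < b then w b else 0) \<bullet> (if a < c then w c else 0)))"
      by (rule sum.swap)
    finally show ?thesis by (simp add: sum_distrib_left)
  qed
  have 3: "(norm (V - (\<Sum>b\<in>?L. u b)))\<^sup>2 = V \<bullet> V - 2 * (\<Sum>b\<in>?L. u b \<bullet> V) + (\<Sum>b\<in>?L. \<Sum>c\<in>?L. u b \<bullet> u c)" for u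
  proof -
    have "(norm (V - sum u ?L))\<^sup>2 = V \<bullet> V - 2 * (sum u ?L \<bullet> V) + sum u ?L \<bullet> sum u ?L"
      by (simp add: power2_norm_eq_inner inner_diff_left inner_diff_right inner_commute)
    then show ?thesis
      by (subst (asm) (2) inner_sum_left) (simp only: inner_sum_left[of _ _ V] inner_sum_right)
  qed
  show ?thesis
    unfolding 1 2 3 MiT_joint_mass
    by (simp add: sum_distrib_left sum_distrib_right sum_subtractf sum.distrib algebra_simps)
qed

lemma horiz_inner: "horiz s \<bullet> horiz s' = s \<bullet> s'"
  by (simp add: horiz_eq inner_vec_def sum_3 sum_2)

text \<open>\<open>horiz\<close> is the adjoint of the map \<open>C^T (e3 x .)\<close>. Pairing a
  link row of the mass matrix with a link velocity therefore produces inner products of vectors in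
  space.\<close>

lemma horiz_link_inner: "horiz s \<bullet> v = s \<bullet> (transpose Cmat *v (e3 \<times> v))"
  by (simp add: horiz_eq Cmat_transpose_mult cross3_def axis_def inner_vec_def sum_3 sum_2)

lemma horiz_scaleR: "horiz (k *\<^sub>R s) = k *\<^sub>R horiz s"
  by (simp add: horiz_eq vec_eq_iff forall_3)

lemma horiz_eq_0: "horiz s = 0 \<Longrightarrow> s = 0"
  by (metis horiz_inner inner_eq_zero_iff)

text \<open>
  Paired with \<open>a\<close>, the rows add up to twice the kinetic energy of the system for the
  velocities \<open>a\<close>.
\<close>

lemma mass_matrix_injective:
  fixes P :: "'n::finite plant"
  assumes P: "admissible_plant P"
    and zero: "\<And>r. r \<in> coords P \<Longrightarrow> mat_app (coords P) (Mmat P) a r = 0"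
  shows "\<forall>c\<in>coords P. a c = 0"
proof -
  define X where "X = posv a"
  define Y where "Y = attv a"
  define s where "s = linkv a"
  \<comment> \<open>\<open>V i\<close> is the velocity of attachment point \<open>i\<close>, and
    \<open>w i j\<close> is what link \<open>j\<close> adds to the velocities along cable
    \<open>i\<close>.\<close>
  define V where "V i = X - rho P i \<times> Y" for i
  define w where "w i j = llink P i j *\<^sub>R horiz (s i j)" for i j
  note abbr = X_def[symmetric] Y_def[symmetric] s_def[symmetric]
  have rowP: "MT P *\<^sub>R X - (\<Sum>i\<in>UNIV. MiT P i *\<^sub>R (rho P i \<times> Y))
     - (\<Sum>i\<in>UNIV. \<Sum>j\<in>links P i. M0 P i j *\<^sub>R w i j) = 0" (is "?L = 0")
  proof -
    have "?L $ r = 0" for r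
      using zero[of "Pos r"] unfolding mass_matrix_Pos abbr by (simp add: w_def coords_def)
    then show ?thesis by (simp add: vec_eq_iff)
  qed
  have rowA: "Jbar P *v Y + (\<Sum>i\<in>UNIV. MiT P i *\<^sub>R (rho P i \<times> X))
     - (\<Sum>i\<in>UNIV. \<Sum>j\<in>links P i. M0 P i j *\<^sub>R (rho P i \<times> w i j)) = 0" (is "?L = 0")
  proof -
    have "?L $ r = 0" for r
      using zero[of "Att r"] unfolding mass_matrix_Att abbr by (simp add: w_def coords_def cross_mult_right)
    then show ?thesis by (simp add: vec_eq_iff)
  qed
  have rowL: "- (M0 P i j * (w i j \<bullet> V i)) + (\<Sum>k\<in>links P i. M0 P i (min j k) * (w i j \<bullet> w i k)) = 0"
    if j: "j \<in> links P i" for i j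
  proof -
    let ?L = "- (M0 P i j *\<^sub>R (transpose Cmat *v (e3 \<times> X)))
     + M0 P i j *\<^sub>R (transpose Cmat *v (e3 \<times> (rho P i \<times> Y)))
     + (\<Sum>k\<in>links P i. (M0 P i (min j k) * llink P i k) *\<^sub>R s i k)"
    have "?L $ r = 0" for r
      using zero[of "Link i j r"] j unfolding mass_matrix_Link[OF j] abbr by (auto simp: coords_def)
    then have "?L = 0" by (simp add: vec_eq_iff)
    \<comment> \<open>The mass matrix is not symmetric: its link columns carry the lengths and its
      link rows do not. Pairing the row with the link velocity times the length restores the
      symmetry of the energy.\<close>
    then have "(llink P i j *\<^sub>R s i j) \<bullet> ?L = 0" by simp
    then show ?thesis
      by (simp add: inner_add_right inner_sum_right horiz_link_inner[symmetric] horiz_inner horiz_scaleR V_def w_def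
        inner_diff_right sum_distrib_left algebra_simps)
  qed
  let ?E = "\<lambda>i. MiT P i * (V i \<bullet> V i) - 2 * (\<Sum>b\<in>links P i. M0 P i b * (w i b \<bullet> V i))
    + (\<Sum>b\<in>links P i. \<Sum>c\<in>links P i. M0 P i (min b c) * (w i b \<bullet> w i c))"
  have cr: "Y \<bullet> (rho P i \<times> v) = - ((rho P i \<times> Y) \<bullet> v)" for i v
    by (metis cross_triple cross_skew inner_commute inner_minus_left)
  have Jb: "Y \<bullet> (Jbar P *v Y) = Y \<bullet> (inertia0 P *v Y) + (\<Sum>i\<in>UNIV. MiT P i * ((rho P i \<times> Y) \<bullet> (rho P i \<times> Y)))"
    unfolding Jbar_def
    by (simp add: mat_vec_simps matrix_vector_mult_sum_left inner_diff_right inner_sum_right cr sum_negf)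
  have "0 = X \<bullet> (MT P *\<^sub>R X - (\<Sum>i\<in>UNIV. MiT P i *\<^sub>R (rho P i \<times> Y))
     - (\<Sum>i\<in>UNIV. \<Sum>j\<in>links P i. M0 P i j *\<^sub>R w i j)) + Y \<bullet> (Jbar P *v Y + (\<Sum>i\<in>UNIV. MiT P i *\<^sub>R (rho P i \<times> X))
     - (\<Sum>i\<in>UNIV. \<Sum>j\<in>links P i. M0 P i j *\<^sub>R (rho P i \<times> w i j)))
     + (\<Sum>i\<in>UNIV. \<Sum>j\<in>links P i. - (M0 P i j * (w i j \<bullet> V i)) + (\<Sum>k\<in>links P i. M0 P i (min j k) * (w i j \<bullet> w i k)))"
    unfolding rowP rowA using rowL by simp
  also have "\<dots> = mass0 P * (X \<bullet> X) + Y \<bullet> (inertia0 P *v Y) + (\<Sum>i\<in>UNIV. ?E i)"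
  proof -
    have E: "?E i = MiT P i * (X \<bullet> X) - MiT P i * (X \<bullet> (rho P i \<times> Y)) - MiT P i * ((rho P i \<times> Y) \<bullet> X)
       + MiT P i * ((rho P i \<times> Y) \<bullet> (rho P i \<times> Y))
       - (\<Sum>b\<in>links P i. M0 P i b * (w i b \<bullet> V i))
       - (\<Sum>b\<in>links P i. M0 P i b * (X \<bullet> w i b)) + (\<Sum>b\<in>links P i. M0 P i b * ((rho P i \<times> Y) \<bullet> w i b))
       + (\<Sum>b\<in>links P i. \<Sum>c\<in>links P i. M0 P i (min b c) * (w i b \<bullet> w i c))" for i
    proof -
      have "(\<Sum>b\<in>links P i. M0 P i b * (w i b \<bullet> V i))
        = (\<Sum>b\<in>links P i. M0 P i b * (X \<bullet> w i b)) - (\<Sum>b\<in>links P i. M0 P i b * ((rho P i \<times> Y) \<bullet> w i b))"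
        by (simp add: V_def inner_diff_right right_diff_distrib sum_subtractf inner_commute[of "w i _"])
      moreover have "MiT P i * (V i \<bullet> V i) = MiT P i * (X \<bullet> X) - MiT P i * (X \<bullet> (rho P i \<times> Y)) - MiT P i * ((rho P i \<times> Y) \<bullet> X)
       + MiT P i * ((rho P i \<times> Y) \<bullet> (rho P i \<times> Y))"
        by (simp add: V_def inner_diff_left inner_diff_right algebra_simps)
      ultimately show ?thesis by linarith
    qed
    show ?thesis unfolding E
      by (simp add: MT_def Jb inner_diff_right inner_add_right inner_sum_right cr sum_negf
        sum.distrib sum_subtractf sum_distrib_right distrib_right)
  qed
  finally have tot: "mass0 P * (X \<bullet> X) + Y \<bullet> (inertia0 P *v Y) + (\<Sum>i\<in>UNIV. ?E i) = 0" by simp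
  have jm: "joint_mass P i a > 0" if "a \<in> {0..nlinks P i}" for i a
    using P that by (auto simp: admissible_plant_def joint_mass_def)
  have Epos: "?E i \<ge> 0" for i
    unfolding cable_energy using jm by (intro sum_nonneg mult_nonneg_nonneg) (auto intro: less_imp_le)
  have Jpos: "Y \<bullet> (inertia0 P *v Y) \<ge> 0" and Jz: "Y \<bullet> (inertia0 P *v Y) = 0 \<Longrightarrow> Y = 0"
    using P by (auto simp: admissible_plant_def sym_pos_def_def) (metis inner_zero_left less_eq_real_def)
  have Xpos: "mass0 P * (X \<bullet> X) \<ge> 0" and m0: "mass0 P > 0"
    using P by (auto simp: admissible_plant_def)
  have sE: "(\<Sum>i\<in>UNIV. ?E i) \<ge> 0" by (intro sum_nonneg Epos)
  have z: "mass0 P * (X \<bullet> X) = 0" "Y \<bullet> (inertia0 P *v Y) = 0" "(\<Sum>i\<in>UNIV. ?E i) = 0"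
    using tot Xpos Jpos sE by linarith+
  have X0: "X = 0" and Y0: "Y = 0" using z(1,2) m0 Jz by auto
  have V0: "V i = 0" for i by (simp add: V_def X0 Y0)
  \<comment> \<open>Zero energy puts every joint at rest. The attachment points are at rest too, so
    the links beyond joint \<open>a\<close> contribute nothing in total.\<close>
  have tails: "(\<Sum>b\<in>links P i. if a < b then w i b else 0) = 0" if a: "a \<in> {0..nlinks P i}" for i a
  proof -
    have "?E i = 0" using z(3) Epos by (simp add: sum_nonneg_eq_0_iff)
    then have "joint_mass P i a * (norm (V i - (\<Sum>b\<in>links P i. if a < b then w i b else 0)))\<^sup>2 = 0"
      unfolding cable_energy using a jm
      by (subst (asm) sum_nonneg_eq_0_iff) (auto simp: zero_le_mult_iff less_imp_le)
    then show ?thesis using jm[OF a] by (simp add: V0)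
  qed
  have s0: "s i j = 0" if j: "j \<in> links P i" for i j
  proof -
    \<comment> \<open>The tails at joints \<open>j - 1\<close> and \<open>j\<close> differ by link
      \<open>j\<close> alone; for \<open>j = 1\<close> the former belongs to the quadrotor.\<close>
    have "(\<Sum>b\<in>links P i. if j - 1 < b then w i b else 0)
      = (\<Sum>b\<in>links P i. (if j < b then w i b else 0) + (if b = j then w i b else 0))"
      using j by (intro sum.cong) auto
    also have "\<dots> = (\<Sum>b\<in>links P i. if j < b then w i b else 0) + w i j"
      using j by (simp add: sum.distrib)
    finally have "w i j = 0" using tails[of "j - 1" i] tails[of j i] j by auto
    moreover have "llink P i j > 0" using P j by (auto simp: admissible_plant_def)
    ultimately show ?thesis by (auto simp: w_def intro: horiz_eq_0)
  qed
  show ?thesis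
    using X0 Y0 s0 by (auto simp: coords_def X_def Y_def s_def posv_def attv_def linkv_def vec_eq_iff)
qed

section \<open>A Lyapunov function of the linear closed loop\<close>

definition lin_acc ::
  "'n::finite plant \<Rightarrow> 'n gain \<Rightarrow> 'n gain \<Rightarrow> ('n coord \<Rightarrow> 'n coord \<Rightarrow> real) \<Rightarrow>
   ('n coord \<Rightarrow> real) \<Rightarrow> ('n coord \<Rightarrow> real) \<Rightarrow> 'n coord \<Rightarrow> real" where
  "lin_acc P Kx Kv N x v = mat_app (coords P) N
     (\<lambda>r. mat_app UNIV (Bmat P) (lin_input P Kx Kv x v) r - mat_app (coords P) (Gmat P) x r)"

text \<open>The first-order form of the system: the left summand labels positions, the right one
  velocities.\<close>

definition phase_coords :: "'n plant \<Rightarrow> ('n coord + 'n coord) set" where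
  "phase_coords P = coords P <+> coords P"

lemma finite_phase_coords: "finite (phase_coords P)" for P :: "'n::finite plant"
  by (simp add: phase_coords_def finite_coords)

lemma sum_phase_coords:
  fixes P :: "'n::finite plant"
  shows "sum f (phase_coords P) = (\<Sum>s\<in>coords P. f (Inl s)) + (\<Sum>s\<in>coords P. f (Inr s))"
  by (simp add: phase_coords_def sum.Plus finite_coords)

lemma L2_set_phase_coords:
  fixes P :: "'n::finite plant"
  shows "(L2_set (case_sum x v) (phase_coords P))\<^sup>2 = (L2_set x (coords P))\<^sup>2 + (L2_set v (coords P))\<^sup>2"
  by (simp add: L2_set_def sum_phase_coords sum_nonneg)

lemma mat_app_uminus: "mat_app I A (\<lambda>c. - x c) r = - mat_app I A x r"
  by (simp add: mat_app_def sum_negf)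

lemma mat_app_diff: "mat_app I A (\<lambda>c. x c - y c) r = mat_app I A x r - mat_app I A y r"
  by (simp add: mat_app_def sum_subtractf right_diff_distrib)

lemma mat_app_comp:
  "mat_app I A (mat_app J B x) r = mat_app J (\<lambda>r d. \<Sum>c\<in>I. A r c * B c d) x r"
proof -
  have "mat_app I A (mat_app J B x) r = (\<Sum>c\<in>I. \<Sum>d\<in>J. A r c * B c d * x d)"
    by (simp add: mat_app_def sum_distrib_left mult_ac)
  also have "\<dots> = (\<Sum>d\<in>J. \<Sum>c\<in>I. A r c * B c d * x d)" by (rule sum.swap)
  finally show ?thesis by (simp add: mat_app_def sum_distrib_right)
qed

text \<open>The second-order system is written as a first-order one on \<open>phase_coords\<close>.
  Local attractivity then yields decay of every solution, because by linearity each solution can be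
  scaled into the region of attraction.\<close>

lemma closed_loop_lyapunov_form:
  fixes P :: "'n::finite plant"
  assumes P: "admissible_plant P" and stable: "lin_asymptotically_stable P Kx Kv"
  obtains N H p where "p > 0"
    and "\<And>a s. s \<in> coords P \<Longrightarrow> mat_app (coords P) N (mat_app (coords P) (Mmat P) a) s = a s"
    and "\<And>z. p * (L2_set z (phase_coords P))\<^sup>2 \<le> bilin (phase_coords P) H z z"
    and "\<And>x v. bilin (phase_coords P) H (case_sum v (lin_acc P Kx Kv N x v)) (case_sum x v)
        + bilin (phase_coords P) H (case_sum x v) (case_sum v (lin_acc P Kx Kv N x v))
        = - (L2_set (case_sum x v) (phase_coords P))\<^sup>2"
proof -
  let ?I = "coords P" and ?J = "phase_coords P"
  note fin = finite_coords[of P]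
  have JI: "Inl s \<in> ?J" "Inr s \<in> ?J" if "s \<in> ?I" for s
    using that by (auto simp: phase_coords_def)
  obtain N where NM: "\<And>a s. s \<in> ?I \<Longrightarrow> mat_app ?I N (mat_app ?I (Mmat P) a) s = a s"
    and MN: "\<And>b s. s \<in> ?I \<Longrightarrow> mat_app ?I (Mmat P) (mat_app ?I N b) s = b s"
    using injective_system_inverse[OF fin mass_matrix_injective[OF P]] by blast
  define Lx where "Lx r d = - (\<Sum>q\<in>UNIV. Bmat P r q * stacked Kx q d) - Gmat P r d" for r d
  define Lv where "Lv r d = - (\<Sum>q\<in>UNIV. Bmat P r q * stacked Kv q d)" for r d
  have force: "mat_app UNIV (Bmat P) (lin_input P Kx Kv x v) r - mat_app ?I (Gmat P) x r
      = mat_app ?I Lx x r + mat_app ?I Lv v r" for x v r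
  proof -
    have "mat_app UNIV (Bmat P) (lin_input P Kx Kv x v) r
      = - mat_app UNIV (Bmat P) (mat_app ?I (stacked Kx) x) r - mat_app UNIV (Bmat P) (mat_app ?I (stacked Kv) v) r"
      unfolding lin_input_def by (simp add: mat_app_diff mat_app_uminus)
    then show ?thesis
      unfolding mat_app_comp by (simp add: mat_app_def Lx_def Lv_def algebra_simps sum_negf sum_subtractf sum.distrib)
  qed
  define A where "A r c = (case r of
      Inl s \<Rightarrow> (case c of Inl d \<Rightarrow> 0 | Inr d \<Rightarrow> if s = d then 1 else 0)
    | Inr s \<Rightarrow> (case c of Inl d \<Rightarrow> \<Sum>r\<in>?I. N s r * Lx r d | Inr d \<Rightarrow> \<Sum>r\<in>?I. N s r * Lv r d))" for r c
  have AInl: "mat_app ?J A z (Inl s) = z (Inr s)" if "s \<in> ?I" for z s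
    using that fin by (simp add: mat_app_def sum_phase_coords A_def if_distrib[of "\<lambda>u. u * _"] cong: if_cong)
  have AInr: "mat_app ?J A z (Inr s) = lin_acc P Kx Kv N (z \<circ> Inl) (z \<circ> Inr) s" for z s
  proof -
    have "lin_acc P Kx Kv N (z \<circ> Inl) (z \<circ> Inr) s
      = mat_app ?I N (mat_app ?I Lx (z \<circ> Inl)) s + mat_app ?I N (mat_app ?I Lv (z \<circ> Inr)) s"
      unfolding lin_acc_def force by (simp add: mat_app_def distrib_left sum.distrib)
    then show ?thesis
      unfolding mat_app_comp by (simp add: mat_app_def sum_phase_coords A_def)
  qed
  have acc: "mat_app ?I (Mmat P) (lin_acc P Kx Kv N x v) s + mat_app ?I (Gmat P) x s
      = mat_app UNIV (Bmat P) (lin_input P Kx Kv x v) s" if "s \<in> ?I" for x v s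
    unfolding lin_acc_def using MN[OF that] by simp
  obtain \<delta> where \<delta>: "\<delta> > 0" and conv: "\<And>x v. lin_solution P Kx Kv x v \<Longrightarrow>
      phase_norm P (x 0) (v 0) < \<delta> \<Longrightarrow> ((\<lambda>t. phase_norm P (x t) (v t)) \<longlongrightarrow> 0) at_top"
    using stable unfolding lin_asymptotically_stable_def by blast
  have decay: "\<forall>c\<in>?J. ((\<lambda>t. z t c) \<longlongrightarrow> 0) at_top"
    if z: "\<And>t c. t \<ge> 0 \<Longrightarrow> c \<in> ?J \<Longrightarrow> ((\<lambda>t. z t c) has_real_derivative mat_app ?J A (z t) c) (at t)" for z
  proof -
    define n where "n = phase_norm P (z 0 \<circ> Inl) (z 0 \<circ> Inr)"
    have n0: "n \<ge> 0" by (simp add: n_def phase_norm_def L2_set_nonneg)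
    \<comment> \<open>Brings the initial phase norm below \<open>\<delta>\<close>; the summand 1
      covers the case \<open>n = 0\<close>.\<close>
    define k where "k = \<delta> / (n + 1)"
    have k: "k > 0" "k * n < \<delta>" using n0 \<delta> by (auto simp: k_def field_simps)
    define x where "x t s = k * z t (Inl s)" for t s
    define v where "v t s = k * z t (Inr s)" for t s
    have L2k: "L2_set (\<lambda>s. k * f s) I = k * L2_set f I" for f and I :: "'n coord set"
      using L2_set_right_distrib[of k f I] k by simp
    have "lin_solution P Kx Kv x v"
      unfolding lin_solution_def
    proof (intro allI impI exI[where x = "lin_acc P Kx Kv N (x t) (v t)" for t] conjI ballI)
      fix t :: real and s assume t: "t \<ge> 0" and s: "s \<in> ?I"
      have "((\<lambda>t. z t (Inl s)) has_real_derivative z t (Inr s)) (at t)"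
        using z[OF t, of "Inl s"] s JI(1)[OF s] by (simp add: AInl)
      from DERIV_cmult[OF this, of k]
      show "((\<lambda>\<tau>. x \<tau> s) has_real_derivative v t s) (at t within {0..})"
        unfolding x_def v_def by (rule has_field_derivative_at_within)
      have "((\<lambda>t. z t (Inr s)) has_real_derivative lin_acc P Kx Kv N (z t \<circ> Inl) (z t \<circ> Inr) s) (at t)"
        using z[OF t, of "Inr s"] s JI(2)[OF s] by (simp add: AInr)
      from DERIV_cmult[OF this, of k]
      have "((\<lambda>\<tau>. v \<tau> s) has_real_derivative k * lin_acc P Kx Kv N (z t \<circ> Inl) (z t \<circ> Inr) s) (at t within {0..})"
        unfolding v_def by (rule has_field_derivative_at_within)
      moreover have "lin_acc P Kx Kv N (x t) (v t) s = k * lin_acc P Kx Kv N (z t \<circ> Inl) (z t \<circ> Inr) s"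
        unfolding lin_acc_def force x_def[abs_def] v_def[abs_def]
        by (simp add: mat_app_def sum_distrib_left distrib_left mult_ac)
      ultimately show "((\<lambda>\<tau>. v \<tau> s) has_real_derivative lin_acc P Kx Kv N (x t) (v t) s) (at t within {0..})"
        by simp
    qed (rule acc)
    moreover have pn: "phase_norm P (x t) (v t) = k * phase_norm P (z t \<circ> Inl) (z t \<circ> Inr)" for t
      unfolding phase_norm_def x_def[abs_def] v_def[abs_def] L2k by (simp add: comp_def distrib_left)
    ultimately have "((\<lambda>t. k * phase_norm P (z t \<circ> Inl) (z t \<circ> Inr)) \<longlongrightarrow> 0) at_top"
      using conv[of x v] k(2) unfolding pn n_def[symmetric] by simp
    then have lim: "((\<lambda>t. phase_norm P (z t \<circ> Inl) (z t \<circ> Inr)) \<longlongrightarrow> 0) at_top"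
      using k(1) tendsto_mult_left_iff[of k "\<lambda>t. phase_norm P (z t \<circ> Inl) (z t \<circ> Inr)" 0] by simp
    have mem: "\<bar>f s\<bar> \<le> L2_set f ?I" if "s \<in> ?I" for f s
      using member_le_L2_set[OF fin that, of "\<lambda>c. \<bar>f c\<bar>"] by (simp add: L2_set_def)
    show ?thesis
    proof
      fix c assume "c \<in> ?J"
      then have "\<bar>z t c\<bar> \<le> phase_norm P (z t \<circ> Inl) (z t \<circ> Inr)" for t
        unfolding phase_norm_def phase_coords_def
        using mem[of _ "z t \<circ> Inl"] mem[of _ "z t \<circ> Inr"]
          L2_set_nonneg[of "z t \<circ> Inl" ?I] L2_set_nonneg[of "z t \<circ> Inr" ?I]
        by (auto intro: add_increasing add_increasing2)
      then show "((\<lambda>t. z t c) \<longlongrightarrow> 0) at_top"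
        using lim by (intro Lim_null_comparison[OF always_eventually lim]) auto
    qed
  qed
  obtain H where H: "lyapunov_form ?J A H"
    using lyapunov_form_exists[OF finite_phase_coords decay] by blast
  then obtain p where p: "p > 0" "\<And>z. p * (L2_set z ?J)\<^sup>2 \<le> bilin ?J H z z"
    unfolding lyapunov_form_def by blast
  have "bilin ?J H (case_sum v (lin_acc P Kx Kv N x v)) (case_sum x v)
        + bilin ?J H (case_sum x v) (case_sum v (lin_acc P Kx Kv N x v))
        = - (L2_set (case_sum x v) ?J)\<^sup>2" for x v
  proof -
    have "mat_app ?J A (case_sum x v) c = case_sum v (lin_acc P Kx Kv N x v) c" if "c \<in> ?J" for c
    proof -
      have "(\<exists>s\<in>?I. c = Inl s) \<or> (\<exists>s\<in>?I. c = Inr s)"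
        using that by (auto simp: phase_coords_def)
      then show ?thesis by (auto simp: AInl AInr comp_def)
    qed
    then have "bilin ?J H (case_sum v (lin_acc P Kx Kv N x v)) (case_sum x v) = bilin ?J H (mat_app ?J A (case_sum x v)) (case_sum x v)"
      "bilin ?J H (case_sum x v) (case_sum v (lin_acc P Kx Kv N x v)) = bilin ?J H (case_sum x v) (mat_app ?J A (case_sum x v))"
      by (auto intro!: bilin_cong)
    then show ?thesis using H unfolding lyapunov_form_def by simp
  qed
  with p NM show ?thesis using that by blast
qed

section \<open>Uniform estimates\<close>

text \<open>No limit is involved: one constant serves all of \<open>D\<close>, and smallness is
  imposed by shrinking \<open>D\<close>.\<close>

definition bigO :: "'s set \<Rightarrow> ('s \<Rightarrow> 'a::real_normed_vector) \<Rightarrow> ('s \<Rightarrow> real) \<Rightarrow> bool" where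
  "bigO D f g \<longleftrightarrow> (\<exists>c\<ge>0. \<forall>\<sigma>\<in>D. norm (f \<sigma>) \<le> c * g \<sigma>)"

lemma bigOI: "(\<And>\<sigma>. \<sigma> \<in> D \<Longrightarrow> norm (f \<sigma>) \<le> c * g \<sigma>) \<Longrightarrow> c \<ge> 0 \<Longrightarrow> bigO D f g"
  unfolding bigO_def by blast

lemma bigOI1: "(\<And>\<sigma>. \<sigma> \<in> D \<Longrightarrow> norm (f \<sigma>) \<le> g \<sigma>) \<Longrightarrow> bigO D f g"
  by (rule bigOI[where c = 1]) auto

lemma bigOE:
  assumes "bigO D f g" "\<And>\<sigma>. \<sigma> \<in> D \<Longrightarrow> g \<sigma> \<ge> 0"
  obtains c where "c > 0" "\<And>\<sigma>. \<sigma> \<in> D \<Longrightarrow> norm (f \<sigma>) \<le> c * g \<sigma>"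
proof -
  obtain c where c: "c \<ge> 0" "\<And>\<sigma>. \<sigma> \<in> D \<Longrightarrow> norm (f \<sigma>) \<le> c * g \<sigma>"
    using assms(1) unfolding bigO_def by blast
  have "norm (f \<sigma>) \<le> (c + 1) * g \<sigma>" if "\<sigma> \<in> D" for \<sigma>
    using c(2)[OF that] assms(2)[OF that] by (simp add: distrib_right)
  with c(1) show ?thesis using that[of "c + 1"] by simp
qed

lemma bigO_cong: "(\<And>\<sigma>. \<sigma> \<in> D \<Longrightarrow> f \<sigma> = f' \<sigma>) \<Longrightarrow> bigO D f' g \<Longrightarrow> bigO D f g"
  unfolding bigO_def by simp

lemma bigO_subset: "bigO D f g \<Longrightarrow> D' \<subseteq> D \<Longrightarrow> bigO D' f g"
  unfolding bigO_def by blast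

lemma bigO_le:
  assumes "bigO D f g" "\<And>\<sigma>. \<sigma> \<in> D \<Longrightarrow> g \<sigma> \<le> g' \<sigma>"
  shows "bigO D f g'"
  using assms unfolding bigO_def by (meson mult_left_mono order_trans)

lemma bigO_trans:
  assumes "bigO D f g" "bigO D g h"
  shows "bigO D f h"
proof -
  obtain c d where c: "c \<ge> 0" "\<And>\<sigma>. \<sigma> \<in> D \<Longrightarrow> norm (f \<sigma>) \<le> c * g \<sigma>"
    and d: "d \<ge> 0" "\<And>\<sigma>. \<sigma> \<in> D \<Longrightarrow> \<bar>g \<sigma>\<bar> \<le> d * h \<sigma>"
    using assms unfolding bigO_def real_norm_def by blast
  have "norm (f \<sigma>) \<le> (c * d) * h \<sigma>" if "\<sigma> \<in> D" for \<sigma>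
  proof -
    have "norm (f \<sigma>) \<le> c * (d * h \<sigma>)"
      using c(2)[OF that] d(2)[OF that] c(1) by (meson abs_ge_self mult_left_mono order_trans)
    then show ?thesis by (simp add: mult.assoc)
  qed
  then show ?thesis using c(1) d(1) by (intro bigOI[where c = "c * d"]) auto
qed

lemma bigO_norm_iff: "bigO D (\<lambda>\<sigma>. norm (f \<sigma>)) g \<longleftrightarrow> bigO D f g"
  by (simp add: bigO_def)

lemma bigO_const: "bigO D (\<lambda>_. k) (\<lambda>_. 1)"
  by (rule bigOI[where c = "norm k"]) auto

lemma bigO_zero: "bigO D (\<lambda>_. 0) g"
  by (rule bigOI[where c = 0]) auto

lemma bigO_add: "bigO D f g \<Longrightarrow> bigO D f' g \<Longrightarrow> bigO D (\<lambda>\<sigma>. f \<sigma> + f' \<sigma>) g"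
proof -
  assume "bigO D f g" "bigO D f' g"
  then obtain c d where "c \<ge> 0" "\<And>\<sigma>. \<sigma> \<in> D \<Longrightarrow> norm (f \<sigma>) \<le> c * g \<sigma>"
    and "d \<ge> 0" "\<And>\<sigma>. \<sigma> \<in> D \<Longrightarrow> norm (f' \<sigma>) \<le> d * g \<sigma>"
    unfolding bigO_def by blast
  then show ?thesis
    by (intro bigOI[where c = "c + d"]) (auto simp: distrib_right intro!: norm_triangle_mono)
qed

lemma bigO_bounded_linear:
  assumes "bounded_linear h" "bigO D f g"
  shows "bigO D (\<lambda>\<sigma>. h (f \<sigma>)) g"
proof -
  obtain K where K: "K > 0" "\<And>x. norm (h x) \<le> norm x * K"
    using bounded_linear.pos_bounded[OF assms(1)] by blast
  have "bigO D (\<lambda>\<sigma>. h (f \<sigma>)) (\<lambda>\<sigma>. norm (f \<sigma>))"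
    using K by (intro bigOI[where c = K]) (auto simp: mult.commute)
  then show ?thesis using assms(2) bigO_norm_iff bigO_trans by blast
qed

lemma bigO_minus: "bigO D f g \<Longrightarrow> bigO D (\<lambda>\<sigma>. - f \<sigma>) g"
  by (simp add: bigO_def)

lemma bigO_diff: "bigO D f g \<Longrightarrow> bigO D f' g \<Longrightarrow> bigO D (\<lambda>\<sigma>. f \<sigma> - f' \<sigma>) g"
  using bigO_add[of D f g "\<lambda>\<sigma>. - f' \<sigma>"] by (simp add: bigO_minus)

lemma bigO_scaleR: "bigO D f g \<Longrightarrow> bigO D (\<lambda>\<sigma>. k *\<^sub>R f \<sigma>) g"
  by (rule bigO_bounded_linear[OF bounded_linear_scaleR_right])

lemma bigO_mult_left: "bigO D f g \<Longrightarrow> bigO D (\<lambda>\<sigma>. k * f \<sigma>) g" for k :: real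
  by (rule bigO_bounded_linear[OF bounded_linear_mult_right])

lemma bigO_sum:
  assumes "\<And>i. i \<in> I \<Longrightarrow> bigO D (f i) g"
  shows "bigO D (\<lambda>\<sigma>. \<Sum>i\<in>I. f i \<sigma>) g"
  using assms by (induction I rule: infinite_finite_induct) (auto intro: bigO_zero bigO_add)

text \<open>The nonlinear terms of the model are built from bounded bilinear products, so this rule
  determines their order from the orders of the factors.\<close>

lemma bigO_bilinear:
  assumes "bounded_bilinear h" "bigO D f g" "bigO D f' g'"
  shows "bigO D (\<lambda>\<sigma>. h (f \<sigma>) (f' \<sigma>)) (\<lambda>\<sigma>. g \<sigma> * g' \<sigma>)"
proof -
  obtain K where K: "K > 0" "\<And>x y. norm (h x y) \<le> norm x * norm y * K"
    using bounded_bilinear.pos_bounded[OF assms(1)] by blast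
  obtain c d where c: "c \<ge> 0" "\<And>\<sigma>. \<sigma> \<in> D \<Longrightarrow> norm (f \<sigma>) \<le> c * g \<sigma>"
    and d: "d \<ge> 0" "\<And>\<sigma>. \<sigma> \<in> D \<Longrightarrow> norm (f' \<sigma>) \<le> d * g' \<sigma>"
    using assms(2,3) unfolding bigO_def by blast
  have "norm (h (f \<sigma>) (f' \<sigma>)) \<le> (c * d * K) * (g \<sigma> * g' \<sigma>)" if "\<sigma> \<in> D" for \<sigma>
  proof -
    have "norm (h (f \<sigma>) (f' \<sigma>)) \<le> norm (f \<sigma>) * norm (f' \<sigma>) * K" by (rule K)
    also have "\<dots> \<le> (c * g \<sigma>) * (d * g' \<sigma>) * K"
    proof (intro mult_right_mono mult_mono c(2) d(2) that)
      show "0 \<le> c * g \<sigma>" using c(2)[OF that] norm_ge_zero order_trans by blast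
    qed (use K in auto)
    finally show ?thesis by (simp add: mult_ac)
  qed
  then show ?thesis using c d K by (intro bigOI[where c = "c * d * K"]) auto
qed

lemma bigO_component: "bigO D f g \<Longrightarrow> bigO D (\<lambda>\<sigma>. f \<sigma> $ i) g" for f :: "'s \<Rightarrow> 'b::real_normed_vector ^ 'n"
  by (rule bigO_bounded_linear[OF bounded_linear_vec_nth])

lemma bigO_mat_app:
  "(\<And>c. c \<in> I \<Longrightarrow> bigO D (\<lambda>\<sigma>. x \<sigma> c) g) \<Longrightarrow> bigO D (\<lambda>\<sigma>. mat_app I A (x \<sigma>) r) g"
  unfolding mat_app_def by (intro bigO_sum bigO_mult_left)

section \<open>The linear and bilinear maps that occur in the model\<close>

lemma bounded_bilinear_matrix_vector_mult: "bounded_bilinear ((*v) :: real^'m::finite^'n::finite \<Rightarrow> _)"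
proof -
  have "bilinear ((*v) :: real^'m::finite^'n::finite \<Rightarrow> _)"
    by (auto simp: bilinear_def linear_iff matrix_vector_right_distrib matrix_vector_mult_add_rdistrib
        scaleR_matrix_vector_assoc[symmetric] matrix_vector_mult_scaleR)
  then show ?thesis by (simp add: bilinear_conv_bounded_bilinear)
qed

lemma bounded_bilinear_matrix_matrix_mult:
  "bounded_bilinear ((**) :: real^'m::finite^'n::finite \<Rightarrow> real^'k::finite^'m \<Rightarrow> _)"
proof -
  have "bilinear ((**) :: real^'m::finite^'n::finite \<Rightarrow> real^'k::finite^'m \<Rightarrow> _)"
    by (auto simp: bilinear_def linear_iff matrix_add_ldistrib matrix_scalar_ac scalar_matrix_assoc
        vec_eq_iff matrix_matrix_mult_def sum.distrib distrib_right distrib_left sum_distrib_left mult_ac)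
  then show ?thesis by (simp add: bilinear_conv_bounded_bilinear)
qed

lemma bounded_bilinear_cross: "bounded_bilinear cross3"
  using bilinear_cross by (simp add: bilinear_conv_bounded_bilinear)

lemma bounded_linear_transpose: "bounded_linear (transpose :: real^'m::finite^'n::finite \<Rightarrow> _)"
  by (simp add: linear_conv_bounded_linear[symmetric] linear_iff transpose_def vec_eq_iff)

lemma bounded_linear_hat: "bounded_linear hat"
  by (simp add: linear_conv_bounded_linear[symmetric] linear_iff hat_def matrix_def cross3_def
      axis_def vec_eq_iff forall_3 algebra_simps)

text \<open>Both attitude errors are values of this linear map: \<open>eR0\<close> at the payload
  attitude, and \<open>eR\<close> at the relative attitude \<open>transpose Rc ** R\<close>. By
  linearity it commutes with time derivatives.\<close>

definition skew_part :: "real^3^3 \<Rightarrow> real^3" where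
  "skew_part Y = (1/2) *\<^sub>R vee (Y - transpose Y)"

lemma bounded_linear_skew_part: "bounded_linear skew_part"
  by (simp add: linear_conv_bounded_linear[symmetric] linear_iff skew_part_def vee_def transpose_def
      vec_eq_iff forall_3 algebra_simps)

lemma skew_part_hat: "skew_part (hat w) = w"
  by (simp add: skew_part_def vee_def transpose_def hat_def matrix_def cross3_def axis_def
      vec_eq_iff forall_3)

lemma skew_part_mat1: "skew_part (mat 1) = 0"
  by (simp add: skew_part_def transpose_mat vee_def vec_eq_iff forall_3)

lemma hat_skew_part: "hat (skew_part Y) = (1/2) *\<^sub>R (Y - transpose Y)"
  by (simp add: skew_part_def vee_def transpose_def hat_def matrix_def cross3_def axis_def
      vec_eq_iff forall_3 field_simps)

definition planar :: "real^3 \<Rightarrow> real^2" where "planar v = transpose Cmat *v (e3 \<times> v)"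

lemma planar_eq: "planar v = vector [- v $ 2, v $ 1]"
  by (simp add: planar_def Cmat_transpose_mult cross3_def axis_def vec_eq_iff forall_2)

lemma bounded_linear_planar: "bounded_linear planar"
  by (simp add: linear_conv_bounded_linear[symmetric] linear_iff planar_eq vec_eq_iff forall_2)

lemma planar_e3: "planar e3 = 0"
  by (simp add: planar_eq axis_def vec_eq_iff forall_2)

text \<open>What the link coordinates lose is exactly the vertical component.\<close>

lemma horiz_planar: "horiz (planar v) = v - (v \<bullet> e3) *\<^sub>R e3"
  by (simp add: planar_eq horiz_eq axis_def inner_vec_def sum_3 vec_eq_iff forall_3)

lemma bounded_linear_horiz: "bounded_linear horiz"
  by (simp add: linear_conv_bounded_linear[symmetric] linear_iff horiz_eq vec_eq_iff forall_3)

lemmas bigO_mv = bigO_bilinear[OF bounded_bilinear_matrix_vector_mult]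
  and bigO_mm = bigO_bilinear[OF bounded_bilinear_matrix_matrix_mult]
  and bigO_cross = bigO_bilinear[OF bounded_bilinear_cross]
  and bigO_inner = bigO_bilinear[OF bounded_bilinear_inner]
  and bigO_mult = bigO_bilinear[OF bounded_bilinear_mult]
  and bigO_transpose = bigO_bounded_linear[OF bounded_linear_transpose]
  and bigO_hat = bigO_bounded_linear[OF bounded_linear_hat]
  and bigO_skew_part = bigO_bounded_linear[OF bounded_linear_skew_part]
  and bigO_planar = bigO_bounded_linear[OF bounded_linear_planar]
  and bigO_horiz = bigO_bounded_linear[OF bounded_linear_horiz]

lemma bigO_const_mv: "bigO D f g \<Longrightarrow> bigO D (\<lambda>\<sigma>. A *v f \<sigma>) g" for A :: "real^'m::finite^'n::finite"
  using bigO_mv[OF bigO_const[of D A]] by simp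

lemma bigO_const_cross: "bigO D f g \<Longrightarrow> bigO D (\<lambda>\<sigma>. a \<times> f \<sigma>) g"
  using bigO_cross[OF bigO_const[of D a]] by simp

section \<open>The dynamics near the equilibrium\<close>

primrec join :: "real^3 \<Rightarrow> real^3 \<Rightarrow> ('n \<Rightarrow> nat \<Rightarrow> real^2) \<Rightarrow> 'n coord \<Rightarrow> real" where
  "join X Y s (Pos a) = X $ a"
| "join X Y s (Att a) = Y $ a"
| "join X Y s (Link i j a) = s i j $ a"

lemma join_vectors [simp]:
  "posv (join X Y s) = X" "attv (join X Y s) = Y" "linkv (join X Y s) i j = s i j"
  by (simp_all add: posv_def attv_def linkv_def)

text \<open>For a unit vector \<open>q\<close> the double cross product is minus the projection
  orthogonal to \<open>q\<close>. In link coordinates it acts as \<open>- planar v\<close>, up to a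
  term with the factor \<open>planar q\<close>, which vanishes at the equilibrium.\<close>

lemma planar_double_cross:
  assumes "norm q = 1"
  shows "planar (q \<times> (q \<times> v)) = (q \<bullet> v) *\<^sub>R planar q - planar v"
proof -
  have "q \<bullet> q = 1" using assms by (simp add: norm_eq_1)
  then have "q \<times> (q \<times> v) = (q \<bullet> v) *\<^sub>R q - v" by (simp add: Lagrange)
  then show ?thesis
    by (simp add: bounded_linear.linear[OF bounded_linear_planar] linear_diff linear_scale)
qed

lemma planar_add: "planar (v + w) = planar v + planar w"
  and planar_diff: "planar (v - w) = planar v - planar w"
  and planar_scaleR: "planar (k *\<^sub>R v) = k *\<^sub>R planar v"
  and planar_sum: "planar (\<Sum>i\<in>I. f i) = (\<Sum>i\<in>I. planar (f i))"
  and planar_minus: "planar (- v) = - planar v"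
  using bounded_linear.linear[OF bounded_linear_planar]
  by (simp_all add: linear_add linear_diff linear_scale linear_sum linear_neg)

text \<open>The symmetric part of \<open>M - I\<close> is therefore of second order near the identity.\<close>

lemma orthogonal_symmetric_part:
  assumes "orthogonal_matrix M"
  shows "M - mat 1 - hat (skew_part M) = (- 1/2) *\<^sub>R ((M - mat 1) ** transpose (M - mat 1))"
proof -
  have "M ** transpose M = mat 1" using assms unfolding orthogonal_matrix_def by blast
  moreover have "(M - mat 1) ** transpose (M - mat 1) = M ** transpose M - M - transpose M + mat 1"
    by (simp add: bounded_bilinear.diff_left[OF bounded_bilinear_matrix_matrix_mult]
        bounded_bilinear.diff_right[OF bounded_bilinear_matrix_matrix_mult]
        linear_diff[OF bounded_linear.linear[OF bounded_linear_transpose]] transpose_mat)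
  moreover have "U - I - (1/2) *\<^sub>R (U - T) = (- 1/2) *\<^sub>R (I - U - T + I)" for T U I :: "real^3^3"
    by (simp add: vec_eq_iff field_simps)
  ultimately show ?thesis by (simp only: hat_skew_part)
qed

text \<open>
  The elements of \<open>D\<close> stand for instants of arbitrary motions, so that the \<open>bigO\<close> estimates are
  uniform over all of them.
\<close>

locale configurations =
  fixes P :: "'n::finite plant" and Kx Kv :: "'n gain" and D :: "'s set"
    and X V :: "'s \<Rightarrow> real^3" and R :: "'s \<Rightarrow> real^3^3" and Om :: "'s \<Rightarrow> real^3"
    and q qd :: "'n \<Rightarrow> nat \<Rightarrow> 's \<Rightarrow> real^3"
    and x v :: "'s \<Rightarrow> 'n coord \<Rightarrow> real" and dev :: "'s \<Rightarrow> real"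
  assumes x_def: "x = (\<lambda>\<sigma>. join (X \<sigma>) (skew_part (R \<sigma>)) (\<lambda>i j. planar (q i j \<sigma>)))"
    and v_def: "v = (\<lambda>\<sigma>. join (V \<sigma>) (skew_part (R \<sigma> ** hat (Om \<sigma>))) (\<lambda>i j. planar (qd i j \<sigma>)))"
    and dev_def: "dev = (\<lambda>\<sigma>. norm (X \<sigma>) + norm (V \<sigma>) + norm (R \<sigma> - mat 1) + norm (Om \<sigma>)
      + (\<Sum>i\<in>UNIV. \<Sum>j\<in>links P i. norm (q i j \<sigma> - e3) + norm (qd i j \<sigma>)))"
    and dev_le_1: "\<And>\<sigma>. \<sigma> \<in> D \<Longrightarrow> dev \<sigma> \<le> 1"
begin

abbreviation "dF i \<sigma> \<equiv> inputv (lin_input P Kx Kv (x \<sigma>) (v \<sigma>)) i"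

lemma dev_nonneg: "dev \<sigma> \<ge> 0"
  unfolding dev_def by (intro add_nonneg_nonneg sum_nonneg; simp)

lemma link_sum_nonneg:
  fixes f :: "'n \<Rightarrow> nat \<Rightarrow> real"
  assumes "\<And>i j. f i j \<ge> 0" "j \<in> links P i"
  shows "f i j \<le> (\<Sum>i\<in>UNIV. \<Sum>j\<in>links P i. f i j)"
proof -
  have "f i j \<le> (\<Sum>j\<in>links P i. f i j)"
    using assms by (intro member_le_sum) auto
  also have "\<dots> \<le> (\<Sum>i\<in>UNIV. \<Sum>j\<in>links P i. f i j)"
    using assms by (intro member_le_sum sum_nonneg) auto
  finally show ?thesis .
qed

lemma dev_parts:
  "norm (X \<sigma>) \<le> dev \<sigma>" "norm (V \<sigma>) \<le> dev \<sigma>" "norm (R \<sigma> - mat 1) \<le> dev \<sigma>" "norm (Om \<sigma>) \<le> dev \<sigma>"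
  "j \<in> links P i \<Longrightarrow> norm (q i j \<sigma> - e3) \<le> dev \<sigma>" "j \<in> links P i \<Longrightarrow> norm (qd i j \<sigma>) \<le> dev \<sigma>"
proof -
  let ?S = "\<Sum>i\<in>UNIV. \<Sum>j\<in>links P i. norm (q i j \<sigma> - e3) + norm (qd i j \<sigma>)"
  have S: "?S \<ge> 0" by (intro sum_nonneg add_nonneg_nonneg) auto
  note n = norm_ge_zero[of "X \<sigma>"] norm_ge_zero[of "V \<sigma>"] norm_ge_zero[of "R \<sigma> - mat 1"] norm_ge_zero[of "Om \<sigma>"]
  show "norm (X \<sigma>) \<le> dev \<sigma>" "norm (V \<sigma>) \<le> dev \<sigma>" "norm (R \<sigma> - mat 1) \<le> dev \<sigma>" "norm (Om \<sigma>) \<le> dev \<sigma>"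
    unfolding dev_def using S n by linarith+
  assume "j \<in> links P i"
  then have "norm (q i j \<sigma> - e3) + norm (qd i j \<sigma>) \<le> ?S"
    by (intro link_sum_nonneg[of "\<lambda>i j. norm (q i j \<sigma> - e3) + norm (qd i j \<sigma>)"]) auto
  then show "norm (q i j \<sigma> - e3) \<le> dev \<sigma>" "norm (qd i j \<sigma>) \<le> dev \<sigma>"
    unfolding dev_def using n norm_ge_zero[of "q i j \<sigma> - e3"] norm_ge_zero[of "qd i j \<sigma>"] by linarith+
qed

lemma bigO_dev:
  "bigO D X dev" "bigO D V dev" "bigO D (\<lambda>\<sigma>. R \<sigma> - mat 1) dev" "bigO D Om dev"
  "j \<in> links P i \<Longrightarrow> bigO D (\<lambda>\<sigma>. q i j \<sigma> - e3) dev" "j \<in> links P i \<Longrightarrow> bigO D (qd i j) dev"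
  by (auto intro!: bigOI1 dev_parts)

lemma dev_bounded: "bigO D f dev \<Longrightarrow> bigO D f (\<lambda>_. 1)"
  by (rule bigO_le) (auto simp: dev_le_1)

lemma bounded_bilinear_left:
  assumes "bounded_bilinear h" "bigO D f (\<lambda>_. 1)" "bigO D g k"
  shows "bigO D (\<lambda>\<sigma>. h (f \<sigma>) (g \<sigma>)) k"
  using bigO_bilinear[OF assms] by simp

lemma bounded_bilinear_right:
  assumes "bounded_bilinear h" "bigO D f k" "bigO D g (\<lambda>_. 1)"
  shows "bigO D (\<lambda>\<sigma>. h (f \<sigma>) (g \<sigma>)) k"
  using bigO_bilinear[OF assms] by simp

lemmas bb = bounded_bilinear_matrix_vector_mult bounded_bilinear_matrix_matrix_mult
  bounded_bilinear_cross bounded_bilinear_inner bounded_bilinear_scaleR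
lemmas left_I = bb[THEN bounded_bilinear_left] and right_I = bb[THEN bounded_bilinear_right]

lemma R_bounded: "bigO D R (\<lambda>_. 1)"
  using bigO_add[OF dev_bounded[OF bigO_dev(3)] bigO_const[of _ "mat 1"]] by simp

lemma RT_bounded: "bigO D (\<lambda>\<sigma>. transpose (R \<sigma>)) (\<lambda>_. 1)"
  by (rule bigO_transpose[OF R_bounded])

lemma RT_dev: "bigO D (\<lambda>\<sigma>. transpose (R \<sigma>) - mat 1) dev"
proof -
  have "transpose (M - mat 1) = transpose M - mat 1" for M :: "real^3^3"
    by (simp add: linear_diff[OF bounded_linear.linear[OF bounded_linear_transpose]] transpose_mat)
  then show ?thesis using bigO_transpose[OF bigO_dev(3)] by simp
qed

lemma q_bounded: "j \<in> links P i \<Longrightarrow> bigO D (q i j) (\<lambda>_. 1)"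
  using bigO_add[OF dev_bounded[OF bigO_dev(5)] bigO_const[of _ "e3"]] by simp

lemma planar_q: "j \<in> links P i \<Longrightarrow> bigO D (\<lambda>\<sigma>. planar (q i j \<sigma>)) dev"
  using bigO_planar[OF bigO_dev(5)] by (simp add: planar_diff planar_e3)

lemma skew_R: "bigO D (\<lambda>\<sigma>. skew_part (R \<sigma>)) dev"
  using bigO_skew_part[OF bigO_dev(3)]
  by (simp add: linear_diff[OF bounded_linear.linear[OF bounded_linear_skew_part]] skew_part_mat1)

lemma
  assumes "s \<in> coords P"
  shows x_dev: "bigO D (\<lambda>\<sigma>. x \<sigma> s) dev" and v_dev: "bigO D (\<lambda>\<sigma>. v \<sigma> s) dev"
proof -
  have "bigO D (\<lambda>\<sigma>. skew_part (R \<sigma> ** hat (Om \<sigma>))) dev"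
    by (intro bigO_skew_part left_I R_bounded bigO_hat bigO_dev)
  moreover have "j \<in> links P i" if "s = Link i j b" for i j b
    using assms that by (auto simp: coords_def)
  ultimately show "bigO D (\<lambda>\<sigma>. x \<sigma> s) dev" "bigO D (\<lambda>\<sigma>. v \<sigma> s) dev"
    unfolding x_def v_def
    by (cases s; simp add: bigO_component bigO_dev skew_R planar_q bigO_planar)+
qed

lemma dF_dev: "bigO D (dF i) dev"
proof -
  have "bigO D (\<lambda>\<sigma>. lin_input P Kx Kv (x \<sigma>) (v \<sigma>) (i, b)) dev" for b
    unfolding lin_input_def by (intro bigO_diff bigO_minus bigO_mat_app x_dev v_dev)
  then have "bigO D (\<lambda>\<sigma>. \<Sum>b\<in>UNIV. lin_input P Kx Kv (x \<sigma>) (v \<sigma>) (i, b) *\<^sub>R axis b (1::real)) dev"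
    by (intro bigO_sum bounded_bilinear_right[OF bounded_bilinear_scaleR] bigO_const) auto
  then show ?thesis
    by (rule bigO_cong[rotated]) (simp add: inputv_def vec_eq_iff axis_def sum_3 forall_3)
qed

end

text \<open>\<open>F\<close> are the applied forces and \<open>Er\<close> their deviations from the commanded ones.\<close>

locale snapshots = configurations P Kx Kv D X V R Om q qd x v dev
  for P :: "'n::finite plant" and Kx Kv :: "'n gain" and D :: "'s set"
    and X V :: "'s \<Rightarrow> real^3" and R :: "'s \<Rightarrow> real^3^3" and Om :: "'s \<Rightarrow> real^3"
    and q qd :: "'n \<Rightarrow> nat \<Rightarrow> 's \<Rightarrow> real^3" and x v dev +
  fixes A dOm :: "'s \<Rightarrow> real^3" and qdd :: "'n \<Rightarrow> nat \<Rightarrow> 's \<Rightarrow> real^3"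
    and F Er :: "'n \<Rightarrow> 's \<Rightarrow> real^3" and err :: "'s \<Rightarrow> real"
    and a :: "'s \<Rightarrow> 'n coord \<Rightarrow> real" and acc :: "'s \<Rightarrow> real"
  assumes a_def: "a = (\<lambda>\<sigma>. join (A \<sigma>) (skew_part (R \<sigma> ** hat (Om \<sigma>) ** hat (Om \<sigma>) + R \<sigma> ** hat (dOm \<sigma>)))
      (\<lambda>i j. planar (qdd i j \<sigma>)))"
    and acc_def: "acc = (\<lambda>\<sigma>. norm (A \<sigma>) + norm (dOm \<sigma>) + (\<Sum>i\<in>UNIV. \<Sum>j\<in>links P i. norm (qdd i j \<sigma>)))"
    and equilibrium: "(\<Sum>i\<in>UNIV. rho P i) \<times> e3 = 0"
    and orth: "\<And>\<sigma>. \<sigma> \<in> D \<Longrightarrow> orthogonal_matrix (R \<sigma>)"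
    and unit: "\<And>\<sigma> i j. \<sigma> \<in> D \<Longrightarrow> j \<in> links P i \<Longrightarrow> norm (q i j \<sigma>) = 1"
    and unit1: "\<And>\<sigma> i j. \<sigma> \<in> D \<Longrightarrow> j \<in> links P i \<Longrightarrow> q i j \<sigma> \<bullet> qd i j \<sigma> = 0"
    and unit2: "\<And>\<sigma> i j. \<sigma> \<in> D \<Longrightarrow> j \<in> links P i \<Longrightarrow> q i j \<sigma> \<bullet> qdd i j \<sigma> = - (qd i j \<sigma> \<bullet> qd i j \<sigma>)"
    and eqP: "\<And>\<sigma>. \<sigma> \<in> D \<Longrightarrow> MT P *\<^sub>R A \<sigma>
      - (\<Sum>i\<in>UNIV. \<Sum>j\<in>links P i. (M0 P i j * llink P i j) *\<^sub>R qdd i j \<sigma>)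
      - (\<Sum>i\<in>UNIV. MiT P i *\<^sub>R (R \<sigma> *v (rho P i \<times> dOm \<sigma>)))
      = (MT P * grav P) *\<^sub>R e3 + (\<Sum>i\<in>UNIV. F i \<sigma>)
      - (\<Sum>i\<in>UNIV. MiT P i *\<^sub>R (R \<sigma> *v (Om \<sigma> \<times> (Om \<sigma> \<times> rho P i))))"
    and eqR: "\<And>\<sigma>. \<sigma> \<in> D \<Longrightarrow> Jbar P *v dOm \<sigma>
      + (\<Sum>i\<in>UNIV. MiT P i *\<^sub>R (rho P i \<times> (transpose (R \<sigma>) *v A \<sigma>)))
      - (\<Sum>i\<in>UNIV. \<Sum>j\<in>links P i. (M0 P i j * llink P i j) *\<^sub>R (rho P i \<times> (transpose (R \<sigma>) *v qdd i j \<sigma>)))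
      = (\<Sum>i\<in>UNIV. rho P i \<times> (transpose (R \<sigma>) *v (F i \<sigma> + (MiT P i * grav P) *\<^sub>R e3)))
      - Om \<sigma> \<times> (Jbar P *v Om \<sigma>)"
    and eqL: "\<And>\<sigma> i j. \<sigma> \<in> D \<Longrightarrow> j \<in> links P i \<Longrightarrow>
      (\<Sum>k\<in>links P i. (M0 P i (min j k) * llink P i k) *\<^sub>R (q i j \<sigma> \<times> (q i j \<sigma> \<times> qdd i k \<sigma>)))
      - M0 P i j *\<^sub>R (q i j \<sigma> \<times> (q i j \<sigma> \<times> A \<sigma>))
      + M0 P i j *\<^sub>R (q i j \<sigma> \<times> (q i j \<sigma> \<times> (R \<sigma> *v (rho P i \<times> dOm \<sigma>))))
      = M0 P i j *\<^sub>R (q i j \<sigma> \<times> (q i j \<sigma> \<times> (R \<sigma> *v (Om \<sigma> \<times> (Om \<sigma> \<times> rho P i)))))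
      - q i j \<sigma> \<times> (q i j \<sigma> \<times> ((M0 P i j * grav P) *\<^sub>R e3 + F i \<sigma>))"
    and force: "\<And>\<sigma> i. \<sigma> \<in> D \<Longrightarrow>
      F i \<sigma> = u_star P i + inputv (lin_input P Kx Kv (x \<sigma>) (v \<sigma>)) i + Er i \<sigma>"
    and Er_le: "\<And>i \<sigma>. \<sigma> \<in> D \<Longrightarrow>
      norm (Er i \<sigma>) \<le> 2 * norm (u_star P i + inputv (lin_input P Kx Kv (x \<sigma>) (v \<sigma>)) i) * err \<sigma>"
    and err_nonneg: "\<And>\<sigma>. err \<sigma> \<ge> 0"
begin

abbreviation "Y \<sigma> \<equiv> skew_part (R \<sigma> ** hat (Om \<sigma>) ** hat (Om \<sigma>) + R \<sigma> ** hat (dOm \<sigma>))"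

text \<open>The order of what the linearization discards: products of a deviation with a deviation
  or an acceleration, and the effect of misaligned thrusts. The accelerations remain in the bound
  because the equations are implicit in them.\<close>

definition "G \<sigma> = dev \<sigma> * (dev \<sigma> + acc \<sigma>) + err \<sigma>"

lemma acc_nonneg: "acc \<sigma> \<ge> 0"
  unfolding acc_def by (intro add_nonneg_nonneg sum_nonneg; simp)

text \<open>The misalignment error is given relative to the commanded force, and this force is
  bounded because the deviation is at most 1.\<close>

lemma Er: "bigO D (Er i) err"
proof -
  have "bigO D (\<lambda>\<sigma>. u_star P i + dF i \<sigma>) (\<lambda>_. 1)"
    by (intro bigO_add bigO_const dev_bounded dF_dev)
  then have "bigO D (\<lambda>\<sigma>. (2 * norm (u_star P i + dF i \<sigma>)) * err \<sigma>) (\<lambda>\<sigma>. 1 * err \<sigma>)"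
    by (intro bigO_mult bigO_mult_left) (simp_all add: bigO_norm_iff bigOI1 err_nonneg)
  then show ?thesis
    using bigO_trans[OF bigOI1[of D "Er i" "\<lambda>\<sigma>. (2 * norm (u_star P i + dF i \<sigma>)) * err \<sigma>"]] Er_le by simp
qed

lemma acc_parts:
  "norm (A \<sigma>) \<le> acc \<sigma>" "norm (dOm \<sigma>) \<le> acc \<sigma>" "j \<in> links P i \<Longrightarrow> norm (qdd i j \<sigma>) \<le> acc \<sigma>"
proof -
  let ?S = "\<Sum>i\<in>UNIV. \<Sum>j\<in>links P i. norm (qdd i j \<sigma>)"
  have S: "?S \<ge> 0" by (intro sum_nonneg) auto
  note n = norm_ge_zero[of "A \<sigma>"] norm_ge_zero[of "dOm \<sigma>"]
  show "norm (A \<sigma>) \<le> acc \<sigma>" "norm (dOm \<sigma>) \<le> acc \<sigma>"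
    unfolding acc_def using S n by linarith+
  assume "j \<in> links P i"
  then have "norm (qdd i j \<sigma>) \<le> ?S"
    by (intro link_sum_nonneg[of "\<lambda>i j. norm (qdd i j \<sigma>)"]) auto
  then show "norm (qdd i j \<sigma>) \<le> acc \<sigma>"
    unfolding acc_def using n by linarith
qed

lemma dev_acc: "bigO D f dev \<Longrightarrow> bigO D f (\<lambda>\<sigma>. dev \<sigma> + acc \<sigma>)"
  by (rule bigO_le) (auto simp: acc_nonneg)

lemma bigO_acc:
  "bigO D A (\<lambda>\<sigma>. dev \<sigma> + acc \<sigma>)" "bigO D dOm (\<lambda>\<sigma>. dev \<sigma> + acc \<sigma>)"
  "j \<in> links P i \<Longrightarrow> bigO D (qdd i j) (\<lambda>\<sigma>. dev \<sigma> + acc \<sigma>)"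
  by (auto intro!: bigOI1 order_trans[OF acc_parts(1)] order_trans[OF acc_parts(2)]
      order_trans[OF acc_parts(3)] dev_nonneg)

text \<open>The rule for second-order terms: one factor is of the order of the deviation, the other
  may also be of the order of an acceleration.\<close>

lemma bilinear_G:
  assumes "bounded_bilinear h" "bigO D f dev" "bigO D g (\<lambda>\<sigma>. dev \<sigma> + acc \<sigma>)"
  shows "bigO D (\<lambda>\<sigma>. h (f \<sigma>) (g \<sigma>)) G"
  by (rule bigO_le[OF bigO_bilinear[OF assms]]) (simp add: G_def err_nonneg)

lemma bilinear_G':
  assumes "bounded_bilinear h" "bigO D f (\<lambda>\<sigma>. dev \<sigma> + acc \<sigma>)" "bigO D g dev"
  shows "bigO D (\<lambda>\<sigma>. h (f \<sigma>) (g \<sigma>)) G"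
  by (rule bigO_le[OF bigO_bilinear[OF assms]]) (simp add: G_def err_nonneg mult.commute)

lemmas G_I = bb[THEN bilinear_G]

lemma err_G: "bigO D f err \<Longrightarrow> bigO D f G"
  by (rule bigO_le) (auto simp: G_def dev_nonneg acc_nonneg)

text \<open>The left-hand side is the symmetric part of \<open>R - I\<close>, which orthogonality
  makes quadratic. It permits replacing \<open>R^T e3\<close> by
  \<open>e3 + e3 x skew_part R\<close> in the moment of the payload weight.\<close>

lemma R_second_order: "bigO D (\<lambda>\<sigma>. transpose (R \<sigma>) - mat 1 + hat (skew_part (R \<sigma>))) G"
proof (rule bigO_cong)
  show "transpose (R \<sigma>) - mat 1 + hat (skew_part (R \<sigma>))
    = (- 1/2) *\<^sub>R ((R \<sigma> - mat 1) ** transpose (R \<sigma> - mat 1))" if "\<sigma> \<in> D" for \<sigma>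
  proof -
    have "T - I + (1/2) *\<^sub>R (U - T) = U - I - (1/2) *\<^sub>R (U - T)" for T U I :: "real^3^3"
      by (simp add: vec_eq_iff field_simps)
    then show ?thesis
      using orthogonal_symmetric_part[OF orth[OF that]] by (simp only: hat_skew_part)
  qed
  show "bigO D (\<lambda>\<sigma>. (- 1/2) *\<^sub>R ((R \<sigma> - mat 1) ** transpose (R \<sigma> - mat 1))) G"
    by (intro bigO_scaleR G_I bigO_transpose bigO_dev dev_acc)
qed

lemma Om_Om: "bigO D (\<lambda>\<sigma>. Om \<sigma> \<times> (Om \<sigma> \<times> r)) G"
  by (intro G_I bigO_dev dev_acc right_I bigO_const)

text \<open>\<open>Y\<close> is the second derivative of the attitude coordinates. It differs from
  the angular acceleration by terms that contain \<open>Om\<close> twice or \<open>R - I\<close>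
  times \<open>dOm\<close>.\<close>

lemma Y_dOm: "bigO D (\<lambda>\<sigma>. Y \<sigma> - dOm \<sigma>) G"
proof (rule bigO_cong)
  fix \<sigma>
  have "(M - mat 1) ** B = M ** B - B" for M B :: "real^3^3" by (rule bounded_bilinear.diff_left[OF bb(2), where a = M and a' = "mat 1", simplified])
  moreover have "dOm \<sigma> = skew_part (hat (dOm \<sigma>))" by (simp add: skew_part_hat)
  moreover have "skew_part (B + C) = skew_part B + skew_part C" "skew_part (B - C) = skew_part B - skew_part C" for B C
    using bounded_linear.linear[OF bounded_linear_skew_part] by (simp_all add: linear_add linear_diff)
  ultimately show "Y \<sigma> - dOm \<sigma> = skew_part (R \<sigma> ** hat (Om \<sigma>) ** hat (Om \<sigma>))
    + skew_part ((R \<sigma> - mat 1) ** hat (dOm \<sigma>))" by simp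
next
  show "bigO D (\<lambda>\<sigma>. skew_part (R \<sigma> ** hat (Om \<sigma>) ** hat (Om \<sigma>)) + skew_part ((R \<sigma> - mat 1) ** hat (dOm \<sigma>))) G"
    by (intro bigO_add bigO_skew_part G_I bigO_dev bigO_hat dev_acc bigO_acc
        left_I R_bounded)
qed

text \<open>Differentiating the unit length of \<open>q\<close> twice gives
  \<open>q . q'' = - |q'|^2\<close>, so the vertical component of \<open>q''\<close>, which the link
  coordinates do not show, is of second order.\<close>

lemma qdd_vertical: "j \<in> links P i \<Longrightarrow> bigO D (\<lambda>\<sigma>. qdd i j \<sigma> - horiz (planar (qdd i j \<sigma>))) G"
proof (rule bigO_cong)
  fix \<sigma> assume D: "\<sigma> \<in> D" and j: "j \<in> links P i"
  have "qdd i j \<sigma> \<bullet> e3 = - (qd i j \<sigma> \<bullet> qd i j \<sigma>) - (q i j \<sigma> - e3) \<bullet> qdd i j \<sigma>"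
    using unit2[OF D j] by (simp add: inner_diff_left inner_commute[of e3])
  then show "qdd i j \<sigma> - horiz (planar (qdd i j \<sigma>))
    = (- (qd i j \<sigma> \<bullet> qd i j \<sigma>) - (q i j \<sigma> - e3) \<bullet> qdd i j \<sigma>) *\<^sub>R e3"
    by (simp add: horiz_planar)
next
  assume j: "j \<in> links P i"
  show "bigO D (\<lambda>\<sigma>. (- (qd i j \<sigma> \<bullet> qd i j \<sigma>) - (q i j \<sigma> - e3) \<bullet> qdd i j \<sigma>) *\<^sub>R e3) G"
    by (rule right_I(5)[OF bigO_diff[OF bigO_minus[OF G_I(4)[OF bigO_dev(6) dev_acc[OF bigO_dev(6)]]]
        G_I(4)[OF bigO_dev(5) bigO_acc(3)]] bigO_const]) (rule j)+
qed

lemma rotated_dOm: "bigO D (\<lambda>\<sigma>. R \<sigma> *v (r \<times> dOm \<sigma>) - r \<times> Y \<sigma>) G"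
proof (rule bigO_cong)
  fix \<sigma>
  have "(M - mat 1) *v w = M *v w - w" for M :: "real^3^3" and w
    by (simp add: matrix_vector_mult_diff_rdistrib)
  moreover have "r \<times> (y - w) = r \<times> y - r \<times> w" for y w
    by (simp add: right_diff_distrib bounded_bilinear.diff_right[OF bounded_bilinear_cross])
  ultimately show "R \<sigma> *v (r \<times> dOm \<sigma>) - r \<times> Y \<sigma> = (R \<sigma> - mat 1) *v (r \<times> dOm \<sigma>) - r \<times> (Y \<sigma> - dOm \<sigma>)"
    by simp
next
  show "bigO D (\<lambda>\<sigma>. (R \<sigma> - mat 1) *v (r \<times> dOm \<sigma>) - r \<times> (Y \<sigma> - dOm \<sigma>)) G"
    by (intro bigO_diff G_I bigO_dev bigO_const_cross bigO_acc Y_dOm)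
qed

lemma rotated_Om_Om: "bigO D (\<lambda>\<sigma>. R \<sigma> *v (Om \<sigma> \<times> (Om \<sigma> \<times> r))) G"
  by (intro left_I R_bounded Om_Om)

section \<open>Residuals of the linearized equations of motion\<close>

lemma total_weight: "(\<Sum>i\<in>UNIV. u_star P i) = - ((MT P * grav P) *\<^sub>R e3)"
proof -
  have "(\<Sum>i\<in>(UNIV::'n set). (MiT P i + mass0 P / real CARD('n)) * grav P) = MT P * grav P"
    by (simp add: MT_def sum.distrib sum_distrib_right[symmetric] add.commute)
  then show ?thesis
    unfolding u_star_def by (simp add: sum_negf scaleR_sum_left[symmetric])
qed

text \<open>The nominal thrusts balance the total weight, so the constant terms cancel. Each
  remaining difference from the linear row is one of the remainders estimated above.\<close>

lemma residual_Pos: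
  "bigO D (\<lambda>\<sigma>. MT P *\<^sub>R A \<sigma> - (\<Sum>i\<in>UNIV. MiT P i *\<^sub>R (rho P i \<times> Y \<sigma>))
     - (\<Sum>i\<in>UNIV. \<Sum>j\<in>links P i. (M0 P i j * llink P i j) *\<^sub>R horiz (planar (qdd i j \<sigma>)))
     - (\<Sum>i\<in>UNIV. dF i \<sigma>)) G" (is "bigO D ?f G")
proof (rule bigO_cong)
  let ?g = "\<lambda>\<sigma>. (\<Sum>i\<in>UNIV. \<Sum>j\<in>links P i. (M0 P i j * llink P i j) *\<^sub>R (qdd i j \<sigma> - horiz (planar (qdd i j \<sigma>))))
    + (\<Sum>i\<in>UNIV. MiT P i *\<^sub>R (R \<sigma> *v (rho P i \<times> dOm \<sigma>) - rho P i \<times> Y \<sigma>))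
    + (\<Sum>i\<in>UNIV. Er i \<sigma>) - (\<Sum>i\<in>UNIV. MiT P i *\<^sub>R (R \<sigma> *v (Om \<sigma> \<times> (Om \<sigma> \<times> rho P i))))"
  fix \<sigma> assume D: "\<sigma> \<in> D"
  have "(\<Sum>i\<in>UNIV. F i \<sigma>) = - ((MT P * grav P) *\<^sub>R e3) + (\<Sum>i\<in>UNIV. dF i \<sigma>) + (\<Sum>i\<in>UNIV. Er i \<sigma>)"
    by (simp add: force[OF D] sum.distrib total_weight)
  then show "?f \<sigma> = ?g \<sigma>"
    using eqP[OF D] by (simp add: scaleR_diff_right sum_subtractf algebra_simps)
next
  show "bigO D (\<lambda>\<sigma>. (\<Sum>i\<in>UNIV. \<Sum>j\<in>links P i. (M0 P i j * llink P i j) *\<^sub>R (qdd i j \<sigma> - horiz (planar (qdd i j \<sigma>))))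
    + (\<Sum>i\<in>UNIV. MiT P i *\<^sub>R (R \<sigma> *v (rho P i \<times> dOm \<sigma>) - rho P i \<times> Y \<sigma>))
    + (\<Sum>i\<in>UNIV. Er i \<sigma>) - (\<Sum>i\<in>UNIV. MiT P i *\<^sub>R (R \<sigma> *v (Om \<sigma> \<times> (Om \<sigma> \<times> rho P i))))) G"
    by (intro bigO_diff[where f = "\<lambda>\<sigma>. _ \<sigma> + _ \<sigma>"] bigO_add bigO_sum bigO_scaleR rotated_dOm rotated_Om_Om
        err_G[OF Er] qdd_vertical)
qed

text \<open>Each nominal thrust contains a share \<open>m0 g / n\<close> of the payload weight,
  which keeps its direction in space while the payload turns. In the body frame its moment involves
  \<open>R^T e3\<close>, and the linear part of this vector yields the stiffness term.\<close>

lemma residual_Att: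
  "bigO D (\<lambda>\<sigma>. Jbar P *v Y \<sigma> + (\<Sum>i\<in>UNIV. MiT P i *\<^sub>R (rho P i \<times> A \<sigma>))
     - (\<Sum>i\<in>UNIV. \<Sum>j\<in>links P i. (M0 P i j * llink P i j) *\<^sub>R (rho P i \<times> horiz (planar (qdd i j \<sigma>))))
     + (\<Sum>i\<in>UNIV. (mass0 P / real CARD('n) * grav P) *\<^sub>R (rho P i \<times> (e3 \<times> skew_part (R \<sigma>))))
     - (\<Sum>i\<in>UNIV. rho P i \<times> dF i \<sigma>)) G" (is "bigO D ?f G")
proof (rule bigO_cong)
  let ?k = "mass0 P / real CARD('n) * grav P"
  let ?S = "\<lambda>\<sigma>. transpose (R \<sigma>) - mat 1 + hat (skew_part (R \<sigma>))"
  let ?g = "\<lambda>\<sigma>. Jbar P *v (Y \<sigma> - dOm \<sigma>)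
    + (\<Sum>i\<in>UNIV. (- MiT P i) *\<^sub>R (rho P i \<times> ((transpose (R \<sigma>) - mat 1) *v A \<sigma>)))
    + (\<Sum>i\<in>UNIV. \<Sum>j\<in>links P i. (M0 P i j * llink P i j) *\<^sub>R
        (rho P i \<times> ((transpose (R \<sigma>) - mat 1) *v qdd i j \<sigma> + (qdd i j \<sigma> - horiz (planar (qdd i j \<sigma>))))))
    + (\<Sum>i\<in>UNIV. rho P i \<times> ((transpose (R \<sigma>) - mat 1) *v dF i \<sigma> + transpose (R \<sigma>) *v Er i \<sigma> - ?k *\<^sub>R (?S \<sigma> *v e3)))
    - Om \<sigma> \<times> (Jbar P *v Om \<sigma>)"
  note cl = bounded_bilinear.add_right[OF bounded_bilinear_cross] bounded_bilinear.diff_right[OF bounded_bilinear_cross]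
    bounded_bilinear.scaleR_right[OF bounded_bilinear_cross] bounded_bilinear.minus_right[OF bounded_bilinear_cross]
  note ml = matrix_vector_mult_diff_rdistrib matrix_vector_mult_add_rdistrib matrix_vector_right_distrib
    matrix_vector_mult_diff_distrib matrix_vector_mult_scaleR
  fix \<sigma> assume D: "\<sigma> \<in> D"
  let ?T = "transpose (R \<sigma>)"
  \<comment> \<open>The constant moment vanishes by the equilibrium assumption on the attachment
    points.\<close>
  have e3: "(\<Sum>i\<in>UNIV. ?k *\<^sub>R (rho P i \<times> e3)) = 0"
  proof -
    have "(\<Sum>i\<in>UNIV. rho P i \<times> e3) = (\<Sum>i\<in>UNIV. rho P i) \<times> e3"
      by (rule bounded_bilinear.sum_left[OF bounded_bilinear_cross, symmetric])
    then show ?thesis using equilibrium by (simp add: scaleR_sum_right[symmetric])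
  qed
  \<comment> \<open>The weight of cable and quadrotor cancels against the nominal thrust, leaving
    the share \<open>?k\<close> of the payload weight.\<close>
  have Fe: "?T *v (F i \<sigma> + (MiT P i * grav P) *\<^sub>R e3) = ?T *v dF i \<sigma> + ?T *v Er i \<sigma> - ?k *\<^sub>R (?T *v e3)" for i
    unfolding force[OF D] u_star_def
    by (simp add: ml distrib_right scaleR_left_distrib bounded_bilinear.minus_right[OF bb(1)] algebra_simps)
  have "e3 \<times> w = - (w \<times> e3)" for w by (rule cross_skew)
  then have Se: "?S \<sigma> *v e3 = ?T *v e3 - e3 - e3 \<times> skew_part (R \<sigma>)"
    by (simp add: ml hat_mult)
  have eq: "Jbar P *v dOm \<sigma> = - (\<Sum>i\<in>UNIV. MiT P i *\<^sub>R (rho P i \<times> (?T *v A \<sigma>)))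
      + (\<Sum>i\<in>UNIV. \<Sum>j\<in>links P i. (M0 P i j * llink P i j) *\<^sub>R (rho P i \<times> (?T *v qdd i j \<sigma>)))
      + (\<Sum>i\<in>UNIV. rho P i \<times> (?T *v dF i \<sigma> + ?T *v Er i \<sigma> - ?k *\<^sub>R (?T *v e3)))
      - Om \<sigma> \<times> (Jbar P *v Om \<sigma>)"
    using eqR[OF D] unfolding Fe by (simp add: algebra_simps)
  show "?f \<sigma> = ?g \<sigma>"
    unfolding matrix_vector_mult_diff_distrib[of "Jbar P"] eq Se
    using e3
    by (simp add: ml cl scaleR_diff_right scaleR_add_right sum_subtractf sum.distrib sum_negf)
next
  let ?k = "mass0 P / real CARD('n) * grav P"
  show "bigO D (\<lambda>\<sigma>. Jbar P *v (Y \<sigma> - dOm \<sigma>)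
    + (\<Sum>i\<in>UNIV. (- MiT P i) *\<^sub>R (rho P i \<times> ((transpose (R \<sigma>) - mat 1) *v A \<sigma>)))
    + (\<Sum>i\<in>UNIV. \<Sum>j\<in>links P i. (M0 P i j * llink P i j) *\<^sub>R
        (rho P i \<times> ((transpose (R \<sigma>) - mat 1) *v qdd i j \<sigma> + (qdd i j \<sigma> - horiz (planar (qdd i j \<sigma>))))))
    + (\<Sum>i\<in>UNIV. rho P i \<times> ((transpose (R \<sigma>) - mat 1) *v dF i \<sigma> + transpose (R \<sigma>) *v Er i \<sigma>
        - ?k *\<^sub>R ((transpose (R \<sigma>) - mat 1 + hat (skew_part (R \<sigma>))) *v e3)))
    - Om \<sigma> \<times> (Jbar P *v Om \<sigma>)) G" (is "bigO D (\<lambda>\<sigma>. ?g1 \<sigma> + ?g2 \<sigma> + ?g3 \<sigma> + ?g4 \<sigma> - ?g5 \<sigma>) G")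
  proof (intro bigO_diff[where f = "\<lambda>\<sigma>. ?g1 \<sigma> + ?g2 \<sigma> + ?g3 \<sigma> + ?g4 \<sigma>"] bigO_add)
    show "bigO D ?g1 G" by (intro bigO_const_mv Y_dOm)
    show "bigO D ?g2 G" by (intro bigO_sum bigO_scaleR bigO_const_cross G_I RT_dev bigO_acc)
    show "bigO D ?g3 G"
      by (intro bigO_sum bigO_scaleR bigO_const_cross bigO_add G_I RT_dev bigO_acc qdd_vertical)
    have "bigO D (\<lambda>\<sigma>. (transpose (R \<sigma>) - mat 1 + hat (skew_part (R \<sigma>))) *v e3) G"
      by (intro right_I R_second_order bigO_const)
    moreover have "bigO D (\<lambda>\<sigma>. transpose (R \<sigma>) *v Er i \<sigma>) G" for i
      by (intro left_I RT_bounded err_G Er)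
    moreover have "bigO D (\<lambda>\<sigma>. (transpose (R \<sigma>) - mat 1) *v dF i \<sigma>) G" for i
      by (intro G_I RT_dev dev_acc dF_dev)
    ultimately show "bigO D ?g4 G"
      by (intro bigO_sum bigO_const_cross bigO_diff bigO_scaleR bigO_add)
    show "bigO D ?g5 G" by (intro G_I bigO_dev bigO_const_mv dev_acc)
  qed
qed

text \<open>\<open>planar\<close> annihilates vertical constant forces, so the stiffness cannot come
  from them directly. It comes from their component along \<open>q\<close>, which multiplies
  \<open>planar q\<close> in the expanded double cross product.\<close>

lemma residual_Link:
  assumes j: "j \<in> links P i"
  shows "bigO D (\<lambda>\<sigma>. - (M0 P i j *\<^sub>R planar (A \<sigma>)) + M0 P i j *\<^sub>R planar (rho P i \<times> Y \<sigma>)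
     + (\<Sum>k\<in>links P i. (M0 P i (min j k) * llink P i k) *\<^sub>R planar (qdd i k \<sigma>))
     + ((MiT P i + mass0 P / real CARD('n) - M0 P i j) * grav P) *\<^sub>R planar (q i j \<sigma>)
     + planar (dF i \<sigma>)) G" (is "bigO D ?f G")
proof -
  \<comment> \<open>The tension of link \<open>j\<close> at the equilibrium: the weight of the
    masses of the cable on the payload side of the link, plus the share of the payload.\<close>
  define \<gamma> where "\<gamma> = (MiT P i + mass0 P / real CARD('n) - M0 P i j) * grav P"
  let ?s = "\<lambda>\<sigma>. planar (q i j \<sigma>)"
  let ?g1 = "\<lambda>\<sigma>. M0 P i j *\<^sub>R planar (rho P i \<times> Y \<sigma> - R \<sigma> *v (rho P i \<times> dOm \<sigma>))"
  let ?g2 = "\<lambda>\<sigma>. \<Sum>k\<in>links P i. (M0 P i (min j k) * llink P i k) *\<^sub>R ((q i j \<sigma> \<bullet> qdd i k \<sigma>) *\<^sub>R ?s \<sigma>)"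
  let ?g3 = "\<lambda>\<sigma>. M0 P i j *\<^sub>R ((q i j \<sigma> \<bullet> (R \<sigma> *v (rho P i \<times> dOm \<sigma>) - A \<sigma>)) *\<^sub>R ?s \<sigma>)"
  let ?g4 = "\<lambda>\<sigma>. M0 P i j *\<^sub>R planar (q i j \<sigma> \<times> (q i j \<sigma> \<times> (R \<sigma> *v (Om \<sigma> \<times> (Om \<sigma> \<times> rho P i)))))"
  let ?g5 = "\<lambda>\<sigma>. (q i j \<sigma> \<bullet> dF i \<sigma>) *\<^sub>R ?s \<sigma>"
  let ?g6 = "\<lambda>\<sigma>. (q i j \<sigma> \<bullet> Er i \<sigma>) *\<^sub>R ?s \<sigma> - planar (Er i \<sigma>)"
  let ?g7 = "\<lambda>\<sigma>. \<gamma> *\<^sub>R (((e3 - q i j \<sigma>) \<bullet> e3) *\<^sub>R ?s \<sigma>)"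
  note qb = q_bounded[OF j] and sdev = planar_q[OF j]
  have "bigO D ?g1 G"
    using bigO_minus[OF rotated_dOm[of "rho P i"]] by (intro bigO_scaleR bigO_planar) simp
  moreover have "bigO D ?g2 G"
    by (intro bigO_sum bigO_scaleR bilinear_G'[OF bounded_bilinear_scaleR] left_I(4) qb bigO_acc sdev)
  moreover have "bigO D (\<lambda>\<sigma>. R \<sigma> *v (rho P i \<times> dOm \<sigma>) - A \<sigma>) (\<lambda>\<sigma>. dev \<sigma> + acc \<sigma>)"
    by (intro bigO_diff left_I(1) R_bounded bigO_const_cross bigO_acc)
  then have "bigO D ?g3 G"
    by (intro bigO_scaleR bilinear_G'[OF bounded_bilinear_scaleR] left_I(4) qb sdev)
  moreover have "bigO D ?g4 G"
    by (intro bigO_scaleR bigO_planar left_I(3) qb rotated_Om_Om)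
  moreover have "bigO D ?g5 G"
    by (intro G_I(5) left_I(4) qb dF_dev dev_acc sdev)
  moreover have "bigO D ?g6 G"
    by (intro bigO_diff bigO_planar err_G[OF Er] right_I(5) left_I(4) qb dev_bounded sdev)
  moreover have "bigO D ?g7 G"
    using bigO_minus[OF bigO_dev(5)[OF j]]
    by (intro bigO_scaleR G_I(5) right_I(4) bigO_const dev_acc sdev) simp
  ultimately have G: "bigO D (\<lambda>\<sigma>. ?g1 \<sigma> + ?g2 \<sigma> + ?g3 \<sigma> - ?g4 \<sigma> + ?g5 \<sigma> + ?g6 \<sigma> + ?g7 \<sigma>) G"
    by (intro bigO_add[where f = "\<lambda>\<sigma>. ?g1 \<sigma> + ?g2 \<sigma> + ?g3 \<sigma> - ?g4 \<sigma> + ?g5 \<sigma> + ?g6 \<sigma>"]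
        bigO_add[where f = "\<lambda>\<sigma>. ?g1 \<sigma> + ?g2 \<sigma> + ?g3 \<sigma> - ?g4 \<sigma> + ?g5 \<sigma>"]
        bigO_add[where f = "\<lambda>\<sigma>. ?g1 \<sigma> + ?g2 \<sigma> + ?g3 \<sigma> - ?g4 \<sigma>"]
        bigO_diff[where f = "\<lambda>\<sigma>. ?g1 \<sigma> + ?g2 \<sigma> + ?g3 \<sigma>"] bigO_add[where f = "\<lambda>\<sigma>. ?g1 \<sigma> + ?g2 \<sigma>"]
        bigO_add[where f = ?g1])
  show ?thesis
  proof (rule bigO_cong[OF _ G])
    fix \<sigma> assume D: "\<sigma> \<in> D"
    have e33: "e3 \<bullet> e3 = 1" by (simp add: inner_axis)
    have PF: "planar ((M0 P i j * grav P) *\<^sub>R e3 + F i \<sigma>) = planar (dF i \<sigma>) + planar (Er i \<sigma>)"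
      unfolding force[OF D] u_star_def by (simp add: planar_add planar_diff planar_minus planar_scaleR planar_e3)
    have qF: "q i j \<sigma> \<bullet> ((M0 P i j * grav P) *\<^sub>R e3 + F i \<sigma>)
      = q i j \<sigma> \<bullet> dF i \<sigma> + q i j \<sigma> \<bullet> Er i \<sigma> - \<gamma> * (q i j \<sigma> \<bullet> e3)"
      unfolding force[OF D] u_star_def \<gamma>_def by (simp add: inner_add_right algebra_simps)
    note eqL[OF D j]
    from arg_cong[OF this, of planar]
    have "(\<Sum>k\<in>links P i. (M0 P i (min j k) * llink P i k) *\<^sub>R planar (qdd i k \<sigma>))
      = (\<Sum>k\<in>links P i. (M0 P i (min j k) * llink P i k) *\<^sub>R ((q i j \<sigma> \<bullet> qdd i k \<sigma>) *\<^sub>R ?s \<sigma>))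
      - M0 P i j *\<^sub>R ((q i j \<sigma> \<bullet> A \<sigma>) *\<^sub>R ?s \<sigma> - planar (A \<sigma>))
      + M0 P i j *\<^sub>R ((q i j \<sigma> \<bullet> (R \<sigma> *v (rho P i \<times> dOm \<sigma>))) *\<^sub>R ?s \<sigma> - planar (R \<sigma> *v (rho P i \<times> dOm \<sigma>)))
      - ?g4 \<sigma>
      + ((q i j \<sigma> \<bullet> dF i \<sigma> + q i j \<sigma> \<bullet> Er i \<sigma> - \<gamma> * (q i j \<sigma> \<bullet> e3)) *\<^sub>R ?s \<sigma> - planar (dF i \<sigma>) - planar (Er i \<sigma>))"
      unfolding planar_add planar_diff planar_sum planar_scaleR
      unfolding planar_double_cross[OF unit[OF D j]] qF
      using PF by (simp add: scaleR_diff_right sum_subtractf algebra_simps planar_add planar_scaleR)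
    then show "?f \<sigma> = ?g1 \<sigma> + ?g2 \<sigma> + ?g3 \<sigma> - ?g4 \<sigma> + ?g5 \<sigma> + ?g6 \<sigma> + ?g7 \<sigma>"
      unfolding \<gamma>_def[symmetric]
      by (simp only: planar_diff inner_diff_left inner_diff_right e33) (simp add: algebra_simps)
  qed
qed

definition "residual \<sigma> r = mat_app (coords P) (Mmat P) (a \<sigma>) r
  - (mat_app UNIV (Bmat P) (lin_input P Kx Kv (x \<sigma>) (v \<sigma>)) r - mat_app (coords P) (Gmat P) (x \<sigma>) r)"

lemma residual: "r \<in> coords P \<Longrightarrow> bigO D (\<lambda>\<sigma>. residual \<sigma> r) G"
proof (cases r)
  case (Pos b)
  show ?thesis
    using bigO_component[OF residual_Pos, of b]
    unfolding residual_def[abs_def] Pos mass_matrix_Pos stiffness_matrix_Pos input_matrix_Pos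
    by (simp add: a_def x_def v_def)
next
  case (Att b)
  show ?thesis
    using bigO_component[OF residual_Att, of b]
    unfolding residual_def[abs_def] Att mass_matrix_Att stiffness_matrix_Att input_matrix_Att
    by (simp add: a_def x_def v_def algebra_simps)
next
  case (Link i j b)
  assume "r \<in> coords P"
  then have j: "j \<in> links P i" by (auto simp: coords_def Link)
  show ?thesis
    using bigO_component[OF residual_Link[OF j], of b]
    unfolding residual_def[abs_def] Link mass_matrix_Link[OF j] stiffness_matrix_Link[OF j] input_matrix_Link
    by (simp add: a_def x_def v_def planar_def[symmetric] algebra_simps)
qed

end

section \<open>Absorption of higher-order terms for small deviations\<close>

lemma bigO_vec:
  fixes f :: "'s \<Rightarrow> real^'n::finite"
  assumes "\<And>b. bigO D (\<lambda>\<sigma>. f \<sigma> $ b) g"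
  shows "bigO D f g"
proof -
  have "bigO D (\<lambda>\<sigma>. \<Sum>b\<in>UNIV. (f \<sigma> $ b) *\<^sub>R axis b (1::real)) g"
    by (intro bigO_sum bigO_bounded_linear[OF bounded_linear_scaleR_left] assms)
  then show ?thesis
    by (rule bigO_cong[rotated]) (simp add: vec_eq_iff axis_def if_distrib cong: if_cong)
qed

text \<open>If \<open>u\<close> differs from \<open>w\<close> by a small multiple of its own size,
  the difference can be moved to the other side. The threshold depends on the hidden constant;
  stating the conclusion for all sufficiently small \<open>\<epsilon>\<close> lets finitely many
  such estimates be combined.\<close>

lemma bigO_absorb:
  assumes "bigO D (\<lambda>\<sigma>. u \<sigma> - w \<sigma>) (\<lambda>\<sigma>. \<delta> \<sigma> * norm (u \<sigma>))" "\<And>\<sigma>. \<sigma> \<in> D \<Longrightarrow> \<delta> \<sigma> \<ge> 0"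
    and w: "bigO D w g"
  shows "\<forall>\<^sub>F \<epsilon> in at_right 0. bigO {\<sigma> \<in> D. \<delta> \<sigma> \<le> (\<epsilon>::real)} u g"
proof -
  obtain c where c: "c > 0" "\<And>\<sigma>. \<sigma> \<in> D \<Longrightarrow> norm (u \<sigma> - w \<sigma>) \<le> c * (\<delta> \<sigma> * norm (u \<sigma>))"
    using bigOE[OF assms(1)] assms(2) by (metis mult_nonneg_nonneg norm_ge_zero)
  \<comment> \<open>Below this threshold the difference is at most half the norm of
    \<open>u\<close>, whence the factor 2.\<close>
  have "bigO {\<sigma> \<in> D. \<delta> \<sigma> \<le> \<epsilon>} u g" if \<epsilon>: "\<epsilon> \<in> {0<..<1 / (2 * c)}" for \<epsilon>
  proof (rule bigO_trans[OF bigOI[where c = 2] bigO_subset[OF bigO_norm_iff[THEN iffD2, OF w]]])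
    fix \<sigma> assume \<sigma>: "\<sigma> \<in> {\<sigma> \<in> D. \<delta> \<sigma> \<le> \<epsilon>}"
    have "c * \<delta> \<sigma> \<le> 1 / 2"
    proof -
      have "c * \<delta> \<sigma> \<le> c * (1 / (2 * c))" using \<sigma> \<epsilon> c(1) by (intro mult_left_mono) auto
      then show ?thesis using c(1) by simp
    qed
    then have "c * \<delta> \<sigma> * norm (u \<sigma>) \<le> 1 / 2 * norm (u \<sigma>)" by (rule mult_right_mono) simp
    then have "norm (u \<sigma> - w \<sigma>) \<le> 1 / 2 * norm (u \<sigma>)" using c(2)[of \<sigma>] \<sigma> by (simp add: mult.assoc)
    moreover have "norm (u \<sigma>) \<le> norm (w \<sigma>) + norm (u \<sigma> - w \<sigma>)" by (rule norm_triangle_sub)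
    ultimately show "norm (u \<sigma>) \<le> 2 * norm (w \<sigma>)" by linarith
  qed auto
  moreover have "0 < 1 / (2 * c)" using c(1) by simp
  ultimately show ?thesis by (rule eventually_at_rightI)
qed

context snapshots begin

definition "phase \<sigma> = L2_set (case_sum (x \<sigma>) (v \<sigma>)) (phase_coords P)"

lemma phase_nonneg: "phase \<sigma> \<ge> 0" by (simp add: phase_def L2_set_nonneg)

lemma
  assumes "s \<in> coords P"
  shows x_phase: "bigO D (\<lambda>\<sigma>. x \<sigma> s) phase" and v_phase: "bigO D (\<lambda>\<sigma>. v \<sigma> s) phase"
proof -
  have mem: "\<bar>f c\<bar> \<le> L2_set f (phase_coords P)" if "c \<in> phase_coords P" for f c
    using member_le_L2_set[OF finite_phase_coords that, of "\<lambda>c. \<bar>f c\<bar>"] by (simp add: L2_set_def)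
  have "Inl s \<in> phase_coords P" "Inr s \<in> phase_coords P"
    using assms by (auto simp: phase_coords_def)
  from this[THEN mem] show "bigO D (\<lambda>\<sigma>. x \<sigma> s) phase" "bigO D (\<lambda>\<sigma>. v \<sigma> s) phase"
    unfolding phase_def[abs_def] by (auto intro!: bigOI1 simp: sum.case_distrib dest: spec[of _ "case_sum _ _"])
      (metis old.sum.simps(5) old.sum.simps(6))+
qed

lemma phase_dev: "bigO D phase dev"
proof -
  have "bigO D (\<lambda>\<sigma>. \<Sum>c\<in>phase_coords P. \<bar>case_sum (x \<sigma>) (v \<sigma>) c\<bar>) dev"
  proof (rule bigO_sum)
    fix c assume c: "c \<in> phase_coords P"
    have "bigO D (\<lambda>\<sigma>. case_sum (x \<sigma>) (v \<sigma>) c) dev"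
      using c by (cases c) (auto simp: phase_coords_def intro: x_dev v_dev)
    then show "bigO D (\<lambda>\<sigma>. \<bar>case_sum (x \<sigma>) (v \<sigma>) c\<bar>) dev"
      using bigO_norm_iff[of D "\<lambda>\<sigma>. case_sum (x \<sigma>) (v \<sigma>) c" dev] by simp
  qed
  moreover have "bigO D phase (\<lambda>\<sigma>. \<Sum>c\<in>phase_coords P. \<bar>case_sum (x \<sigma>) (v \<sigma>) c\<bar>)"
    unfolding phase_def[abs_def] by (intro bigOI1) (simp add: L2_set_nonneg L2_set_le_sum_abs)
  ultimately show ?thesis by (rule bigO_trans[rotated])
qed

text \<open>The coordinates do not show the symmetric part of the attitude and the vertical parts of
  links and link velocities, and they distort the angular velocity. Each of these discrepancies is a
  small multiple of the quantity itself, so near the equilibrium the coordinates control the whole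
  deviation.\<close>

lemma dev_phase: "\<forall>\<^sub>F \<epsilon> in at_right 0. bigO {\<sigma> \<in> D. dev \<sigma> \<le> \<epsilon>} dev phase"
proof -
  have coord: "Pos b \<in> coords P" "Att b \<in> coords P" "j \<in> links P i \<Longrightarrow> Link i j b' \<in> coords P" for i j b b'
    by (auto simp: coords_def)
  have X: "bigO D X phase"
    using x_phase[OF coord(1)] by (intro bigO_vec) (simp add: x_def)
  have V: "bigO D V phase"
    using v_phase[OF coord(1)] by (intro bigO_vec) (simp add: v_def)
  have eR: "bigO D (\<lambda>\<sigma>. hat (skew_part (R \<sigma>))) phase"
    using x_phase[OF coord(2)] by (intro bigO_hat bigO_vec) (simp add: x_def)
  have eO: "bigO D (\<lambda>\<sigma>. skew_part (R \<sigma> ** hat (Om \<sigma>))) phase"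
    using v_phase[OF coord(2)] by (intro bigO_vec) (simp add: v_def)
  have ev_R: "\<forall>\<^sub>F \<epsilon> in at_right 0. bigO {\<sigma> \<in> D. dev \<sigma> \<le> \<epsilon>} (\<lambda>\<sigma>. R \<sigma> - mat 1) phase"
  proof (rule bigO_absorb[OF _ _ eR])
    have RT: "bigO D (\<lambda>\<sigma>. transpose (R \<sigma> - mat 1)) (\<lambda>\<sigma>. norm (R \<sigma> - mat 1))"
      by (intro bigO_transpose bigOI1) simp
    have "bigO D (\<lambda>\<sigma>. (R \<sigma> - mat 1) ** transpose (R \<sigma> - mat 1)) (\<lambda>\<sigma>. dev \<sigma> * norm (R \<sigma> - mat 1))"
      by (intro bigO_mm bigO_dev RT)
    then have "bigO D (\<lambda>\<sigma>. (- 1/2) *\<^sub>R ((R \<sigma> - mat 1) ** transpose (R \<sigma> - mat 1))) (\<lambda>\<sigma>. dev \<sigma> * norm (R \<sigma> - mat 1))"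
      by (rule bigO_scaleR)
    then show "bigO D (\<lambda>\<sigma>. R \<sigma> - mat 1 - hat (skew_part (R \<sigma>))) (\<lambda>\<sigma>. dev \<sigma> * norm (R \<sigma> - mat 1))"
      by (rule bigO_cong[rotated]) (rule orthogonal_symmetric_part[OF orth])
  qed (rule dev_nonneg)
  have ev_Om: "\<forall>\<^sub>F \<epsilon> in at_right 0. bigO {\<sigma> \<in> D. dev \<sigma> \<le> \<epsilon>} Om phase"
  proof (rule bigO_absorb[OF _ _ eO])
    have "bigO D (\<lambda>\<sigma>. - skew_part ((R \<sigma> - mat 1) ** hat (Om \<sigma>))) (\<lambda>\<sigma>. dev \<sigma> * norm (Om \<sigma>))"
      by (intro bigO_minus bigO_skew_part bigO_mm bigO_dev bigO_hat bigOI1) simp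
    then show "bigO D (\<lambda>\<sigma>. Om \<sigma> - skew_part (R \<sigma> ** hat (Om \<sigma>))) (\<lambda>\<sigma>. dev \<sigma> * norm (Om \<sigma>))"
      by (rule bigO_cong[rotated])
        (simp add: bounded_bilinear.diff_left[OF bb(2)] skew_part_hat
          linear_diff[OF bounded_linear.linear[OF bounded_linear_skew_part]])
  qed (rule dev_nonneg)
  have ev_q: "\<forall>\<^sub>F \<epsilon> in at_right 0. bigO {\<sigma> \<in> D. dev \<sigma> \<le> \<epsilon>} (\<lambda>\<sigma>. q i j \<sigma> - e3) phase"
    if j: "j \<in> links P i" for i j
  proof (rule bigO_absorb)
    show "bigO D (\<lambda>\<sigma>. horiz (planar (q i j \<sigma>))) phase"
      using x_phase[OF coord(3)[OF j]] by (intro bigO_horiz bigO_vec) (simp add: x_def)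
    have "bigO D (\<lambda>\<sigma>. (q i j \<sigma> - e3) \<bullet> (q i j \<sigma> - e3)) (\<lambda>\<sigma>. dev \<sigma> * norm (q i j \<sigma> - e3))"
      by (intro bigO_inner bigO_dev j bigOI1) simp
    from bigO_bilinear[OF bounded_bilinear_scaleR bigO_mult_left[OF this, of "- 1/2"] bigO_const[of _ e3]]
    show "bigO D (\<lambda>\<sigma>. q i j \<sigma> - e3 - horiz (planar (q i j \<sigma>))) (\<lambda>\<sigma>. dev \<sigma> * norm (q i j \<sigma> - e3))"
      unfolding mult_1_right
    proof (rule bigO_cong[rotated])
      fix \<sigma> assume "\<sigma> \<in> D"
      then have "q i j \<sigma> \<bullet> q i j \<sigma> = 1" using unit j by (simp add: norm_eq_1)
      \<comment> \<open>For unit vectors the vertical error is minus half the squared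
        distance.\<close>
      then have h: "- 1 / 2 * ((q i j \<sigma> - e3) \<bullet> (q i j \<sigma> - e3)) = q i j \<sigma> \<bullet> e3 - 1"
        by (simp add: inner_diff_left inner_diff_right inner_commute inner_axis field_simps)
      show "q i j \<sigma> - e3 - horiz (planar (q i j \<sigma>))
        = (- 1 / 2 * ((q i j \<sigma> - e3) \<bullet> (q i j \<sigma> - e3))) *\<^sub>R e3"
        unfolding h horiz_planar by (simp add: scaleR_diff_left)
    qed
  qed (rule dev_nonneg)
  have ev_qd: "\<forall>\<^sub>F \<epsilon> in at_right 0. bigO {\<sigma> \<in> D. dev \<sigma> \<le> \<epsilon>} (qd i j) phase"
    if j: "j \<in> links P i" for i j
  proof (rule bigO_absorb)
    show "bigO D (\<lambda>\<sigma>. horiz (planar (qd i j \<sigma>))) phase"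
      using v_phase[OF coord(3)[OF j]] by (intro bigO_horiz bigO_vec) (simp add: v_def)
    have "bigO D (\<lambda>\<sigma>. (q i j \<sigma> - e3) \<bullet> qd i j \<sigma>) (\<lambda>\<sigma>. dev \<sigma> * norm (qd i j \<sigma>))"
      by (intro bigO_inner bigO_dev j bigOI1) simp
    from bigO_bilinear[OF bounded_bilinear_scaleR bigO_minus[OF this] bigO_const[of _ e3]]
    show "bigO D (\<lambda>\<sigma>. qd i j \<sigma> - horiz (planar (qd i j \<sigma>))) (\<lambda>\<sigma>. dev \<sigma> * norm (qd i j \<sigma>))"
      unfolding mult_1_right
    proof (rule bigO_cong[rotated])
      fix \<sigma> assume "\<sigma> \<in> D"
      then show "qd i j \<sigma> - horiz (planar (qd i j \<sigma>)) = (- ((q i j \<sigma> - e3) \<bullet> qd i j \<sigma>)) *\<^sub>R e3"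
        using unit1[OF _ j] by (simp add: horiz_planar inner_diff_left inner_commute[of e3])
    qed
  qed (rule dev_nonneg)
  have "\<forall>\<^sub>F \<epsilon> in at_right 0. \<forall>i\<in>UNIV. \<forall>j\<in>links P i.
      bigO {\<sigma> \<in> D. dev \<sigma> \<le> \<epsilon>} (\<lambda>\<sigma>. q i j \<sigma> - e3) phase \<and> bigO {\<sigma> \<in> D. dev \<sigma> \<le> \<epsilon>} (qd i j) phase"
    by (intro eventually_ball_finite finite ballI finite_atLeastAtMost eventually_conj ev_q ev_qd)
  with ev_R ev_Om show ?thesis
  proof eventually_elim
    case (elim \<epsilon>)
    let ?D = "{\<sigma> \<in> D. dev \<sigma> \<le> \<epsilon>}"
    have "bigO ?D X phase" "bigO ?D V phase" by (rule bigO_subset[OF X], blast, rule bigO_subset[OF V], blast)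
    with elim show ?case unfolding dev_def
      by (intro bigO_add bigO_sum) (auto simp: bigO_norm_iff)
  qed
qed

text \<open>The difference between the actual and the linear acceleration is \<open>N\<close>
  applied to the residual, hence of order \<open>G\<close>.\<close>

lemma coordinate_acceleration:
  assumes NM: "\<And>b s. s \<in> coords P \<Longrightarrow> mat_app (coords P) N (mat_app (coords P) (Mmat P) b) s = b s"
    and s: "s \<in> coords P"
  shows "bigO D (\<lambda>\<sigma>. a \<sigma> s - lin_acc P Kx Kv N (x \<sigma>) (v \<sigma>) s) G"
    and "bigO D (\<lambda>\<sigma>. a \<sigma> s) (\<lambda>\<sigma>. dev \<sigma> + G \<sigma>)"
proof -
  have "a \<sigma> s - lin_acc P Kx Kv N (x \<sigma>) (v \<sigma>) s = mat_app (coords P) N (residual \<sigma>) s" for \<sigma>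
    unfolding residual_def lin_acc_def mat_app_diff by (simp add: NM[OF s] mat_app_diff)
  then show 1: "bigO D (\<lambda>\<sigma>. a \<sigma> s - lin_acc P Kx Kv N (x \<sigma>) (v \<sigma>) s) G"
    by (simp add: bigO_mat_app residual)
  have "bigO D (\<lambda>\<sigma>. lin_acc P Kx Kv N (x \<sigma>) (v \<sigma>) s) dev"
    unfolding lin_acc_def lin_input_def
    by (rule bigO_mat_app, intro bigO_diff bigO_mat_app) (auto intro!: bigO_diff bigO_minus bigO_mat_app x_dev v_dev)
  then have 2: "bigO D (\<lambda>\<sigma>. lin_acc P Kx Kv N (x \<sigma>) (v \<sigma>) s) (\<lambda>\<sigma>. dev \<sigma> + G \<sigma>)"
    by (rule bigO_le) (simp add: G_def dev_nonneg acc_nonneg err_nonneg)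
  have "bigO D (\<lambda>\<sigma>. a \<sigma> s - lin_acc P Kx Kv N (x \<sigma>) (v \<sigma>) s) (\<lambda>\<sigma>. dev \<sigma> + G \<sigma>)"
    by (rule bigO_le[OF 1]) (simp add: dev_nonneg)
  from bigO_add[OF this 2] show "bigO D (\<lambda>\<sigma>. a \<sigma> s) (\<lambda>\<sigma>. dev \<sigma> + G \<sigma>)" by simp
qed

lemma G_nonneg: "G \<sigma> \<ge> 0"
  by (simp add: G_def dev_nonneg acc_nonneg err_nonneg)

text \<open>The accelerations are recovered from those of the coordinates, since what the
  coordinates do not show is of order \<open>G\<close>. The bound is still implicit because
  \<open>G\<close> contains \<open>acc\<close>.\<close>

lemma acc_dev_G:
  assumes NM: "\<And>b s. s \<in> coords P \<Longrightarrow> mat_app (coords P) N (mat_app (coords P) (Mmat P) b) s = b s"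
  shows "bigO D acc (\<lambda>\<sigma>. dev \<sigma> + G \<sigma>)"
proof -
  have coord: "Pos b \<in> coords P" "Att b \<in> coords P" "j \<in> links P i \<Longrightarrow> Link i j b' \<in> coords P" for i j b b'
    by (auto simp: coords_def)
  note aO = coordinate_acceleration(2)[OF NM]
  have G: "bigO D f (\<lambda>\<sigma>. dev \<sigma> + G \<sigma>)" if "bigO D f G" for f :: "'s \<Rightarrow> real^3"
    by (rule bigO_le[OF that]) (simp add: dev_nonneg)
  have "bigO D A (\<lambda>\<sigma>. dev \<sigma> + G \<sigma>)"
    using aO[OF _ coord(1)] by (intro bigO_vec) (simp add: a_def)
  moreover have "bigO D dOm (\<lambda>\<sigma>. dev \<sigma> + G \<sigma>)"
  proof -
    have "bigO D Y (\<lambda>\<sigma>. dev \<sigma> + G \<sigma>)"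
      using aO[OF _ coord(2)] by (intro bigO_vec) (simp add: a_def)
    from bigO_diff[OF this G[OF Y_dOm]] show ?thesis by simp
  qed
  moreover have "bigO D (qdd i j) (\<lambda>\<sigma>. dev \<sigma> + G \<sigma>)" if j: "j \<in> links P i" for i j
  proof -
    have "bigO D (\<lambda>\<sigma>. horiz (planar (qdd i j \<sigma>))) (\<lambda>\<sigma>. dev \<sigma> + G \<sigma>)"
      using aO[OF _ coord(3)[OF j]] by (intro bigO_horiz bigO_vec) (simp add: a_def)
    from bigO_add[OF this G[OF qdd_vertical[OF j]]] show ?thesis by simp
  qed
  ultimately show ?thesis
    unfolding acc_def by (intro bigO_add bigO_sum) (auto simp: bigO_norm_iff)
qed

theorem small_deviation_estimates:
  assumes NM: "\<And>b s. s \<in> coords P \<Longrightarrow> mat_app (coords P) N (mat_app (coords P) (Mmat P) b) s = b s"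
  shows "\<forall>\<^sub>F \<epsilon> in at_right 0.
    bigO {\<sigma> \<in> D. dev \<sigma> \<le> \<epsilon>} acc (\<lambda>\<sigma>. dev \<sigma> + err \<sigma>) \<and>
    bigO {\<sigma> \<in> D. dev \<sigma> \<le> \<epsilon>} dev phase \<and>
    (\<forall>s\<in>coords P. bigO {\<sigma> \<in> D. dev \<sigma> \<le> \<epsilon>}
      (\<lambda>\<sigma>. a \<sigma> s - lin_acc P Kx Kv N (x \<sigma>) (v \<sigma>) s) (\<lambda>\<sigma>. (dev \<sigma>)\<^sup>2 + err \<sigma>))"
proof -
  obtain c where c: "c > 0" "\<And>\<sigma>. \<sigma> \<in> D \<Longrightarrow> acc \<sigma> \<le> c * (dev \<sigma> + G \<sigma>)"
    using bigOE[OF acc_dev_G[OF NM]] dev_nonneg G_nonneg acc_nonneg by (metis abs_of_nonneg add_nonneg_nonneg real_norm_def)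
  have dd: "dev \<sigma> * dev \<sigma> \<le> dev \<sigma>" if "\<sigma> \<in> D" for \<sigma>
    using dev_le_1[OF that] dev_nonneg[of \<sigma>] by (simp add: mult_left_le)
  \<comment> \<open>The term \<open>dev * acc\<close> inside \<open>G\<close> costs at most half of
    \<open>acc\<close> when \<open>dev \<le> 1 / (2 * c)\<close>; moving it to the left gives the
    constant \<open>4 * c\<close>.\<close>
  have acc: "bigO {\<sigma> \<in> D. dev \<sigma> \<le> \<epsilon>} acc (\<lambda>\<sigma>. dev \<sigma> + err \<sigma>)" if \<epsilon>: "\<epsilon> \<in> {0<..<1 / (2 * c)}" for \<epsilon>
  proof (rule bigOI[where c = "4 * c"])
    fix \<sigma> assume \<sigma>: "\<sigma> \<in> {\<sigma> \<in> D. dev \<sigma> \<le> \<epsilon>}"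
    have "c * dev \<sigma> \<le> c * (1 / (2 * c))" using \<sigma> \<epsilon> c(1) by (intro mult_left_mono) auto
    then have "(c * dev \<sigma>) * acc \<sigma> \<le> 1 / 2 * acc \<sigma>" using c(1) acc_nonneg by (intro mult_right_mono) auto
    moreover have "acc \<sigma> \<le> c * dev \<sigma> + c * (dev \<sigma> * dev \<sigma>) + (c * dev \<sigma>) * acc \<sigma> + c * err \<sigma>"
      using c(2)[of \<sigma>] \<sigma> by (simp add: G_def algebra_simps)
    moreover have "c * (dev \<sigma> * dev \<sigma>) \<le> c * dev \<sigma>" using dd[of \<sigma>] \<sigma> c(1) by (intro mult_left_mono) auto
    moreover have "0 \<le> c * err \<sigma>" using c(1) err_nonneg by simp
    ultimately have "acc \<sigma> \<le> 4 * (c * dev \<sigma>) + 4 * (c * err \<sigma>)" by linarith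
    then show "norm (acc \<sigma>) \<le> 4 * c * (dev \<sigma> + err \<sigma>)" using acc_nonneg by (simp add: algebra_simps)
  qed (use c(1) in simp)
  have G: "bigO {\<sigma> \<in> D. dev \<sigma> \<le> \<epsilon>} G (\<lambda>\<sigma>. (dev \<sigma>)\<^sup>2 + err \<sigma>)" if \<epsilon>: "\<epsilon> \<in> {0<..<1 / (2 * c)}" for \<epsilon>
  proof -
    let ?D = "{\<sigma> \<in> D. dev \<sigma> \<le> \<epsilon>}"
    have "bigO ?D (\<lambda>\<sigma>. dev \<sigma> * acc \<sigma>) (\<lambda>\<sigma>. dev \<sigma> * (dev \<sigma> + err \<sigma>))"
      by (intro bigO_mult acc[OF \<epsilon>] bigOI1) (simp add: dev_nonneg)
    then have "bigO ?D (\<lambda>\<sigma>. dev \<sigma> * acc \<sigma>) (\<lambda>\<sigma>. (dev \<sigma>)\<^sup>2 + err \<sigma>)"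
    proof (rule bigO_le)
      fix \<sigma> assume "\<sigma> \<in> ?D"
      then have "dev \<sigma> * err \<sigma> \<le> 1 * err \<sigma>" using dev_le_1 err_nonneg by (intro mult_right_mono) auto
      then show "dev \<sigma> * (dev \<sigma> + err \<sigma>) \<le> (dev \<sigma>)\<^sup>2 + err \<sigma>"
        by (simp add: distrib_left power2_eq_square)
    qed
    moreover have "bigO ?D (\<lambda>\<sigma>. (dev \<sigma>)\<^sup>2) (\<lambda>\<sigma>. (dev \<sigma>)\<^sup>2 + err \<sigma>)" "bigO ?D err (\<lambda>\<sigma>. (dev \<sigma>)\<^sup>2 + err \<sigma>)"
      by (intro bigOI1; simp add: err_nonneg)+
    ultimately have "bigO ?D (\<lambda>\<sigma>. (dev \<sigma>)\<^sup>2 + dev \<sigma> * acc \<sigma> + err \<sigma>) (\<lambda>\<sigma>. (dev \<sigma>)\<^sup>2 + err \<sigma>)"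
      by (intro bigO_add)
    then show ?thesis
      by (rule bigO_cong[rotated]) (simp add: G_def distrib_left power2_eq_square)
  qed
  have "\<forall>\<^sub>F \<epsilon> in at_right 0. \<epsilon> \<in> {0<..<1 / (2 * c)}"
    by (rule eventually_at_rightI[where b = "1 / (2 * c)"]) (use c(1) in auto)
  with dev_phase show ?thesis
  proof eventually_elim
    case (elim \<epsilon>)
    have "bigO {\<sigma> \<in> D. dev \<sigma> \<le> \<epsilon>} (\<lambda>\<sigma>. a \<sigma> s - lin_acc P Kx Kv N (x \<sigma>) (v \<sigma>) s) (\<lambda>\<sigma>. (dev \<sigma>)\<^sup>2 + err \<sigma>)"
      if s: "s \<in> coords P" for s
      by (rule bigO_trans[OF bigO_subset[OF coordinate_acceleration(1)[OF NM s]] G[OF elim(2)]]) auto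
    then show ?case using acc[OF elim(2)] elim(1) by blast
  qed
qed

end

section \<open>Attitude tracking\<close>

lemma norm_matrix_sq: "(norm (A :: real^'m^'n))\<^sup>2 = (\<Sum>i\<in>UNIV. \<Sum>j\<in>UNIV. (A $ i $ j)\<^sup>2)"
  unfolding power2_norm_eq_inner inner_vec_def by (simp add: power2_eq_square)

lemma norm_vector_3_sq: "(norm (v :: real^3))\<^sup>2 = (v $ 1)\<^sup>2 + (v $ 2)\<^sup>2 + (v $ 3)\<^sup>2"
  unfolding power2_norm_eq_inner inner_vec_def by (simp add: sum_3 power2_eq_square)

text \<open>Rotations preserve cross products, so each entry equals its cofactor; the diagonal
  entries are those needed for the norm of the skew part.\<close>

lemma rotation_cofactor:
  assumes "rotation_matrix (Q :: real^3^3)"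
  shows "Q$2$2 * Q$3$3 - Q$2$3 * Q$3$2 = Q$1$1" "Q$1$1 * Q$3$3 - Q$1$3 * Q$3$1 = Q$2$2"
    "Q$1$1 * Q$2$2 - Q$1$2 * Q$2$1 = Q$3$3"
proof -
  have "(Q *v e2) \<times> (Q *v e3) = Q *v e1" "(Q *v e3) \<times> (Q *v e1) = Q *v e2"
    "(Q *v e1) \<times> (Q *v e2) = Q *v e3"
    using cross_rotation_matrix[OF assms] by (simp_all add: cross_basis)
  then show "Q$2$2 * Q$3$3 - Q$2$3 * Q$3$2 = Q$1$1" "Q$1$1 * Q$3$3 - Q$1$3 * Q$3$1 = Q$2$2"
    "Q$1$1 * Q$2$2 - Q$1$2 * Q$2$1 = Q$3$3"
    by (simp_all add: cross3_def matrix_vector_mult_def axis_def vec_eq_iff forall_3 sum_3 algebra_simps)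
qed

lemma orthogonal_norm_sq:
  assumes "orthogonal_matrix (Q :: real^3^3)"
  shows "(norm Q)\<^sup>2 = 3"
proof -
  have "Q ** transpose Q = mat 1" using assms by (simp add: orthogonal_matrix_def)
  then have "(Q ** transpose Q) $ i $ i = 1" for i by (simp add: mat_def)
  then show ?thesis
    unfolding norm_matrix_sq by (simp add: matrix_matrix_mult_def transpose_def power2_eq_square)
qed

lemma norm_orthogonal_diff_mat1:
  assumes "orthogonal_matrix (Q :: real^3^3)"
  shows "(norm (Q - mat 1))\<^sup>2 = 2 * trace (mat 1 - Q)"
proof -
  have "(norm (Q - mat 1))\<^sup>2 = (norm Q)\<^sup>2 - 2 * trace Q + 3"
    unfolding norm_matrix_sq by (simp add: trace_def sum_3 mat_def power2_eq_square algebra_simps)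
  then show ?thesis by (simp add: orthogonal_norm_sq[OF assms] trace_def sum_3 mat_def)
qed

text \<open>For a rotation by the angle \<open>\<theta>\<close> one has
  \<open>\<psi> = 1 - cos \<theta>\<close>, and this is the identity
  \<open>sin^2 \<theta> = (1 - cos \<theta>) (1 + cos \<theta>)\<close>. The proof works on matrix
  entries, where the cofactors enter.\<close>

lemma norm_skew_part_rotation:
  assumes "rotation_matrix (Q :: real^3^3)"
  defines "\<psi> \<equiv> (1/2) * trace (mat 1 - Q)"
  shows "(norm (skew_part Q))\<^sup>2 = \<psi> * (2 - \<psi>)"
proof -
  have "(norm Q)\<^sup>2 = 3" using assms by (simp add: rotation_matrix_def orthogonal_norm_sq)
  then show ?thesis
    using rotation_cofactor[OF assms(1)]
    unfolding \<psi>_def norm_matrix_sq norm_vector_3_sq skew_part_def vee_def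
    by (simp add: trace_def sum_3 mat_def transpose_def power2_eq_square field_simps)
qed

text \<open>The error vector has norm \<open>|sin \<theta>|\<close>, which vanishes at half turns
  too. The trace condition says that the angle is at most a right angle, and there the error vector
  controls the distance to the identity.\<close>

lemma rotation_error_bounds:
  assumes "rotation_matrix (Q :: real^3^3)"
  shows "norm (skew_part Q) \<le> norm (Q - mat 1)"
    and "(1/2) * trace (mat 1 - Q) \<le> 1 \<Longrightarrow> norm (Q - mat 1) \<le> 2 * norm (skew_part Q)"
    and "norm (Q - mat 1) \<le> 1 \<Longrightarrow> (1/2) * trace (mat 1 - Q) \<le> 1"
proof -
  define \<psi> where "\<psi> = (1/2) * trace (mat 1 - Q)"
  have n: "(norm (Q - mat 1))\<^sup>2 = 4 * \<psi>"
    using assms norm_orthogonal_diff_mat1 by (simp add: \<psi>_def rotation_matrix_def)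
  then have "\<psi> \<ge> 0" by (metis zero_le_power2 mult_le_0_iff not_numeral_le_zero zero_le_mult_iff)
  have s: "(norm (skew_part Q))\<^sup>2 = \<psi> * (2 - \<psi>)"
    using norm_skew_part_rotation[OF assms] by (simp add: \<psi>_def)
  have "\<psi> * (2 - \<psi>) \<le> 4 * \<psi>" using \<open>\<psi> \<ge> 0\<close> by (simp add: algebra_simps)
  then have "(norm (skew_part Q))\<^sup>2 \<le> (norm (Q - mat 1))\<^sup>2" by (simp only: n s)
  then show "norm (skew_part Q) \<le> norm (Q - mat 1)" by (rule power2_le_imp_le) simp
  show "norm (Q - mat 1) \<le> 2 * norm (skew_part Q)" if "(1/2) * trace (mat 1 - Q) \<le> 1"
  proof (rule power2_le_imp_le)
    have "\<psi> * \<psi> \<le> \<psi> * 1" using that \<open>\<psi> \<ge> 0\<close> unfolding \<psi>_def by (intro mult_left_mono) auto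
    then show "(norm (Q - mat 1))\<^sup>2 \<le> (2 * norm (skew_part Q))\<^sup>2"
      unfolding power_mult_distrib n s by (simp add: algebra_simps)
  qed simp
  show "(1/2) * trace (mat 1 - Q) \<le> 1" if "norm (Q - mat 1) \<le> 1"
  proof -
    have "(norm (Q - mat 1))\<^sup>2 \<le> 1" using that by (simp add: power_le_one)
    then show ?thesis using n unfolding \<psi>_def by simp
  qed
qed

section \<open>The commanded attitude as a function of thrust direction and heading\<close>

lemma attitude_of_columns:
  fixes b3 b1 :: "real^3"
  defines "u \<equiv> (b3 \<times> b1) /\<^sub>R norm (b3 \<times> b1)"
  assumes "norm b3 = 1"
  shows "attitude_of b3 b1 = transpose (vector [u \<times> b3, u, b3])"
proof -
  have h: "(hat b3 ** hat b3) *v b1 = b3 \<times> (b3 \<times> b1)" "hat b3 *v b1 = b3 \<times> b1"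
    by (simp_all add: mat_vec_simps)
  have "(norm (b3 \<times> (b3 \<times> b1)))\<^sup>2 = (norm (b3 \<times> b1))\<^sup>2"
    using assms(2) by (simp add: norm_cross dot_cross_self)
  then have n: "norm (b3 \<times> (b3 \<times> b1)) = norm (b3 \<times> b1)"
    by (simp add: power2_eq_iff_nonneg)
  have "- ((b3 \<times> (b3 \<times> b1)) /\<^sub>R norm (b3 \<times> b1)) = u \<times> b3"
    unfolding u_def by (metis cross_mult_left cross_mult_right cross_skew)
  then show ?thesis by (simp add: attitude_of_def Let_def h n u_def)
qed

text \<open>The columns \<open>u x b3\<close>, \<open>u\<close>, \<open>b3\<close> are orthonormal
  and positively oriented as soon as \<open>b3 x b1\<close> can be normalized.\<close>

lemma attitude_of_rotation:
  assumes "norm b3 = 1" "b3 \<times> b1 \<noteq> 0"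
  shows "rotation_matrix (attitude_of b3 b1)" and "attitude_of b3 b1 *v e3 = b3"
proof -
  define u where "u = (b3 \<times> b1) /\<^sub>R norm (b3 \<times> b1)"
  let ?A = "vector [u \<times> b3, u, b3] :: real^3^3"
  have Q: "attitude_of b3 b1 = transpose ?A" unfolding u_def by (rule attitude_of_columns[OF assms(1)])
  have u1: "norm u = 1" using assms(2) by (simp add: u_def)
  have ub: "u \<bullet> b3 = 0" by (simp add: u_def dot_cross_self)
  have ubn: "norm (u \<times> b3) = 1"
    using norm_cross[of u b3] u1 ub assms(1) by (simp add: abs_square_eq_1)
  have "?A ** transpose ?A = mat 1"
    using u1 ub ubn assms(1) dot_cross_self(1,2)[of u b3] dot_cross_self(3,4)[of u b3]
    unfolding norm_eq_1
    by (simp add: matrix_matrix_mult_def transpose_def mat_def vec_eq_iff forall_3 inner_vec_def mult.commute)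
  then have "orthogonal_matrix (transpose ?A)"
    by (simp add: orthogonal_matrix)
  moreover have "det (transpose ?A) = (u \<times> b3) \<bullet> (u \<times> b3)"
    by (simp only: det_transpose dot_cross_det)
  ultimately show "rotation_matrix (attitude_of b3 b1)"
    using ubn by (simp add: Q rotation_matrix_def norm_eq_1)
  show "attitude_of b3 b1 *v e3 = b3"
    by (simp add: Q matrix_vector_mult_def transpose_def axis_def vec_eq_iff forall_3 sum_3)
qed

lemma normalize_lipschitz:
  fixes x y :: "'a::real_normed_vector"
  assumes "x \<noteq> 0" "y \<noteq> 0"
  shows "norm (x /\<^sub>R norm x - y /\<^sub>R norm y) \<le> 2 / norm x * norm (x - y)"
proof -
  have "x /\<^sub>R norm x - y /\<^sub>R norm y = (x - y) /\<^sub>R norm x + (1 / norm x - 1 / norm y) *\<^sub>R y"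
    by (simp add: algebra_simps inverse_eq_divide)
  then have "norm (x /\<^sub>R norm x - y /\<^sub>R norm y)
    \<le> norm ((x - y) /\<^sub>R norm x) + norm ((1 / norm x - 1 / norm y) *\<^sub>R y)"
    by (simp only: norm_triangle_ineq)
  also have "norm ((1 / norm x - 1 / norm y) *\<^sub>R y) = \<bar>norm y - norm x\<bar> / norm x"
  proof -
    have "(1 / norm x - 1 / norm y) * norm y = (norm y - norm x) / norm x"
      using assms by (simp add: field_simps)
    then have "\<bar>1 / norm x - 1 / norm y\<bar> * norm y = \<bar>(norm y - norm x) / norm x\<bar>"
      by (metis abs_mult abs_norm_cancel)
    then show ?thesis by simp
  qed
  also have "\<dots> \<le> norm (x - y) / norm x"
    using norm_triangle_ineq3[of x y] by (intro divide_right_mono) auto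
  finally have "norm (x /\<^sub>R norm x - y /\<^sub>R norm y) \<le> norm ((x - y) /\<^sub>R norm x) + norm (x - y) / norm x"
    by simp
  also have "norm ((x - y) /\<^sub>R norm x) = norm (x - y) / norm x"
    by (simp add: divide_inverse mult.commute)
  finally show ?thesis by simp
qed


lemma bounded_bilinear_bound:
  assumes "bounded_bilinear h"
  obtains K where "K > 0" "\<And>x y. norm (h x y) \<le> K * (norm x * norm y)"
  using bounded_bilinear.pos_bounded[OF assms] by (metis mult.commute)

lemma norm_cross_le: "norm (x \<times> y) \<le> norm x * norm y"
proof (rule power2_le_imp_le)
  show "(norm (x \<times> y))\<^sup>2 \<le> (norm x * norm y)\<^sup>2"
    by (simp add: norm_cross power_mult_distrib)
qed simp

lemma norm_transpose_vector_3_le: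
  fixes a b c :: "real^3"
  shows "norm (transpose (vector [a, b, c]) :: real^3^3) \<le> norm a + norm b + norm c"
proof (rule power2_le_imp_le)
  have "(norm (transpose (vector [a, b, c]) :: real^3^3))\<^sup>2 = (norm a)\<^sup>2 + (norm b)\<^sup>2 + (norm c)\<^sup>2"
    unfolding norm_matrix_sq norm_vector_3_sq by (simp add: transpose_def sum_3)
  also have "\<dots> \<le> (norm a + norm b + norm c)\<^sup>2"
    by (simp add: power2_sum algebra_simps)
  finally show "(norm (transpose (vector [a, b, c]) :: real^3^3))\<^sup>2 \<le> (norm a + norm b + norm c)\<^sup>2" .
qed simp

text \<open>Commanded angular velocities will be bounded by difference quotients through this
  estimate, instead of differentiating the formula for the attitude. Keeping thrust direction and
  heading apart makes the normalization Lipschitz.\<close>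

lemma attitude_of_lipschitz:
  assumes \<epsilon>: "\<epsilon> > 0" and b: "norm b = 1" "norm b' = 1" and h: "norm h = 1" "norm h' = 1"
    and sep: "\<epsilon> \<le> norm (b \<times> h)" "\<epsilon> \<le> norm (b' \<times> h')"
  shows "norm (attitude_of b h - attitude_of b' h') \<le> (4 / \<epsilon> + 2) * (norm (b - b') + norm (h - h'))"
proof -
  let ?d = "norm (b - b') + norm (h - h')"
  define u where "u = (b \<times> h) /\<^sub>R norm (b \<times> h)"
  define u' where "u' = (b' \<times> h') /\<^sub>R norm (b' \<times> h')"
  have nz: "b \<times> h \<noteq> 0" "b' \<times> h' \<noteq> 0" using sep \<epsilon> by auto
  have "b \<times> h - b' \<times> h' = (b - b') \<times> h + b' \<times> (h - h')"
    by (simp add: bounded_bilinear.diff_left[OF bounded_bilinear_cross] bounded_bilinear.diff_right[OF bounded_bilinear_cross])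
  then have "norm (b \<times> h - b' \<times> h') \<le> norm ((b - b') \<times> h) + norm (b' \<times> (h - h'))"
    by (simp only: norm_triangle_ineq)
  also have "\<dots> \<le> ?d"
    using norm_cross_le[of "b - b'" h] norm_cross_le[of b' "h - h'"] h b by simp
  finally have c: "norm (b \<times> h - b' \<times> h') \<le> ?d" .
  have "norm (u - u') \<le> 2 / norm (b \<times> h) * norm (b \<times> h - b' \<times> h')"
    unfolding u_def u'_def by (rule normalize_lipschitz[OF nz])
  also have "\<dots> \<le> 2 / \<epsilon> * ?d"
    using sep \<epsilon> by (intro mult_mono c divide_left_mono mult_pos_pos) (auto intro: less_le_trans)
  finally have u: "norm (u - u') \<le> 2 / \<epsilon> * ?d" .
  have nu: "norm u' = 1" using nz by (simp add: u'_def)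
  have "u \<times> b - u' \<times> b' = (u - u') \<times> b + u' \<times> (b - b')"
    by (simp add: bounded_bilinear.diff_left[OF bounded_bilinear_cross] bounded_bilinear.diff_right[OF bounded_bilinear_cross])
  then have "norm (u \<times> b - u' \<times> b') \<le> norm ((u - u') \<times> b) + norm (u' \<times> (b - b'))"
    by (simp only: norm_triangle_ineq)
  also have "\<dots> \<le> norm (u - u') + norm (b - b')"
    using norm_cross_le[of "u - u'" b] norm_cross_le[of u' "b - b'"] b nu by simp
  finally have ub: "norm (u \<times> b - u' \<times> b') \<le> norm (u - u') + norm (b - b')" .
  have "attitude_of b h - attitude_of b' h' = transpose (vector [u \<times> b - u' \<times> b', u - u', b - b'])"
    unfolding attitude_of_columns[OF b(1)] attitude_of_columns[OF b(2)] u_def[symmetric] u'_def[symmetric]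
    by (simp add: transpose_def vec_eq_iff forall_3)
  then have "norm (attitude_of b h - attitude_of b' h')
    \<le> norm (u \<times> b - u' \<times> b') + norm (u - u') + norm (b - b')"
    by (simp only: norm_transpose_vector_3_le)
  \<comment> \<open>Both \<open>u\<close> and \<open>b\<close> occur in two of the three columns,
    which gives the constant \<open>4 / \<epsilon> + 2\<close>.\<close>
  also have "\<dots> \<le> 2 * norm (u - u') + 2 * ?d"
    using ub norm_ge_zero[of "h - h'"] unfolding distrib_left by linarith
  also have "\<dots> \<le> 2 * (2 / \<epsilon> * ?d) + 2 * ?d" by (intro add_right_mono mult_left_mono u) simp
  finally show ?thesis by (simp add: algebra_simps)
qed

lemma thrust_dir_lipschitz:
  assumes "norm a \<ge> m" "m > 0" "a' \<noteq> 0"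
  shows "norm (thrust_dir a - thrust_dir a') \<le> 2 / m * norm (a - a')"
proof -
  have "norm (thrust_dir a - thrust_dir a') = norm (a /\<^sub>R norm a - a' /\<^sub>R norm a')"
    by (simp add: thrust_dir_def norm_minus_commute)
  also have "\<dots> \<le> 2 / norm a * norm (a - a')"
    using assms by (intro normalize_lipschitz) auto
  also have "\<dots> \<le> 2 / m * norm (a - a')"
    using assms by (intro mult_right_mono divide_left_mono mult_pos_pos) (auto intro: less_le_trans)
  finally show ?thesis .
qed

lemma norm_thrust_dir: "a \<noteq> 0 \<Longrightarrow> norm (thrust_dir a) = 1"
  by (simp add: thrust_dir_def)

lemma thrust_dir_scaled: "- (norm a *\<^sub>R thrust_dir a) = a"
  by (cases "a = 0") (simp_all add: thrust_dir_def)

lemma norm_rotation: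
  assumes "rotation_matrix (M :: real^3^3)"
  shows "norm (M *v w) = norm w"
  using assms unfolding rotation_matrix_def
  by (metis matrix_of_matrix_vector_mul matrix_vector_mul_linear orthogonal_transformation
      orthogonal_transformation_matrix)

text \<open>The thrust is the projection of the commanded force to the actual thrust axis.\<close>

lemma projected_force_error:
  assumes "rotation_matrix R" "rotation_matrix Rd" "Rd *v e3 = thrust_dir a"
  shows "norm ((a \<bullet> (R *v e3)) *\<^sub>R (R *v e3) - a) \<le> 2 * norm a * norm (transpose Rd ** R - mat 1)"
proof (cases "a = 0")
  case False
  define b where "b = thrust_dir a"
  define r where "r = R *v e3"
  have nb: "norm b = 1" unfolding b_def by (rule norm_thrust_dir[OF False])
  then have bb: "b \<bullet> b = 1" by (simp add: norm_eq_1)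
  have nr: "norm r = 1" unfolding r_def norm_rotation[OF assms(1)] by simp
  have a: "a = - (norm a *\<^sub>R b)" unfolding b_def by (simp add: thrust_dir_scaled)
  \<comment> \<open>The error of the projection splits into a loss of magnitude along
    \<open>r\<close> and a change of direction, each at most \<open>norm (r - b)\<close>.\<close>
  have "(b \<bullet> r) *\<^sub>R r - b = (b \<bullet> (r - b)) *\<^sub>R r + (r - b)"
    by (simp add: inner_diff_right bb scaleR_diff_left)
  then have "norm ((b \<bullet> r) *\<^sub>R r - b) \<le> norm ((b \<bullet> (r - b)) *\<^sub>R r) + norm (r - b)"
    by (simp only: norm_triangle_ineq)
  also have "\<dots> \<le> 2 * norm (r - b)"
    using Cauchy_Schwarz_ineq2[of b "r - b"] nb nr by simp
  finally have 1: "norm ((b \<bullet> r) *\<^sub>R r - b) \<le> 2 * norm (r - b)" .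
  have "Rd ** transpose Rd = mat 1" using assms(2) by (simp add: rotation_matrix_def orthogonal_matrix_def)
  then have "r - b = Rd *v ((transpose Rd ** R - mat 1) *v e3)"
    unfolding r_def b_def assms(3)[symmetric]
    by (simp add: matrix_vector_mult_diff_rdistrib matrix_vector_mult_diff_distrib matrix_vector_mul_assoc matrix_mul_assoc)
  then have "norm (r - b) = norm ((transpose Rd ** R - mat 1) *v e3)" by (simp add: norm_rotation[OF assms(2)])
  also have "\<dots> \<le> norm (transpose Rd ** R - mat 1)"
  proof (rule power2_le_imp_le)
    show "(norm (M *v e3))\<^sup>2 \<le> (norm M)\<^sup>2" for M :: "real^3^3"
      unfolding norm_matrix_sq norm_vector_3_sq
      by (simp add: matrix_vector_mult_def axis_def sum_3)
  qed simp
  finally have 2: "norm (r - b) \<le> norm (transpose Rd ** R - mat 1)" .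
  have "(a \<bullet> r) *\<^sub>R r - a = - (norm a *\<^sub>R ((b \<bullet> r) *\<^sub>R r - b))"
    by (subst (1 2) a) (simp add: scaleR_diff_right)
  then have "norm ((a \<bullet> r) *\<^sub>R r - a) = norm a * norm ((b \<bullet> r) *\<^sub>R r - b)" by simp
  also have "\<dots> \<le> norm a * (2 * norm (transpose Rd ** R - mat 1))"
    using 1 2 by (intro mult_left_mono) auto
  finally show ?thesis by (simp add: r_def)
qed simp

section \<open>Energy of the attitude error\<close>

definition att_energy :: "real^3^3 \<Rightarrow> real \<Rightarrow> real \<Rightarrow> real^3^3 \<Rightarrow> real^3 \<Rightarrow> real" where
  "att_energy J k c Q e =
     (1/2) * (e \<bullet> (J *v e)) + k * ((1/2) * trace (mat 1 - Q)) + c * (skew_part Q \<bullet> (J *v e))"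

text \<open>The derivative of \<open>att_energy\<close> along \<open>Q' = Q ** hat e\<close>, with
  \<open>w\<close> standing for \<open>J *v e'\<close>; the equation of motion provides this product
  directly.\<close>

definition att_rate :: "real^3^3 \<Rightarrow> real \<Rightarrow> real \<Rightarrow> real^3^3 \<Rightarrow> real^3 \<Rightarrow> real^3 \<Rightarrow> real" where
  "att_rate J k c Q e w =
     e \<bullet> w + k * (skew_part Q \<bullet> e) + c * (skew_part (Q ** hat e) \<bullet> (J *v e) + skew_part Q \<bullet> w)"

lemma sym_pos_def_inner: "sym_pos_def J \<Longrightarrow> v \<bullet> (J *v w) = (J *v v) \<bullet> w"
  unfolding sym_pos_def_def by (metis dot_lmul_matrix transpose_matrix_vector)

text \<open>The minimum over the unit sphere is attained and positive; homogeneity extends it to all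
  vectors.\<close>

lemma sym_pos_def_lower_bound:
  assumes "sym_pos_def J"
  obtains j where "j > 0" "\<And>v. j * (norm v)\<^sup>2 \<le> v \<bullet> (J *v v)"
proof -
  have "compact (sphere (0::real^3) 1)" "sphere (0::real^3) 1 \<noteq> {}" by auto
  moreover have "continuous_on (sphere 0 1) (\<lambda>v. v \<bullet> (J *v v))"
    by (intro continuous_intros linear_continuous_on linear_linear[THEN iffD2] matrix_vector_mul_linear)
  ultimately obtain u where u: "norm u = 1" "\<And>v. norm v = 1 \<Longrightarrow> u \<bullet> (J *v u) \<le> v \<bullet> (J *v v)"
    using continuous_attains_inf[of "sphere (0::real^3) 1" "\<lambda>v. v \<bullet> (J *v v)"] by auto
  have "(u \<bullet> (J *v u)) * (norm v)\<^sup>2 \<le> v \<bullet> (J *v v)" for v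
  proof (cases "v = 0")
    case False
    let ?w = "v /\<^sub>R norm v"
    have "u \<bullet> (J *v u) \<le> ?w \<bullet> (J *v ?w)" using False by (intro u) simp
    also have "\<dots> = (v \<bullet> (J *v v)) / (norm v)\<^sup>2"
      by (simp add: matrix_vector_mult_scaleR power2_eq_square divide_inverse mult_ac)
    finally show ?thesis using False by (simp add: field_simps)
  qed simp
  moreover have "u \<bullet> (J *v u) > 0" using assms u(1) norm_zero[where 'a = "real^3"]
    unfolding sym_pos_def_def by (metis zero_neq_one)
  ultimately show ?thesis using that by blast
qed

text \<open>
  \<open>y\<close> stands for the commanded angular velocity in the body frame. Its gyroscopic contributions
  do no work on the error \<open>e\<close>, so it enters through the cross term only.
\<close>

lemma att_energy_decay:
  assumes J: "sym_pos_def J" and k: "k > 0" "k' > 0" and B: "B \<ge> 0"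
  obtains c p q d where "p > 0" "q > 0" "d > 0"
    and "\<And>Q e. rotation_matrix Q \<Longrightarrow>
      p * ((norm (Q - mat 1))\<^sup>2 + (norm e)\<^sup>2) \<le> att_energy J k c Q e"
    and "\<And>Q e. rotation_matrix Q \<Longrightarrow>
      att_energy J k c Q e \<le> q * ((norm (Q - mat 1))\<^sup>2 + (norm e)\<^sup>2)"
    and "\<And>Q e y. rotation_matrix Q \<Longrightarrow> norm (Q - mat 1) \<le> 1 \<Longrightarrow> norm e \<le> 1 \<Longrightarrow> norm y \<le> B \<Longrightarrow>
      att_rate J k c Q e (- ((e + y) \<times> (J *v (e + y))) - k *\<^sub>R skew_part Q - k' *\<^sub>R e
        + y \<times> (J *v y) + J *v (e \<times> y)) \<le> - d * ((norm (Q - mat 1))\<^sup>2 + (norm e)\<^sup>2)"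
proof -
  obtain j where j: "j > 0" "\<And>v. j * (norm v)\<^sup>2 \<le> v \<bullet> (J *v v)"
    using sym_pos_def_lower_bound[OF J] by blast
  obtain K where K: "K > 0" "\<And>v. norm (J *v v) \<le> K * norm v"
  proof -
    obtain K' where "K' > 0" "\<And>A v. norm (A *v v) \<le> K' * (norm (A::real^3^3) * norm (v::real^3))"
      using bounded_bilinear_bound[OF bounded_bilinear_matrix_vector_mult] by blast
    then have "norm (J *v v) \<le> (K' * norm J + 1) * norm v" "0 < K' * norm J + 1" for v
      by (auto simp: distrib_right mult.assoc intro: add_nonneg_pos add_increasing2)
    with that show ?thesis by blast
  qed
  obtain K0 where K0: "K0 > 0" "\<And>Q e. norm (skew_part (Q ** hat e)) \<le> K0 * (norm Q * norm e)"
  proof -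
    have "bounded_bilinear (\<lambda>Q e. skew_part (Q ** hat e))"
    proof -
      have "bounded_bilinear (\<lambda>Q e. Q ** hat e :: real^3^3)"
        by (rule bounded_bilinear.comp[OF bounded_bilinear_matrix_matrix_mult bounded_linear_ident bounded_linear_hat])
      then have "linear (\<lambda>e. Q ** hat e :: real^3^3)" "linear (\<lambda>Q. Q ** hat e :: real^3^3)" for Q e
        by (simp_all add: bilinear_conv_bounded_bilinear[symmetric] bilinear_def)
      from this[THEN linear_compose, OF bounded_linear.linear[OF bounded_linear_skew_part]]
      have "bilinear (\<lambda>Q e. skew_part (Q ** hat e))"
        unfolding bilinear_def comp_def by simp
      then show ?thesis by (simp add: bilinear_conv_bounded_bilinear)
    qed
    from bounded_bilinear_bound[OF this] show ?thesis using that by blast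
  qed
  \<comment> \<open>\<open>K1\<close> bounds the part of the cross rate that comes from
    \<open>Q'\<close>, relative to the squared norm of \<open>e\<close>, with 2 as a bound for
    \<open>norm Q\<close>. \<open>K2 * norm e\<close> bounds all torques except the restoring one
    when \<open>norm e \<le> 1\<close>, and \<open>c0\<close> collects what the cross term can take
    away from the damping.\<close>
  define K1 where "K1 = 2 * K0 * K"
  define K2 where "K2 = K + 3 * K * B + k'"
  define c0 where "c0 = K1 + K2\<^sup>2 / (2 * k)"
  \<comment> \<open>The three bounds preserve half of the damping \<open>k'\<close> and keep the
    cross term below half of the kinetic and half of the potential part of the energy.\<close>
  define c where "c = min (k' / (2 * c0)) (min (j / (2 * K)) (k / (4 * K)))"
  have K1: "K1 > 0" and K2: "K2 > 0" using K0 K B k by (auto simp: K1_def K2_def intro!: add_pos_nonneg add_nonneg_pos mult_nonneg_nonneg)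
  then have c0: "c0 > 0" using k by (simp add: c0_def add_pos_nonneg)
  have c: "c > 0" "c \<le> k' / (2 * c0)" "c \<le> j / (2 * K)" "c \<le> k / (4 * K)"
    using c0 j K k by (auto simp: c_def)
  have cc: "c * c0 \<le> k' / 2" "c * K \<le> j / 2" "c * K \<le> k / 4"
    using c c0 K by (simp_all add: field_simps)
  show ?thesis
  proof (rule that[of "min (j / 4) (k / 8)" "K + k + c * K" "min (k' / 2) (c * k / 8)" c])
    show "min (j / 4) (k / 8) > 0" "K + k + c * K > 0" "min (k' / 2) (c * k / 8) > 0"
      using j k K c by (auto intro!: add_pos_pos)
  next
    fix Q :: "real^3^3" and e :: "real^3"
    assume Q: "rotation_matrix Q"
    let ?n = "norm (Q - mat 1)" and ?e = "norm e" and ?s = "norm (skew_part Q)"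
    have tr: "(1/2) * trace (mat 1 - Q) = ?n\<^sup>2 / 4"
      using norm_orthogonal_diff_mat1[of Q] Q by (simp add: rotation_matrix_def)
    have sn: "?s \<le> ?n" by (rule rotation_error_bounds[OF Q])
    have "\<bar>skew_part Q \<bullet> (J *v e)\<bar> \<le> ?s * norm (J *v e)" by (rule Cauchy_Schwarz_ineq2)
    also have "\<dots> \<le> ?n * (K * ?e)" using sn K by (intro mult_mono) auto
    also have "\<dots> = K * (?n * ?e)" by simp
    also have "\<dots> \<le> K * ((?n\<^sup>2 + ?e\<^sup>2) / 2)"
      using K sum_squares_bound[of ?n ?e] by (intro mult_left_mono) auto
    finally have "c * \<bar>skew_part Q \<bullet> (J *v e)\<bar> \<le> c * (K * ((?n\<^sup>2 + ?e\<^sup>2) / 2))"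
      using c by (intro mult_left_mono) auto
    then have cross: "\<bar>c * (skew_part Q \<bullet> (J *v e))\<bar> \<le> (c * K) * (?n\<^sup>2 / 2) + (c * K) * (?e\<^sup>2 / 2)"
      using c by (simp add: abs_mult algebra_simps add_divide_distrib)
    have m: "(c * K) * (?n\<^sup>2 / 2) \<le> k / 4 * (?n\<^sup>2 / 2)" "(c * K) * (?e\<^sup>2 / 2) \<le> j / 2 * (?e\<^sup>2 / 2)"
      using cc by (intro mult_right_mono; simp)+
    have "min (j / 4) (k / 8) * ?n\<^sup>2 \<le> k / 8 * ?n\<^sup>2" "min (j / 4) (k / 8) * ?e\<^sup>2 \<le> j / 4 * ?e\<^sup>2"
      by (intro mult_right_mono; simp)+
    then show "min (j / 4) (k / 8) * (?n\<^sup>2 + ?e\<^sup>2) \<le> att_energy J k c Q e"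
      using abs_le_D2[OF cross] m j(2)[of e] unfolding att_energy_def tr distrib_left by linarith
    have "e \<bullet> (J *v e) \<le> ?e * norm (J *v e)" by (rule norm_cauchy_schwarz)
    also have "\<dots> \<le> ?e * (K * ?e)" using K by (intro mult_left_mono) auto
    finally have eJ: "e \<bullet> (J *v e) \<le> K * ?e\<^sup>2" by (simp add: power2_eq_square mult_ac)
    have "0 \<le> K * ?n\<^sup>2" "0 \<le> K * ?e\<^sup>2" "0 \<le> k * ?n\<^sup>2" "0 \<le> k * ?e\<^sup>2" "0 \<le> c * K * ?n\<^sup>2" "0 \<le> c * K * ?e\<^sup>2"
      using K k c by auto
    then show "att_energy J k c Q e \<le> (K + k + c * K) * (?n\<^sup>2 + ?e\<^sup>2)"
      using abs_le_D1[OF cross] eJ unfolding att_energy_def tr distrib_left distrib_right by linarith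
  next
    fix Q :: "real^3^3" and e y :: "real^3"
    assume Q: "rotation_matrix Q" and n1: "norm (Q - mat 1) \<le> 1" and e1: "norm e \<le> 1" and y: "norm y \<le> B"
    let ?n = "norm (Q - mat 1)" and ?e = "norm e" and ?s = "norm (skew_part Q)"
    define w where "w = - ((e + y) \<times> (J *v (e + y))) - k *\<^sub>R skew_part Q - k' *\<^sub>R e
        + y \<times> (J *v y) + J *v (e \<times> y)"
    \<comment> \<open>The torque without the restoring term, after the feedforward has cancelled the
      gyroscopic part quadratic in \<open>y\<close>.\<close>
    define r where "r = - (e \<times> (J *v e)) - e \<times> (J *v y) - y \<times> (J *v e) - k' *\<^sub>R e + J *v (e \<times> y)"
    note cl = bounded_bilinear.add_right[OF bounded_bilinear_cross] bounded_bilinear.add_left[OF bounded_bilinear_cross]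
    have w: "w = r - k *\<^sub>R skew_part Q"
      unfolding w_def r_def by (simp add: cl matrix_vector_right_distrib algebra_simps)
    \<comment> \<open>By symmetry of \<open>J\<close> the two gyroscopic terms that are not
      orthogonal to \<open>e\<close> do opposite work on it.\<close>
    have "e \<bullet> (J *v (e \<times> y)) = e \<bullet> (y \<times> (J *v e))"
      unfolding sym_pos_def_inner[OF J] by (metis cross_triple inner_commute)
    then have er: "e \<bullet> r = - k' * ?e\<^sup>2"
      unfolding r_def by (simp add: inner_diff_right inner_add_right dot_cross_self power2_norm_eq_inner)
    have nr: "norm r \<le> K2 * ?e"
    proof -
      have a: "norm (e \<times> (J *v e)) \<le> K * ?e"
      proof -
        have "norm (e \<times> (J *v e)) \<le> ?e * (K * ?e)"
          by (rule order_trans[OF norm_cross_le mult_left_mono[OF K(2)]]) simp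
        also have "\<dots> \<le> 1 * (K * ?e)" using e1 K by (intro mult_right_mono) auto
        finally show ?thesis by simp
      qed
      have b: "norm (e \<times> (J *v y)) \<le> K * B * ?e"
      proof -
        have "norm (e \<times> (J *v y)) \<le> ?e * (K * norm y)"
          by (rule order_trans[OF norm_cross_le mult_left_mono[OF K(2)]]) simp
        also have "\<dots> \<le> ?e * (K * B)" using y K by (intro mult_left_mono) auto
        finally show ?thesis by (simp add: mult_ac)
      qed
      have c: "norm (y \<times> (J *v e)) \<le> K * B * ?e"
      proof -
        have "norm (y \<times> (J *v e)) \<le> norm y * (K * ?e)"
          by (rule order_trans[OF norm_cross_le mult_left_mono[OF K(2)]]) simp
        also have "\<dots> \<le> B * (K * ?e)" using y K by (intro mult_right_mono) auto
        finally show ?thesis by (simp add: mult_ac)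
      qed
      have d: "norm (J *v (e \<times> y)) \<le> K * B * ?e"
      proof -
        have "norm (J *v (e \<times> y)) \<le> K * (?e * norm y)"
          by (rule order_trans[OF K(2) mult_left_mono[OF norm_cross_le]]) (use K in simp)
        also have "\<dots> \<le> K * (?e * B)" using y K by (intro mult_left_mono) auto
        finally show ?thesis by (simp add: mult_ac)
      qed
      have "norm r \<le> norm (e \<times> (J *v e)) + norm (e \<times> (J *v y)) + norm (y \<times> (J *v e)) + norm (k' *\<^sub>R e) + norm (J *v (e \<times> y))"
        unfolding r_def
        by (intro order_trans[OF norm_triangle_ineq add_right_mono] order_trans[OF norm_triangle_ineq4 add_right_mono]) simp
      then show ?thesis using a b c d k(2) unfolding K2_def by (simp add: algebra_simps)
    qed
    have "skew_part Q \<bullet> r \<le> ?s * norm r" by (rule norm_cauchy_schwarz)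
    also have "\<dots> \<le> ?s * (K2 * ?e)" using nr by (intro mult_left_mono) auto
    \<comment> \<open>Young's inequality, weighted so that half of the restoring term
      \<open>k * ?s\<^sup>2\<close> is left.\<close>
    also have "\<dots> \<le> k / 2 * ?s\<^sup>2 + K2\<^sup>2 / (2 * k) * ?e\<^sup>2"
    proof -
      have "0 \<le> (k * ?s - K2 * ?e)\<^sup>2 / (2 * k)" using k by simp
      also have "\<dots> = k / 2 * ?s\<^sup>2 + K2\<^sup>2 / (2 * k) * ?e\<^sup>2 - ?s * (K2 * ?e)"
        using k by (simp add: field_simps power2_eq_square)
      finally show ?thesis by simp
    qed
    finally have sr: "skew_part Q \<bullet> r \<le> k / 2 * ?s\<^sup>2 + K2\<^sup>2 / (2 * k) * ?e\<^sup>2" .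
    have "(norm Q)\<^sup>2 \<le> 2\<^sup>2"
      using orthogonal_norm_sq[of Q] Q by (simp add: rotation_matrix_def)
    then have "norm Q \<le> 2" by (rule power2_le_imp_le) simp
    have "skew_part (Q ** hat e) \<bullet> (J *v e) \<le> norm (skew_part (Q ** hat e)) * norm (J *v e)"
      by (rule norm_cauchy_schwarz)
    also have "\<dots> \<le> (K0 * (norm Q * ?e)) * (K * ?e)"
      using K K0 by (intro mult_mono) auto
    also have "\<dots> \<le> (K0 * (2 * ?e)) * (K * ?e)"
      using K K0 \<open>norm Q \<le> 2\<close> by (intro mult_right_mono mult_left_mono) auto
    also have "\<dots> = K1 * ?e\<^sup>2" by (simp add: K1_def power2_eq_square)
    finally have sJ: "skew_part (Q ** hat e) \<bullet> (J *v e) \<le> K1 * ?e\<^sup>2" .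
    have "skew_part Q \<bullet> w \<le> - (k / 2) * ?s\<^sup>2 + K2\<^sup>2 / (2 * k) * ?e\<^sup>2"
      using sr unfolding w by (simp add: inner_diff_right power2_norm_eq_inner[symmetric])
    then have "skew_part (Q ** hat e) \<bullet> (J *v e) + skew_part Q \<bullet> w \<le> c0 * ?e\<^sup>2 - k / 2 * ?s\<^sup>2"
      using sJ unfolding c0_def by (simp add: distrib_right)
    then have "c * (skew_part (Q ** hat e) \<bullet> (J *v e) + skew_part Q \<bullet> w) \<le> c * (c0 * ?e\<^sup>2 - k / 2 * ?s\<^sup>2)"
      using c(1) by (intro mult_left_mono) auto
    also have "\<dots> = (c * c0) * ?e\<^sup>2 - c * k / 2 * ?s\<^sup>2" by (simp add: algebra_simps)
    also have "\<dots> \<le> k' / 2 * ?e\<^sup>2 - c * k / 2 * (?n\<^sup>2 / 4)"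
    proof -
      \<comment> \<open>The restoring term only controls \<open>skew_part Q\<close>; the smallness
        of \<open>Q - mat 1\<close> converts this into control of the distance to the
        identity.\<close>
      have "?n \<le> 2 * ?s" using rotation_error_bounds[OF Q] n1 by blast
      then have "?n\<^sup>2 \<le> (2 * ?s)\<^sup>2" by (intro power_mono) auto
      then have "?n\<^sup>2 / 4 \<le> ?s\<^sup>2" by (simp add: power_mult_distrib)
      then have "c * k / 2 * (?n\<^sup>2 / 4) \<le> c * k / 2 * ?s\<^sup>2" using c(1) k by (intro mult_left_mono) auto
      moreover have "(c * c0) * ?e\<^sup>2 \<le> k' / 2 * ?e\<^sup>2" using cc(1) by (intro mult_right_mono) auto
      ultimately show ?thesis by linarith
    qed
    finally have cr: "c * (skew_part (Q ** hat e) \<bullet> (J *v e) + skew_part Q \<bullet> w)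
      \<le> k' / 2 * ?e\<^sup>2 - c * k / 8 * ?n\<^sup>2" by simp
    have "e \<bullet> w + k * (skew_part Q \<bullet> e) = - k' * ?e\<^sup>2"
      unfolding w inner_diff_right er by (simp add: inner_commute)
    then have "att_rate J k c Q e w \<le> - (k' / 2) * ?e\<^sup>2 - c * k / 8 * ?n\<^sup>2"
      unfolding att_rate_def using cr by simp
    also have "\<dots> \<le> - min (k' / 2) (c * k / 8) * (?n\<^sup>2 + ?e\<^sup>2)"
    proof -
      have "min (k' / 2) (c * k / 8) * ?n\<^sup>2 \<le> c * k / 8 * ?n\<^sup>2" "min (k' / 2) (c * k / 8) * ?e\<^sup>2 \<le> k' / 2 * ?e\<^sup>2"
        by (intro mult_right_mono; simp)+
      then show ?thesis by (simp add: distrib_left)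
    qed
    finally show "att_rate J k c Q e (- ((e + y) \<times> (J *v (e + y))) - k *\<^sub>R skew_part Q - k' *\<^sub>R e
        + y \<times> (J *v y) + J *v (e \<times> y)) \<le> - min (k' / 2) (c * k / 8) * (?n\<^sup>2 + ?e\<^sup>2)"
      unfolding w_def .
  qed
qed

section \<open>Derivatives of rotations and of attitude errors\<close>

lemma has_vector_derivative_transform_eventually:
  assumes "(f has_vector_derivative f') (at t within S)"
    and "\<forall>\<^sub>F s in at t within S. f s = g s" "f t = g t" "t \<in> S"
  shows "(g has_vector_derivative f') (at t within S)"
  using assms unfolding has_vector_derivative_def by (rule has_derivative_transform_eventually)

lemma difference_quotient_norm:
  assumes "(f has_vector_derivative f') (at t within S)"
  shows "((\<lambda>s. norm (f s - f t) / \<bar>s - t\<bar>) \<longlongrightarrow> norm f') (at t within S)"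
proof (rule Lim_transform2[OF tendsto_const])
  have lim: "((\<lambda>s. norm (f s - f t - (s - t) *\<^sub>R f') / norm (s - t)) \<longlongrightarrow> 0) (at t within S)"
    using assms unfolding has_vector_derivative_def has_derivative_iff_norm by blast
  show "((\<lambda>s. norm f' - norm (f s - f t) / \<bar>s - t\<bar>) \<longlongrightarrow> 0) (at t within S)"
  proof (rule Lim_null_comparison[OF _ lim])
    have "norm (norm f' - norm (f s - f t) / \<bar>s - t\<bar>) \<le> norm (f s - f t - (s - t) *\<^sub>R f') / norm (s - t)"
      if "s \<noteq> t" for s
    proof -
      have "norm f' - norm (f s - f t) / \<bar>s - t\<bar> = (norm ((s - t) *\<^sub>R f') - norm (f s - f t)) / \<bar>s - t\<bar>"
        using that by (simp add: diff_divide_distrib)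
      then have "\<bar>norm f' - norm (f s - f t) / \<bar>s - t\<bar>\<bar> = \<bar>norm ((s - t) *\<^sub>R f') - norm (f s - f t)\<bar> / \<bar>s - t\<bar>"
        by simp
      also have "\<dots> \<le> norm ((s - t) *\<^sub>R f' - (f s - f t)) / \<bar>s - t\<bar>"
        by (intro divide_right_mono norm_triangle_ineq3) simp
      finally show ?thesis by (simp add: norm_minus_commute)
    qed
    then show "\<forall>\<^sub>F s in at t within S. norm (norm f' - norm (f s - f t) / \<bar>s - t\<bar>)
        \<le> norm (f s - f t - (s - t) *\<^sub>R f') / norm (s - t)"
      unfolding eventually_at_filter by (intro always_eventually) auto
  qed
qed

text \<open>Dividing a Lipschitz estimate along a motion by the elapsed time and passing to the
  limit bounds the derivative without a formula for it.\<close>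

lemma lipschitz_derivative_bound:
  assumes f: "(f has_vector_derivative f') (at t within S)"
    and g: "(g has_vector_derivative g') (at t within S)"
    and h: "(h has_vector_derivative h') (at t within S)"
    and nt: "at t within S \<noteq> bot"
    and le: "\<forall>\<^sub>F s in at t within S. norm (f s - f t) \<le> L * norm (g s - g t) + M * norm (h s - h t)"
  shows "norm f' \<le> L * norm g' + M * norm h'"
proof (rule tendsto_le[OF nt])
  show "((\<lambda>s. L * (norm (g s - g t) / \<bar>s - t\<bar>) + M * (norm (h s - h t) / \<bar>s - t\<bar>)) \<longlongrightarrow> L * norm g' + M * norm h') (at t within S)"
    by (intro tendsto_add tendsto_mult_left difference_quotient_norm g h)
  show "((\<lambda>s. norm (f s - f t) / \<bar>s - t\<bar>) \<longlongrightarrow> norm f') (at t within S)"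
    by (rule difference_quotient_norm[OF f])
  show "\<forall>\<^sub>F s in at t within S. norm (f s - f t) / \<bar>s - t\<bar>
      \<le> L * (norm (g s - g t) / \<bar>s - t\<bar>) + M * (norm (h s - h t) / \<bar>s - t\<bar>)"
    using le
  proof eventually_elim
    case (elim s)
    from divide_right_mono[OF this, of "\<bar>s - t\<bar>"] show ?case by (simp add: add_divide_distrib)
  qed
qed

text \<open>Differentiating \<open>R^T R = I\<close> shows that \<open>R^T R'\<close> is skew, hence
  the hat of its \<open>vee\<close>. Orthogonality is assumed near \<open>t\<close> only, since the
  commanded attitude is known to be a rotation just near the equilibrium.\<close>

lemma rotation_derivative_skew:
  fixes R :: "real \<Rightarrow> real^3^3"
  assumes R: "(R has_vector_derivative R') (at t within S)" and nt: "at t within S \<noteq> bot" and t: "t \<in> S"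
    and orth: "\<forall>\<^sub>F s in at t within S. orthogonal_matrix (R s)" "orthogonal_matrix (R t)"
  shows "R' = R t ** hat (vee (transpose (R t) ** R'))"
proof -
  let ?f = "\<lambda>s. transpose (R s) ** R s"
  note RT = bounded_linear.has_vector_derivative[OF bounded_linear_transpose R]
  have 1: "(?f has_vector_derivative (transpose (R t) ** R' + transpose R' ** R t)) (at t within S)"
    by (rule bounded_bilinear.has_vector_derivative[OF bounded_bilinear_matrix_matrix_mult RT R])
  have "((\<lambda>_. mat 1) has_vector_derivative 0) (at t within S)" by simp
  then have 2: "(?f has_vector_derivative 0) (at t within S)"
  proof (rule has_vector_derivative_transform_eventually)
    show "\<forall>\<^sub>F s in at t within S. mat 1 = transpose (R s) ** R s"
      using orth(1) by eventually_elim (simp add: orthogonal_matrix_def)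
  qed (use orth(2) t in \<open>simp_all add: orthogonal_matrix_def\<close>)
  have "transpose (R t) ** R' + transpose R' ** R t = 0"
    by (rule vector_derivative_unique_within[OF nt 1 2])
  then have "transpose (transpose (R t) ** R') = - (transpose (R t) ** R')"
    by (simp add: matrix_transpose_mul transpose_transpose add_eq_0_iff)
  from hat_vee[OF this] have "R t ** hat (vee (transpose (R t) ** R')) = (R t ** transpose (R t)) ** R'"
    by (simp add: matrix_mul_assoc)
  then show ?thesis using orth(2) by (simp add: orthogonal_matrix_def)
qed

text \<open>The attitude potential changes at a rate proportional to \<open>skew_part Q . e\<close>,
  which is the work that the proportional term of the moment balances.\<close>

lemma trace_mult_hat: "trace (Q ** hat e) = - 2 * (skew_part Q \<bullet> e)"
  by (simp add: trace_def matrix_matrix_mult_def hat_def matrix_def skew_part_def vee_def transpose_def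
      cross3_def axis_def inner_vec_def sum_3 field_simps)

lemma rotation_conjugate_hat:
  assumes "rotation_matrix Q"
  shows "hat w ** Q = Q ** hat (transpose Q *v w)"
  unfolding matrix_eq
proof
  fix v :: "real^3"
  have "Q *v (transpose Q *v w) = w"
    using assms by (simp add: rotation_matrix_def orthogonal_matrix_def matrix_vector_mul_assoc)
  then show "(hat w ** Q) *v v = (Q ** hat (transpose Q *v w)) *v v"
    using cross_rotation_matrix[OF assms, of "transpose Q *v w" v] by (simp add: mat_vec_simps)
qed

lemma rotation_matrix_transpose_mult:
  "rotation_matrix A \<Longrightarrow> rotation_matrix B \<Longrightarrow> rotation_matrix (transpose A ** B)" for A B :: "real^3^3"
  by (simp add: rotation_matrix_def orthogonal_matrix_mul orthogonal_matrix_transpose det_mul)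

text \<open>The relative attitude obeys the kinematics of a rigid body with angular velocity
  \<open>e\<close>; this is why the velocity error subtracts the commanded velocity after
  transporting it to the body frame.\<close>

lemma attitude_error_derivative:
  fixes R Rc :: "real \<Rightarrow> real^3^3" and Om Oc :: "real \<Rightarrow> real^3"
  defines "Q \<equiv> \<lambda>s. transpose (Rc s) ** R s"
    and "e \<equiv> \<lambda>s. Om s - (transpose (R s) ** Rc s) *v Oc s"
  assumes R: "(R has_vector_derivative R t ** hat (Om t)) (at t within S)" "rotation_matrix (R t)"
    and Rc: "(Rc has_vector_derivative Rc t ** hat (Oc t)) (at t within S)" "rotation_matrix (Rc t)"
    and Om: "(Om has_vector_derivative dOm) (at t within S)"
    and Oc: "(Oc has_vector_derivative dOc) (at t within S)"
  shows "(Q has_vector_derivative Q t ** hat (e t)) (at t within S)"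
    and "(e has_vector_derivative (dOm + e t \<times> ((transpose (R t) ** Rc t) *v Oc t) - (transpose (R t) ** Rc t) *v dOc)) (at t within S)"
proof -
  have Qt: "transpose (Q s) = transpose (R s) ** Rc s" for s
    by (simp add: Q_def matrix_transpose_mul transpose_transpose)
  have rot: "rotation_matrix (Q t)" unfolding Q_def using R(2) Rc(2) by (rule rotation_matrix_transpose_mult[rotated])
  note RcT = bounded_linear.has_vector_derivative[OF bounded_linear_transpose Rc(1)]
  have "(Q has_vector_derivative (transpose (Rc t) ** (R t ** hat (Om t)) + transpose (Rc t ** hat (Oc t)) ** R t)) (at t within S)"
    unfolding Q_def by (rule bounded_bilinear.has_vector_derivative[OF bounded_bilinear_matrix_matrix_mult RcT R(1)])
  also have "transpose (Rc t) ** (R t ** hat (Om t)) + transpose (Rc t ** hat (Oc t)) ** R t = Q t ** hat (e t)"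
  proof -
    have "transpose (Rc t ** hat (Oc t)) ** R t = - (hat (Oc t) ** Q t)"
      by (simp add: matrix_transpose_mul transpose_hat Q_def matrix_mul_assoc
          bounded_bilinear.minus_left[OF bounded_bilinear_matrix_matrix_mult])
    also have "\<dots> = - (Q t ** hat (transpose (Q t) *v Oc t))"
      by (simp add: rotation_conjugate_hat[OF rot])
    finally show ?thesis
      unfolding e_def Qt[symmetric]
      by (simp add: linear_diff[OF bounded_linear.linear[OF bounded_linear_hat]]
          bounded_bilinear.diff_right[OF bounded_bilinear_matrix_matrix_mult] Q_def matrix_mul_assoc)
  qed
  finally show Q': "(Q has_vector_derivative Q t ** hat (e t)) (at t within S)" .
  note QT = bounded_linear.has_vector_derivative[OF bounded_linear_transpose Q']
  have "(e has_vector_derivative (dOm - (transpose (Q t) *v dOc + transpose (Q t ** hat (e t)) *v Oc t))) (at t within S)"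
    unfolding e_def Qt[symmetric]
    by (intro has_vector_derivative_diff Om
        bounded_bilinear.has_vector_derivative[OF bounded_bilinear_matrix_vector_mult QT[unfolded e_def Qt[symmetric]] Oc])
  also have "dOm - (transpose (Q t) *v dOc + transpose (Q t ** hat (e t)) *v Oc t)
    = dOm + e t \<times> (transpose (Q t) *v Oc t) - transpose (Q t) *v dOc"
    by (simp add: matrix_transpose_mul transpose_hat mat_vec_simps matrix_vector_mult_uminus_left
        bounded_bilinear.minus_left[OF bounded_bilinear_matrix_matrix_mult])
  finally show "(e has_vector_derivative (dOm + e t \<times> ((transpose (R t) ** Rc t) *v Oc t) - (transpose (R t) ** Rc t) *v dOc)) (at t within S)"
    unfolding Qt .
qed

lemma att_energy_derivative:
  assumes Q: "(Q has_vector_derivative Q t ** hat (e t)) (at t within S)"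
    and e: "(e has_vector_derivative e') (at t within S)" and J: "sym_pos_def J"
  shows "((\<lambda>s. att_energy J k c (Q s) (e s)) has_real_derivative att_rate J k c (Q t) (e t) (J *v e')) (at t within S)"
proof -
  note sk = bounded_linear.has_vector_derivative[OF bounded_linear_skew_part Q]
  have Je: "((\<lambda>s. J *v e s) has_vector_derivative J *v e') (at t within S)"
    by (rule bounded_linear.has_vector_derivative[OF _ e])
      (simp add: linear_conv_bounded_linear[symmetric] matrix_vector_mul_linear)
  have tr: "bounded_linear (trace :: real^3^3 \<Rightarrow> real)"
    by (simp add: linear_conv_bounded_linear[symmetric] linear_iff trace_add trace_def sum.distrib sum_distrib_left)
  have 1: "((\<lambda>s. e s \<bullet> (J *v e s)) has_real_derivative (e t \<bullet> (J *v e') + e' \<bullet> (J *v e t))) (at t within S)"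
    unfolding has_real_derivative_iff_has_vector_derivative
    by (rule bounded_bilinear.has_vector_derivative[OF bounded_bilinear_inner e Je])
  have 2: "((\<lambda>s. trace (mat 1 - Q s)) has_real_derivative - trace (Q t ** hat (e t))) (at t within S)"
    unfolding has_real_derivative_iff_has_vector_derivative
    using bounded_linear.has_vector_derivative[OF tr has_vector_derivative_diff[OF has_vector_derivative_const Q]]
    by (simp add: linear_neg[OF bounded_linear.linear[OF tr]])
  have 3: "((\<lambda>s. skew_part (Q s) \<bullet> (J *v e s)) has_real_derivative
      (skew_part (Q t) \<bullet> (J *v e') + skew_part (Q t ** hat (e t)) \<bullet> (J *v e t))) (at t within S)"
    unfolding has_real_derivative_iff_has_vector_derivative
    by (rule bounded_bilinear.has_vector_derivative[OF bounded_bilinear_inner sk Je])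
  have sym: "e' \<bullet> (J *v e t) = e t \<bullet> (J *v e')"
    using sym_pos_def_inner[OF J, of e' "e t"] by (simp add: inner_commute)
  have "((\<lambda>s. att_energy J k c (Q s) (e s)) has_real_derivative
      (1/2) * (e t \<bullet> (J *v e') + e' \<bullet> (J *v e t)) + k * ((1/2) * (- trace (Q t ** hat (e t))))
      + c * (skew_part (Q t) \<bullet> (J *v e') + skew_part (Q t ** hat (e t)) \<bullet> (J *v e t))) (at t within S)"
    unfolding att_energy_def by (intro DERIV_add DERIV_cmult 1 2 3)
  then show ?thesis by (simp add: att_rate_def trace_mult_hat sym algebra_simps)
qed

section \<open>From the differential inequality to exponential decay\<close>

text \<open>A motion interval contains its left endpoint and has no right endpoint in it, so
  derivatives are one-sided at \<open>t0\<close> only.\<close>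

lemma motion_intervalD:
  assumes "motion_interval t0 S"
  shows "t0 \<in> S" and "t \<in> S \<Longrightarrow> t0 \<le> t" and "t \<in> S \<Longrightarrow> {t0..t} \<subseteq> S"
    and "t \<in> S \<Longrightarrow> at t within S \<noteq> bot"
    and "t \<in> S \<Longrightarrow> t0 < t \<Longrightarrow> at t within S = at t"
proof -
  note S = assms[unfolded motion_interval_def]
  show "t0 \<in> S" "t \<in> S \<Longrightarrow> t0 \<le> t" "t \<in> S \<Longrightarrow> {t0..t} \<subseteq> S" using S by auto
  show "at t within S \<noteq> bot" if t: "t \<in> S"
  proof -
    obtain b where b: "t < b" "{t..<b} \<subseteq> S"
      using S t by (elim disjE exE conjE) (auto intro: that[of "t + 1"])
    have "at t within {t<..<b} \<noteq> bot"
      using b(1) by (simp add: trivial_limit_within islimpt_greaterThanLessThan1)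
    moreover have "{t<..<b} \<subseteq> S" using b(2) by auto
    ultimately show ?thesis by (metis at_le bot_unique)
  qed
  show "at t within S = at t" if t: "t \<in> S" "t0 < t"
  proof (rule at_within_interior)
    show "t \<in> interior S"
      using S t by (elim disjE exE conjE) (simp_all add: interior_atLeastLessThan)
  qed
qed

text \<open>The estimates for \<open>W\<close> are available only while
  \<open>N < \<epsilon>\<close>. Up to the first time at which this fails they give
  \<open>N \<le> sqrt (q / p) * N t0\<close>, by continuity also at that time, and the second
  condition on \<open>N t0\<close> puts this bound below \<open>\<epsilon>\<close>.\<close>

lemma exponential_decay_barrier:
  fixes N W :: "real \<Rightarrow> real"
  assumes S: "motion_interval t0 S" and cont: "continuous_on S N" and nonneg: "\<And>t. N t \<ge> 0"
    and pos: "p > 0" "q > 0"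
    and bounds: "\<And>t. t \<in> S \<Longrightarrow> N t < \<epsilon> \<Longrightarrow> p * (N t)\<^sup>2 \<le> W t"
      "\<And>t. t \<in> S \<Longrightarrow> N t < \<epsilon> \<Longrightarrow> W t \<le> q * (N t)\<^sup>2"
    and der: "\<And>t. t \<in> S \<Longrightarrow> N t < \<epsilon> \<Longrightarrow> \<exists>w. (W has_real_derivative w) (at t within S) \<and> w \<le> - (2 * r) * W t"
    and r: "r \<ge> 0" and init: "N t0 < \<epsilon>" "sqrt (q / p) * N t0 < \<epsilon>"
    and t: "t \<in> S"
  shows "N t < \<epsilon>" and "N t \<le> sqrt (q / p) * exp (- r * (t - t0)) * N t0"
proof -
  note S' = motion_intervalD[OF S]
  have decay: "N t \<le> sqrt (q / p) * exp (- r * (t - t0)) * N t0"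
    if t: "t \<in> S" and good: "\<And>s. s \<in> {t0..t} \<Longrightarrow> N s < \<epsilon>" for t
  proof -
    \<comment> \<open>The integrating factor turns the differential inequality into
      monotonicity.\<close>
    let ?f = "\<lambda>s. exp (2 * r * (s - t0)) * W s"
    have f: "\<exists>w. (?f has_real_derivative w) (at s within S) \<and> w \<le> 0" if s: "s \<in> {t0..t}" for s
    proof -
      have "s \<in> S" using s S'(3)[OF t] by blast
      from der[OF this good[OF s]] obtain w where w: "(W has_real_derivative w) (at s within S)" "w \<le> - (2 * r) * W s"
        by blast
      have "(?f has_real_derivative exp (2 * r * (s - t0)) * (2 * r * W s + w)) (at s within S)"
        by (auto intro!: derivative_eq_intros w(1) simp: algebra_simps)
      moreover have "exp (2 * r * (s - t0)) * (2 * r * W s + w) \<le> 0"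
        using w(2) by (intro mult_nonneg_nonpos) auto
      ultimately show ?thesis by blast
    qed
    have "?f t \<le> ?f t0"
    proof (rule DERIV_nonpos_imp_decreasing_open[where f = ?f])
      show "t0 \<le> t" using S'(2)[OF t] .
      show "\<exists>y. (?f has_real_derivative y) (at s) \<and> y \<le> 0" if "t0 < s" "s < t" for s
      proof -
        have "s \<in> S" using S'(3)[OF t] that by auto
        then show ?thesis using f[of s] S'(5)[of s] that by auto
      qed
      show "continuous_on {t0..t} ?f"
        unfolding continuous_on_eq_continuous_within
      proof
        fix s assume s: "s \<in> {t0..t}"
        from f[OF s] have "continuous (at s within S) ?f" by (auto intro: DERIV_continuous)
        then show "continuous (at s within {t0..t}) ?f" using S'(3)[OF t] by (rule continuous_within_subset)
      qed
    qed
    then have "exp (2 * r * (t - t0)) * W t \<le> W t0" by simp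
    then have "exp (- (2 * r * (t - t0))) * (exp (2 * r * (t - t0)) * W t) \<le> exp (- (2 * r * (t - t0))) * W t0"
      by (rule mult_left_mono) simp
    then have "W t \<le> exp (- (2 * r * (t - t0))) * W t0"
      unfolding mult.assoc[symmetric] exp_add[symmetric] by simp
    moreover have "p * (N t)\<^sup>2 \<le> W t" using bounds(1)[OF t] good S'(2)[OF t] by simp
    moreover have "exp (- (2 * r * (t - t0))) * W t0 \<le> exp (- (2 * r * (t - t0))) * (q * (N t0)\<^sup>2)"
      using bounds(2)[OF S'(1)] init(1) by (intro mult_left_mono) auto
    ultimately have "p * (N t)\<^sup>2 \<le> exp (- (2 * r * (t - t0))) * (q * (N t0)\<^sup>2)" by linarith
    then have "(N t)\<^sup>2 \<le> (q / p) * exp (- (2 * r * (t - t0))) * (N t0)\<^sup>2"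
      using pos by (simp add: field_simps)
    also have "exp (- (2 * r * (t - t0))) = (exp (- r * (t - t0)))\<^sup>2"
      by (simp add: exp_double[symmetric])
    also have "(q / p) * (exp (- r * (t - t0)))\<^sup>2 * (N t0)\<^sup>2 = (sqrt (q / p) * exp (- r * (t - t0)) * N t0)\<^sup>2"
      using pos by (simp add: power_mult_distrib)
    finally show ?thesis
      by (rule power2_le_imp_le) (use nonneg pos in simp)
  qed
  have good: "N t < \<epsilon>" if t: "t \<in> S" for t
  proof (rule ccontr)
    assume "\<not> N t < \<epsilon>"
    \<comment> \<open>The times up to \<open>t\<close> at which the bound fails form a compact set;
      its minimum is the exit time.\<close>
    let ?B = "{s \<in> {t0..t}. \<epsilon> \<le> N s}"
    have ct: "continuous_on {t0..t} N" using cont S'(3)[OF t] by (rule continuous_on_subset)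
    have "closed ({t0..t} \<inter> N -` {\<epsilon>..})"
      using ct by (intro continuous_closed_preimage) auto
    moreover have "{t0..t} \<inter> N -` {\<epsilon>..} = ?B" by auto
    ultimately have "closed ?B" by simp
    moreover have "bounded ?B" by (rule bounded_subset[OF bounded_closed_interval[of t0 t]]) auto
    ultimately have "compact ?B" unfolding compact_eq_bounded_closed by blast
    moreover have "?B \<noteq> {}" using \<open>\<not> N t < \<epsilon>\<close> S'(2)[OF t] by auto
    ultimately have "\<exists>\<tau>\<in>?B. \<forall>s\<in>?B. \<tau> \<le> s" by (rule compact_attains_inf)
    then obtain \<tau> where \<tau>: "\<tau> \<in> ?B" "\<And>s. s \<in> ?B \<Longrightarrow> \<tau> \<le> s" by blast
    have before: "N s < \<epsilon>" if "s \<in> {t0..<\<tau>}" for s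
      using \<tau>(2)[of s] \<tau>(1) that by fastforce
    have "t0 < \<tau>" using \<tau>(1) init(1) by (cases "\<tau> = t0") auto
    have "N s \<le> sqrt (q / p) * N t0" if s: "s \<in> {t0..<\<tau>}" for s
    proof -
      have "s \<in> S" using s \<tau>(1) S'(3)[OF t] by auto
      then have "N s \<le> sqrt (q / p) * exp (- r * (s - t0)) * N t0"
        using before s by (intro decay) auto
      also have "\<dots> \<le> sqrt (q / p) * 1 * N t0"
        using r s nonneg pos by (intro mult_right_mono mult_left_mono) (auto simp: mult_le_0_iff)
      finally show ?thesis by simp
    qed
    moreover have cl: "closure {t0..<\<tau>} = {t0..\<tau>}" using \<open>t0 < \<tau>\<close> by (rule closure_atLeastLessThan)
    moreover have "continuous_on {t0..\<tau>} N" using ct \<tau>(1) by (auto intro: continuous_on_subset)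
    ultimately have "N \<tau> \<le> sqrt (q / p) * N t0"
      using continuous_le_on_closure[of "{t0..<\<tau>}" N \<tau>] \<open>t0 < \<tau>\<close> by auto
    then show False using init(2) \<tau>(1) by auto
  qed
  show "N t < \<epsilon>" by (rule good[OF t])
  show "N t \<le> sqrt (q / p) * exp (- r * (t - t0)) * N t0"
    using good S'(3)[OF t] by (intro decay[OF t]) auto
qed

section \<open>Closed-loop motions\<close>

text \<open>Time derivatives depend on the domain of a motion, so an instant records domain and
  trajectory along with the time.\<close>

type_synonym 'n instant = "real set \<times> 'n trajectory \<times> real"

definition vel0 :: "'n instant \<Rightarrow> real^3" where "vel0 = (\<lambda>(S, T, t). ddt S (pos0 T) t)"
definition acc0 :: "'n instant \<Rightarrow> real^3" where "acc0 = (\<lambda>(S, T, t). ddt S (ddt S (pos0 T)) t)"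
definition rot0 :: "'n instant \<Rightarrow> real^3^3" where "rot0 = (\<lambda>(S, T, t). att0 T t)"
definition om0 :: "'n instant \<Rightarrow> real^3" where "om0 = (\<lambda>(S, T, t). angv0 T t)"
definition dom0 :: "'n instant \<Rightarrow> real^3" where "dom0 = (\<lambda>(S, T, t). ddt S (angv0 T) t)"
definition dir :: "'n \<Rightarrow> nat \<Rightarrow> 'n instant \<Rightarrow> real^3" where "dir i j = (\<lambda>(S, T, t). dirL T i j t)"
definition ddir :: "'n \<Rightarrow> nat \<Rightarrow> 'n instant \<Rightarrow> real^3" where
  "ddir i j = (\<lambda>(S, T, t). ddt S (dirL T i j) t)"
definition dddir :: "'n \<Rightarrow> nat \<Rightarrow> 'n instant \<Rightarrow> real^3" where
  "dddir i j = (\<lambda>(S, T, t). ddt S (ddt S (dirL T i j)) t)"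

lemmas instant_defs = vel0_def acc0_def rot0_def om0_def dom0_def dir_def ddir_def dddir_def

lemma ddt_works: "diff_on S f \<Longrightarrow> t \<in> S \<Longrightarrow> (f has_vector_derivative ddt S f t) (at t within S)"
  by (simp add: diff_on_def ddt_def vector_derivative_works)

lemma ddt_eq:
  "(f has_vector_derivative f') (at t within S) \<Longrightarrow> at t within S \<noteq> bot \<Longrightarrow> ddt S f t = f'"
  unfolding ddt_def by (rule vector_derivative_within)

text \<open>The bounds on the headings are uniform in time because the constants of the stability
  estimate must serve all initial times. Separation of heading and thrust is stated at the nominal
  thrust direction and extends to a neighbourhood.\<close>

locale tracking =
  fixes P :: "'n::finite plant" and c :: "'n controller"
  assumes plant: "admissible_plant P"
    and equilibrium: "(\<Sum>i\<in>UNIV. rho P i) \<times> e3 = 0"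
    and gains: "lin_asymptotically_stable P (Kpos c) (Kvel c)"
    and k_pos: "k_R c > 0" "k_Omega c > 0"
    and heading_smooth: "\<And>i. smooth_command (heading c i)"
    and heading_unit: "\<And>i t. t \<ge> 0 \<Longrightarrow> norm (heading c i t) = 1"
    and heading_bounded: "\<And>i. bounded (ddt {0..} (heading c i) ` {0..})"
    and heading_not_parallel:
      "\<exists>\<epsilon>>0. \<forall>i. \<forall>t\<ge>0.
         \<epsilon> \<le> norm (thrust_dir (force P (Kpos c) (Kvel c) i (\<lambda>_. 0) (\<lambda>_. 0)) \<times> heading c i t)"
begin

text \<open>All instants of all closed-loop motions with nonnegative initial time: constants found
  for this set depend neither on the motion nor on its start.\<close>

definition valid :: "'n instant set" where
  "valid = {(S, T, t). (\<exists>t0\<ge>0. motion_interval t0 S) \<and> closed_loop P c S T \<and> t \<in> S}"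

definition err0 :: "'n instant \<Rightarrow> real^3" where "err0 = (\<lambda>(S, T, t). pos0 T t - pos_cmd c)"

definition x :: "'n instant \<Rightarrow> 'n coord \<Rightarrow> real" where
  "x \<sigma> = join (err0 \<sigma>) (skew_part (rot0 \<sigma>)) (\<lambda>i j. planar (dir i j \<sigma>))"
definition v :: "'n instant \<Rightarrow> 'n coord \<Rightarrow> real" where
  "v \<sigma> = join (vel0 \<sigma>) (skew_part (rot0 \<sigma> ** hat (om0 \<sigma>))) (\<lambda>i j. planar (ddir i j \<sigma>))"
definition a :: "'n instant \<Rightarrow> 'n coord \<Rightarrow> real" where
  "a \<sigma> = join (acc0 \<sigma>) (skew_part (rot0 \<sigma> ** hat (om0 \<sigma>) ** hat (om0 \<sigma>) + rot0 \<sigma> ** hat (dom0 \<sigma>)))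
    (\<lambda>i j. planar (dddir i j \<sigma>))"
definition dev :: "'n instant \<Rightarrow> real" where
  "dev \<sigma> = norm (err0 \<sigma>) + norm (vel0 \<sigma>) + norm (rot0 \<sigma> - mat 1) + norm (om0 \<sigma>)
    + (\<Sum>i\<in>UNIV. \<Sum>j\<in>links P i. norm (dir i j \<sigma> - e3) + norm (ddir i j \<sigma>))"
definition acc :: "'n instant \<Rightarrow> real" where
  "acc \<sigma> = norm (acc0 \<sigma>) + norm (dom0 \<sigma>) + (\<Sum>i\<in>UNIV. \<Sum>j\<in>links P i. norm (dddir i j \<sigma>))"

definition cmd :: "'n \<Rightarrow> 'n instant \<Rightarrow> real^3" where
  "cmd i \<sigma> = u_star P i + inputv (lin_input P (Kpos c) (Kvel c) (x \<sigma>) (v \<sigma>)) i"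

definition Rcmd :: "'n \<Rightarrow> 'n instant \<Rightarrow> real^3^3" where "Rcmd i = (\<lambda>(S, T, t). Rc P c S T i t)"
definition RQ :: "'n \<Rightarrow> 'n instant \<Rightarrow> real^3^3" where "RQ i = (\<lambda>(S, T, t). attQ T i t)"
definition Qerr :: "'n \<Rightarrow> 'n instant \<Rightarrow> real^3^3" where "Qerr i \<sigma> = transpose (Rcmd i \<sigma>) ** RQ i \<sigma>"
definition eOm :: "'n \<Rightarrow> 'n instant \<Rightarrow> real^3" where "eOm i = (\<lambda>(S, T, t). eOmega P c S T i t)"
definition err :: "'n instant \<Rightarrow> real" where "err \<sigma> = (\<Sum>i\<in>UNIV. norm (Qerr i \<sigma> - mat 1))"

context
  fixes S T t
  assumes valid: "(S, T, t) \<in> valid"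
begin

lemma valid_nontrivial: "at t within S \<noteq> bot" and valid_mem: "t \<in> S" and valid_nonneg: "t \<ge> 0"
  using valid motion_intervalD unfolding valid_def by (auto intro: order_trans)

lemma valid_shift: "s \<in> S \<Longrightarrow> (S, T, s) \<in> valid"
  using valid by (auto simp: valid_def)

lemma valid_motion: "closed_loop P c S T"
  using valid by (simp add: valid_def)

lemma valid_kinematics: "kinematics P S T" and valid_regular: "regular_trajectory P S T"
  using valid_motion by (simp_all add: closed_loop_def full_model_def)

lemma pos0_derivative: "((\<lambda>s. err0 (S, T, s)) has_vector_derivative vel0 (S, T, t)) (at t within S)"
  and vel0_derivative: "((\<lambda>s. vel0 (S, T, s)) has_vector_derivative acc0 (S, T, t)) (at t within S)"
  and om0_derivative: "((\<lambda>s. om0 (S, T, s)) has_vector_derivative dom0 (S, T, t)) (at t within S)"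
  and rot0_derivative: "((\<lambda>s. rot0 (S, T, s)) has_vector_derivative rot0 (S, T, t) ** hat (om0 (S, T, t))) (at t within S)"
  and rot0_rotation: "rotation_matrix (rot0 (S, T, t))"
proof -
  note reg = valid_regular[unfolded regular_trajectory_def] and mem = valid_mem
  note kin = valid_kinematics[unfolded kinematics_def]
  have "((\<lambda>s. pos0 T s - pos_cmd c) has_vector_derivative ddt S (pos0 T) t - 0) (at t within S)"
    using reg mem by (intro has_vector_derivative_diff ddt_works has_vector_derivative_const) auto
  then show "((\<lambda>s. err0 (S, T, s)) has_vector_derivative vel0 (S, T, t)) (at t within S)"
    by (simp add: err0_def instant_defs)
  show "((\<lambda>s. vel0 (S, T, s)) has_vector_derivative acc0 (S, T, t)) (at t within S)"
    "((\<lambda>s. om0 (S, T, s)) has_vector_derivative dom0 (S, T, t)) (at t within S)"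
    using reg mem by (simp_all add: instant_defs ddt_works)
  show "((\<lambda>s. rot0 (S, T, s)) has_vector_derivative rot0 (S, T, t) ** hat (om0 (S, T, t))) (at t within S)"
    "rotation_matrix (rot0 (S, T, t))"
    using kin mem by (simp_all add: instant_defs)
qed

context
  fixes i j assumes j: "j \<in> links P i"
begin

lemma ddir_eq: "ddir i j (S, T, t) = angvL T i j t \<times> dirL T i j t"
  using valid_kinematics[unfolded kinematics_def] valid_mem j
  by (simp add: instant_defs) (rule ddt_eq[OF _ valid_nontrivial], simp)

lemma dir_derivative: "((\<lambda>s. dir i j (S, T, s)) has_vector_derivative ddir i j (S, T, t)) (at t within S)"
  using valid_kinematics[unfolded kinematics_def] valid_mem j
  unfolding ddir_eq by (simp add: instant_defs)

lemma ddir_derivative: "((\<lambda>s. ddir i j (S, T, s)) has_vector_derivative dddir i j (S, T, t)) (at t within S)"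
  using valid_regular[unfolded regular_trajectory_def] valid_mem j
  by (simp add: instant_defs ddt_works)

lemma dir_unit: "norm (dir i j (S, T, t)) = 1"
  and angvL_orthogonal: "angvL T i j t \<bullet> dirL T i j t = 0"
  using valid_kinematics[unfolded kinematics_def] valid_mem j by (simp_all add: instant_defs)

lemma dir_ddir: "dir i j (S, T, t) \<bullet> ddir i j (S, T, t) = 0"
  unfolding ddir_eq by (simp add: instant_defs dot_cross_self)

lemma norm_ddir: "norm (ddir i j (S, T, t)) = norm (angvL T i j t)"
proof -
  have "(norm (ddir i j (S, T, t)))\<^sup>2 = (norm (angvL T i j t))\<^sup>2"
    unfolding ddir_eq norm_cross using dir_unit angvL_orthogonal by (simp add: instant_defs)
  then show ?thesis by (simp add: power2_eq_iff_nonneg)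
qed

end

lemma dir_dddir:
  assumes j: "j \<in> links P i"
  shows "dir i j (S, T, t) \<bullet> dddir i j (S, T, t) = - (ddir i j (S, T, t) \<bullet> ddir i j (S, T, t))"
proof -
  have 1: "((\<lambda>s. dir i j (S, T, s) \<bullet> ddir i j (S, T, s)) has_vector_derivative
    (dir i j (S, T, t) \<bullet> dddir i j (S, T, t) + ddir i j (S, T, t) \<bullet> ddir i j (S, T, t))) (at t within S)"
    by (rule bounded_bilinear.has_vector_derivative[OF bounded_bilinear_inner dir_derivative[OF j] ddir_derivative[OF j]])
  have 2: "((\<lambda>s. dir i j (S, T, s) \<bullet> ddir i j (S, T, s)) has_vector_derivative 0) (at t within S)"
    by (rule has_vector_derivative_transform[OF valid_mem _ has_vector_derivative_const])
      (rule tracking.dir_ddir[OF tracking_axioms valid_shift j])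
  have "dir i j (S, T, t) \<bullet> dddir i j (S, T, t) + ddir i j (S, T, t) \<bullet> ddir i j (S, T, t) = 0"
    by (rule vector_derivative_unique_within[OF valid_nontrivial 1 2])
  then show ?thesis by simp
qed

lemma x_derivative:
  assumes "s \<in> coords P"
  shows "((\<lambda>\<tau>. x (S, T, \<tau>) s) has_real_derivative v (S, T, t) s) (at t within S)"
    and "((\<lambda>\<tau>. v (S, T, \<tau>) s) has_real_derivative a (S, T, t) s) (at t within S)"
proof -
  note nth = bounded_linear.has_vector_derivative[OF bounded_linear_vec_nth]
  note skew = bounded_linear.has_vector_derivative[OF bounded_linear_skew_part]
  note pl = bounded_linear.has_vector_derivative[OF bounded_linear_planar]
  note hatd = bounded_linear.has_vector_derivative[OF bounded_linear_hat om0_derivative]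
  have R2: "((\<lambda>\<tau>. rot0 (S, T, \<tau>) ** hat (om0 (S, T, \<tau>))) has_vector_derivative
     rot0 (S, T, t) ** hat (dom0 (S, T, t)) + rot0 (S, T, t) ** hat (om0 (S, T, t)) ** hat (om0 (S, T, t))) (at t within S)"
    by (rule bounded_bilinear.has_vector_derivative[OF bounded_bilinear_matrix_matrix_mult rot0_derivative hatd])
  show "((\<lambda>\<tau>. x (S, T, \<tau>) s) has_real_derivative v (S, T, t) s) (at t within S)"
    unfolding has_real_derivative_iff_has_vector_derivative
  proof (cases s)
    case (Pos b) then show "((\<lambda>\<tau>. x (S, T, \<tau>) s) has_vector_derivative v (S, T, t) s) (at t within S)"
      using nth[OF pos0_derivative] by (simp add: x_def v_def)
  next
    case (Att b) then show "((\<lambda>\<tau>. x (S, T, \<tau>) s) has_vector_derivative v (S, T, t) s) (at t within S)"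
      using nth[OF skew[OF rot0_derivative]] by (simp add: x_def v_def)
  next
    case (Link i j b)
    then have "j \<in> links P i" using assms by (auto simp: coords_def)
    from nth[OF pl[OF dir_derivative[OF this]]]
    show "((\<lambda>\<tau>. x (S, T, \<tau>) s) has_vector_derivative v (S, T, t) s) (at t within S)"
      using Link by (simp add: x_def v_def)
  qed
  show "((\<lambda>\<tau>. v (S, T, \<tau>) s) has_real_derivative a (S, T, t) s) (at t within S)"
    unfolding has_real_derivative_iff_has_vector_derivative
  proof (cases s)
    case (Pos b) then show "((\<lambda>\<tau>. v (S, T, \<tau>) s) has_vector_derivative a (S, T, t) s) (at t within S)"
      using nth[OF vel0_derivative] by (simp add: a_def v_def)
  next
    case (Att b) then show "((\<lambda>\<tau>. v (S, T, \<tau>) s) has_vector_derivative a (S, T, t) s) (at t within S)"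
      using nth[OF skew[OF R2]] by (simp add: a_def v_def add.commute)
  next
    case (Link i j b)
    then have "j \<in> links P i" using assms by (auto simp: coords_def)
    from nth[OF pl[OF ddir_derivative[OF this]]]
    show "((\<lambda>\<tau>. v (S, T, \<tau>) s) has_vector_derivative a (S, T, t) s) (at t within S)"
      using Link by (simp add: a_def v_def)
  qed
qed

lemma state_x: "state (pos_cmd c) T t = x (S, T, t)"
proof
  fix s show "state (pos_cmd c) T t s = x (S, T, t) s"
    by (cases s) (simp_all add: x_def err0_def instant_defs eR0_def skew_part_def planar_def)
qed

end

text \<open>The controller differentiates \<open>state\<close> label by label. Explicit velocities
  are available for the labels of existing links, and only these enter the feedback.\<close>

lemma state_dot_v:
  assumes val: "(S, T, t) \<in> valid" and s: "s \<in> coords P"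
  shows "state_dot S (pos_cmd c) T t s = v (S, T, t) s"
proof -
  have "((\<lambda>\<tau>. state (pos_cmd c) T \<tau> s) has_vector_derivative v (S, T, t) s) (at t within S)"
    using x_derivative(1)[OF val s] unfolding has_real_derivative_iff_has_vector_derivative
    by (rule has_vector_derivative_transform[OF valid_mem[OF val], rotated])
      (simp add: state_x[OF valid_shift[OF val]])
  then show ?thesis unfolding state_dot_def by (rule ddt_eq[OF _ valid_nontrivial[OF val]])
qed

lemma ctrl_force_cmd:
  assumes val: "(S, T, t) \<in> valid"
  shows "ctrl_force P c S T i t = cmd i (S, T, t)"
proof -
  have "mat_app (coords P) (Kvel c i) (state_dot S (pos_cmd c) T t) b = mat_app (coords P) (Kvel c i) (v (S, T, t)) b" for b
    unfolding mat_app_def by (intro sum.cong refl) (simp add: state_dot_v[OF val])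
  then show ?thesis
    unfolding ctrl_force_def force_def cmd_def state_x[OF val]
    by (simp add: inputv_def lin_input_def stacked_def mat_app_def vec_eq_iff)
qed

definition configs :: "'n instant set" where "configs = {\<sigma> \<in> valid. dev \<sigma> \<le> 1}"

sublocale conf: configurations P "Kpos c" "Kvel c" configs err0 vel0 rot0 om0 dir ddir x v dev
  by unfold_locales (auto simp: configs_def x_def[abs_def] v_def[abs_def] dev_def[abs_def])

text \<open>\<open>attitude_of\<close> degenerates when the commanded force vanishes or is parallel
  to the heading; these are the instants at which the command is a genuine attitude.\<close>

definition posed :: "'n instant set" where
  "posed = {\<sigma> \<in> configs. \<forall>i. rotation_matrix (Rcmd i \<sigma>) \<and> Rcmd i \<sigma> *v e3 = thrust_dir (cmd i \<sigma>)}"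

text \<open>The force \<open>- f R e3\<close> produced by the thrust
  \<open>f = - A . R e3\<close>.\<close>

definition frc :: "'n \<Rightarrow> 'n instant \<Rightarrow> real^3" where
  "frc i \<sigma> = (cmd i \<sigma> \<bullet> (RQ i \<sigma> *v e3)) *\<^sub>R (RQ i \<sigma> *v e3)"

lemma thrust_frc:
  "(S, T, t) \<in> valid \<Longrightarrow> thrust_input P c S T t i *\<^sub>R (attQ T i t *v e3) = - frc i (S, T, t)"
  by (simp add: thrust_input_def frc_def ctrl_force_cmd RQ_def)

lemma RQ_rotation: "(S, T, t) \<in> valid \<Longrightarrow> rotation_matrix (RQ i (S, T, t))"
  using valid_kinematics[of S T t] valid_mem[of S T t] by (simp add: kinematics_def RQ_def)

lemma err_nonneg: "err \<sigma> \<ge> 0"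
  by (simp add: err_def sum_nonneg)

lemma norm_Qerr_le_err: "norm (Qerr i \<sigma> - mat 1) \<le> err \<sigma>"
  unfolding err_def by (intro member_le_sum[where f = "\<lambda>i. norm (Qerr i \<sigma> - mat 1)"]) auto

text \<open>The payload and link equations hold with the applied forces \<open>frc\<close>, the
  differentiated unit length constraints give the identities for the links, and the projection
  estimate bounds the force errors.\<close>

sublocale sn: snapshots P "Kpos c" "Kvel c" posed err0 vel0 rot0 om0 dir ddir x v dev
  acc0 dom0 dddir frc "\<lambda>i \<sigma>. frc i \<sigma> - cmd i \<sigma>" err a acc
proof unfold_locales
  fix \<sigma> :: "'n instant" and i j
  assume "\<sigma> \<in> posed"
  then have pos: "\<And>i. rotation_matrix (Rcmd i \<sigma>)" "\<And>i. Rcmd i \<sigma> *v e3 = thrust_dir (cmd i \<sigma>)"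
    and "\<sigma> \<in> configs" by (auto simp: posed_def)
  obtain S T t where \<sigma>: "\<sigma> = (S, T, t)" by (cases \<sigma>)
  have val: "(S, T, t) \<in> valid" using \<open>\<sigma> \<in> configs\<close> by (simp add: \<sigma> configs_def)
  show "dev \<sigma> \<le> 1" using \<open>\<sigma> \<in> configs\<close> by (simp add: configs_def)
  show "orthogonal_matrix (rot0 \<sigma>)" using rot0_rotation[OF val] by (simp add: \<sigma> rotation_matrix_def)
  have eqs: "payload_translation P S T (thrust_input P c S T t) t" "payload_rotation P S T (thrust_input P c S T t) t"
    "j \<in> links P i \<Longrightarrow> link_dynamics P S T (thrust_input P c S T t) t i j"
    using valid_motion[OF val] valid_mem[OF val] by (simp_all add: closed_loop_def full_model_def)
  show "MT P *\<^sub>R acc0 \<sigma>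
      - (\<Sum>i\<in>UNIV. \<Sum>j\<in>links P i. (M0 P i j * llink P i j) *\<^sub>R dddir i j \<sigma>)
      - (\<Sum>i\<in>UNIV. MiT P i *\<^sub>R (rot0 \<sigma> *v (rho P i \<times> dom0 \<sigma>)))
      = (MT P * grav P) *\<^sub>R e3 + (\<Sum>i\<in>UNIV. frc i \<sigma>)
      - (\<Sum>i\<in>UNIV. MiT P i *\<^sub>R (rot0 \<sigma> *v (om0 \<sigma> \<times> (om0 \<sigma> \<times> rho P i))))"
    using eqs(1) unfolding payload_translation_def thrust_frc[OF val]
    by (simp add: \<sigma> instant_defs mat_vec_simps sum_negf)
  show "Jbar P *v dom0 \<sigma>
      + (\<Sum>i\<in>UNIV. MiT P i *\<^sub>R (rho P i \<times> (transpose (rot0 \<sigma>) *v acc0 \<sigma>)))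
      - (\<Sum>i\<in>UNIV. \<Sum>j\<in>links P i. (M0 P i j * llink P i j) *\<^sub>R (rho P i \<times> (transpose (rot0 \<sigma>) *v dddir i j \<sigma>)))
      = (\<Sum>i\<in>UNIV. rho P i \<times> (transpose (rot0 \<sigma>) *v (frc i \<sigma> + (MiT P i * grav P) *\<^sub>R e3)))
      - om0 \<sigma> \<times> (Jbar P *v om0 \<sigma>)"
    using eqs(2) unfolding payload_rotation_def thrust_frc[OF val]
    by (simp add: \<sigma> instant_defs mat_vec_simps)
  show "norm (frc i \<sigma> - cmd i \<sigma>) \<le> 2 * norm (u_star P i + inputv (lin_input P (Kpos c) (Kvel c) (x \<sigma>) (v \<sigma>)) i) * err \<sigma>"
  proof -
    have "norm (frc i \<sigma> - cmd i \<sigma>) \<le> 2 * norm (cmd i \<sigma>) * norm (Qerr i \<sigma> - mat 1)"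
      unfolding frc_def Qerr_def using RQ_rotation[OF val] pos
      by (intro projected_force_error) (auto simp: \<sigma>)
    also have "\<dots> \<le> 2 * norm (cmd i \<sigma>) * err \<sigma>" by (intro mult_left_mono norm_Qerr_le_err) simp
    finally show ?thesis by (simp add: cmd_def)
  qed
  show "frc i \<sigma> = u_star P i + inputv (lin_input P (Kpos c) (Kvel c) (x \<sigma>) (v \<sigma>)) i + (frc i \<sigma> - cmd i \<sigma>)"
    by (simp add: cmd_def)
  assume j: "j \<in> links P i"
  show "norm (dir i j \<sigma>) = 1" "dir i j \<sigma> \<bullet> ddir i j \<sigma> = 0"
    "dir i j \<sigma> \<bullet> dddir i j \<sigma> = - (ddir i j \<sigma> \<bullet> ddir i j \<sigma>)"
    unfolding \<sigma> by (rule dir_unit[OF val j] dir_ddir[OF val j] dir_dddir[OF val j])+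
  show "(\<Sum>k\<in>links P i. (M0 P i (min j k) * llink P i k) *\<^sub>R (dir i j \<sigma> \<times> (dir i j \<sigma> \<times> dddir i k \<sigma>)))
      - M0 P i j *\<^sub>R (dir i j \<sigma> \<times> (dir i j \<sigma> \<times> acc0 \<sigma>))
      + M0 P i j *\<^sub>R (dir i j \<sigma> \<times> (dir i j \<sigma> \<times> (rot0 \<sigma> *v (rho P i \<times> dom0 \<sigma>))))
      = M0 P i j *\<^sub>R (dir i j \<sigma> \<times> (dir i j \<sigma> \<times> (rot0 \<sigma> *v (om0 \<sigma> \<times> (om0 \<sigma> \<times> rho P i)))))
      - dir i j \<sigma> \<times> (dir i j \<sigma> \<times> ((M0 P i j * grav P) *\<^sub>R e3 + frc i \<sigma>))"
    using eqs(3)[OF j] unfolding link_dynamics_def thrust_frc[OF val] Let_def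
    by (simp add: \<sigma> instant_defs mat_vec_simps)
qed (auto simp: equilibrium err_nonneg a_def[abs_def] acc_def[abs_def] x_def[abs_def] v_def[abs_def] dev_def[abs_def])

end

context tracking begin

section \<open>The commanded force near the equilibrium and the energy of the payload\<close>

definition weight :: "'n \<Rightarrow> real" where
  "weight i = (MiT P i + mass0 P / real CARD('n)) * grav P"

lemma weight_pos: "weight i > 0"
proof -
  have "MiT P i > 0"
    using plant unfolding admissible_plant_def MiT_def
    by (meson add_pos_nonneg less_imp_le sum_nonneg)
  then show ?thesis
    using plant by (auto simp: weight_def admissible_plant_def intro!: mult_pos_pos add_pos_pos divide_pos_pos)
qed

lemma u_star_weight: "u_star P i = - (weight i *\<^sub>R e3)"
  by (simp add: u_star_def weight_def)

lemma thrust_dir_u_star: "thrust_dir (u_star P i) = e3"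
  using weight_pos[of i] by (simp add: thrust_dir_def u_star_weight)

definition hsep :: real where
  "hsep = (SOME \<epsilon>. \<epsilon> > 0 \<and> (\<forall>i. \<forall>t\<ge>0. \<epsilon> \<le> norm (e3 \<times> heading c i t)))"

lemma hsep: "hsep > 0" "t \<ge> 0 \<Longrightarrow> hsep \<le> norm (e3 \<times> heading c i t)"
proof -
  have "\<exists>\<epsilon>. \<epsilon> > 0 \<and> (\<forall>i. \<forall>t\<ge>0. \<epsilon> \<le> norm (e3 \<times> heading c i t))"
    using heading_not_parallel unfolding thrust_dir_equilibrium[OF plant] by blast
  from someI_ex[OF this] show "hsep > 0" "t \<ge> 0 \<Longrightarrow> hsep \<le> norm (e3 \<times> heading c i t)"
    unfolding hsep_def by blast+
qed

text \<open>Half of the margins present at the equilibrium. They keep the commanded force away from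
  0 and its direction away from the heading, as the Lipschitz estimate for the commanded attitude
  requires.\<close>

definition regular_cmd :: "'n \<Rightarrow> 'n instant \<Rightarrow> bool" where
  "regular_cmd i \<sigma> \<longleftrightarrow> weight i / 2 \<le> norm (cmd i \<sigma>) \<and>
     hsep / 2 \<le> norm (thrust_dir (cmd i \<sigma>) \<times> heading c i (snd (snd \<sigma>)))"

lemma regular_cmd_posed:
  assumes \<sigma>: "\<sigma> \<in> configs" and reg: "\<And>i. regular_cmd i \<sigma>"
  shows "\<sigma> \<in> posed"
proof -
  obtain S T t where S: "\<sigma> = (S, T, t)" by (cases \<sigma>)
  have val: "(S, T, t) \<in> valid" using \<sigma> by (simp add: S configs_def)
  have "rotation_matrix (Rcmd i \<sigma>) \<and> Rcmd i \<sigma> *v e3 = thrust_dir (cmd i \<sigma>)" for i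
  proof -
    have R: "Rcmd i \<sigma> = attitude_of (thrust_dir (cmd i \<sigma>)) (heading c i t)"
      by (simp add: S Rcmd_def Rc_def ctrl_force_cmd[OF val])
    have "cmd i \<sigma> \<noteq> 0" using reg[of i] weight_pos[of i] by (auto simp: regular_cmd_def)
    moreover have "thrust_dir (cmd i \<sigma>) \<times> heading c i t \<noteq> 0"
      using reg[of i] hsep(1) by (auto simp: regular_cmd_def S)
    ultimately show ?thesis
      unfolding R using attitude_of_rotation[OF norm_thrust_dir] by blast
  qed
  then show ?thesis using \<sigma> by (simp add: posed_def)
qed

lemma cmd_near: "\<forall>\<^sub>F e in at_right 0. \<forall>i. \<forall>\<sigma>\<in>configs. dev \<sigma> \<le> e \<longrightarrow> regular_cmd i \<sigma>"
proof -
  have "\<forall>\<^sub>F e in at_right 0. \<forall>\<sigma>\<in>configs. dev \<sigma> \<le> e \<longrightarrow> regular_cmd i \<sigma>" for i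
  proof -
    obtain k where k: "k > 0" "\<And>\<sigma>. \<sigma> \<in> configs \<Longrightarrow> norm (cmd i \<sigma> - u_star P i) \<le> k * dev \<sigma>"
      using bigOE[OF conf.dF_dev[of i] conf.dev_nonneg] by (auto simp: cmd_def)
    \<comment> \<open>The first entry keeps the force above half of its nominal size. The second, by
      the Lipschitz constant \<open>2 / weight i\<close> of \<open>thrust_dir\<close>, moves the
      thrust direction by at most \<open>hsep / 2\<close>.\<close>
    define \<eta> where "\<eta> = min (weight i / 2) (hsep * weight i / 4)"
    have \<eta>: "\<eta> > 0" using weight_pos[of i] hsep by (simp add: \<eta>_def)
    have "regular_cmd i \<sigma>" if e: "e \<in> {0<..<\<eta> / k}" and \<sigma>: "\<sigma> \<in> configs" "dev \<sigma> \<le> e" for e \<sigma>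
    proof -
      have "k * dev \<sigma> \<le> k * (\<eta> / k)" using e \<sigma> k by (intro mult_left_mono) auto
      then have d: "norm (u_star P i - cmd i \<sigma>) \<le> \<eta>"
        using k(2)[OF \<sigma>(1)] k(1) by (simp add: norm_minus_commute)
      have nu: "norm (u_star P i) = weight i" using weight_pos[of i] by (simp add: u_star_weight)
      have "norm (u_star P i) \<le> norm (cmd i \<sigma>) + norm (u_star P i - cmd i \<sigma>)"
        by (rule norm_triangle_sub)
      then have 1: "weight i / 2 \<le> norm (cmd i \<sigma>)"
        using d unfolding nu \<eta>_def by simp
      then have nz: "cmd i \<sigma> \<noteq> 0" using weight_pos[of i] by auto
      have "norm (e3 - thrust_dir (cmd i \<sigma>)) \<le> 2 / weight i * norm (u_star P i - cmd i \<sigma>)"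
        using thrust_dir_lipschitz[of "weight i" "u_star P i" "cmd i \<sigma>"] weight_pos[of i] nz
        by (simp add: nu thrust_dir_u_star)
      also have "\<dots> \<le> 2 / weight i * (hsep * weight i / 4)"
        using d weight_pos[of i] by (intro mult_left_mono) (auto simp: \<eta>_def)
      finally have b: "norm (e3 - thrust_dir (cmd i \<sigma>)) \<le> hsep / 2"
        using weight_pos[of i] by simp
      obtain S T t where S: "\<sigma> = (S, T, t)" by (cases \<sigma>)
      have val: "(S, T, t) \<in> valid" using \<sigma> by (simp add: S configs_def)
      let ?h = "heading c i t"
      have h: "norm ?h = 1" "hsep \<le> norm (e3 \<times> ?h)"
        using valid_nonneg[OF val] heading_unit hsep by auto
      have "e3 \<times> ?h = thrust_dir (cmd i \<sigma>) \<times> ?h + (e3 - thrust_dir (cmd i \<sigma>)) \<times> ?h"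
        by (simp add: bounded_bilinear.diff_left[OF bounded_bilinear_cross])
      then have "norm (e3 \<times> ?h) \<le> norm (thrust_dir (cmd i \<sigma>) \<times> ?h) + norm ((e3 - thrust_dir (cmd i \<sigma>)) \<times> ?h)"
        by (metis norm_triangle_ineq)
      moreover have "norm ((e3 - thrust_dir (cmd i \<sigma>)) \<times> ?h) \<le> hsep / 2"
        using norm_cross_le[of "e3 - thrust_dir (cmd i \<sigma>)" ?h] h(1) b by simp
      ultimately show ?thesis using 1 h(2) by (simp add: regular_cmd_def S)
    qed
    moreover have "0 < \<eta> / k" using \<eta> k by simp
    ultimately show ?thesis by (intro eventually_at_rightI[of 0 "\<eta> / k"]) blast+
  qed
  then show ?thesis by (simp add: eventually_all_finite)
qed

text \<open>The feedback is linear, so the derivative of the commanded force is the same linear map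
  at \<open>v\<close> and \<open>a\<close>.\<close>

definition dcmd :: "'n \<Rightarrow> 'n instant \<Rightarrow> real^3" where
  "dcmd i \<sigma> = inputv (lin_input P (Kpos c) (Kvel c) (v \<sigma>) (a \<sigma>)) i"

definition payload_energy :: "('n coord + 'n coord \<Rightarrow> 'n coord + 'n coord \<Rightarrow> real) \<Rightarrow> 'n instant \<Rightarrow> real" where
  "payload_energy H \<sigma> = bilin (phase_coords P) H (case_sum (x \<sigma>) (v \<sigma>)) (case_sum (x \<sigma>) (v \<sigma>))"

text \<open>An input-to-state estimate: the attitude errors of the quadrotors act as a disturbance
  of the linear closed loop. The bound on \<open>dcmd\<close> appears here as well because it rests
  on the same bound for the accelerations.\<close>

lemma payload_lyapunov:
  obtains H p q K e B where "p > 0" "q > 0" "K > 0" "e > 0"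
    and "\<And>\<sigma>. \<sigma> \<in> valid \<Longrightarrow> dev \<sigma> \<le> e \<Longrightarrow> \<sigma> \<in> posed \<and> (\<forall>i. regular_cmd i \<sigma>)"
    and "\<And>\<sigma>. \<sigma> \<in> valid \<Longrightarrow> dev \<sigma> \<le> e \<Longrightarrow> p * (dev \<sigma>)\<^sup>2 \<le> payload_energy H \<sigma>"
    and "\<And>\<sigma>. \<sigma> \<in> valid \<Longrightarrow> dev \<sigma> \<le> e \<Longrightarrow> payload_energy H \<sigma> \<le> q * (dev \<sigma>)\<^sup>2"
    and "\<And>S T t. (S, T, t) \<in> valid \<Longrightarrow> dev (S, T, t) \<le> e \<Longrightarrow>
      \<exists>w. ((\<lambda>s. payload_energy H (S, T, s)) has_real_derivative w) (at t within S) \<and>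
        w \<le> - p * (dev (S, T, t))\<^sup>2 + K * (err (S, T, t))\<^sup>2"
    and "\<And>i \<sigma>. \<sigma> \<in> valid \<Longrightarrow> dev \<sigma> \<le> e \<Longrightarrow> err \<sigma> \<le> 1 \<Longrightarrow> norm (dcmd i \<sigma>) \<le> B i"
proof -
  let ?J = "phase_coords P"
  let ?z = "\<lambda>\<sigma>. case_sum (x \<sigma>) (v \<sigma>)"
  obtain N H p where p: "p > 0"
    and NM: "\<And>b s. s \<in> coords P \<Longrightarrow> mat_app (coords P) N (mat_app (coords P) (Mmat P) b) s = b s"
    and low: "\<And>z. p * (L2_set z ?J)\<^sup>2 \<le> bilin ?J H z z"
    and lyap: "\<And>x v. bilin ?J H (case_sum v (lin_acc P (Kpos c) (Kvel c) N x v)) (case_sum x v)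
        + bilin ?J H (case_sum x v) (case_sum v (lin_acc P (Kpos c) (Kvel c) N x v))
        = - (L2_set (case_sum x v) ?J)\<^sup>2"
    by (rule closed_loop_lyapunov_form[OF plant gains]) (rule that)
  have "\<forall>\<^sub>F e in at_right (0::real). 0 < e \<and> e < 1"
    by (rule eventually_at_rightI[of 0 1]) auto
  moreover note sn.small_deviation_estimates[of N]
  ultimately have "\<forall>\<^sub>F e in at_right 0. (\<forall>i. \<forall>\<sigma>\<in>configs. dev \<sigma> \<le> e \<longrightarrow> regular_cmd i \<sigma>) \<and>
    (bigO {\<sigma> \<in> posed. dev \<sigma> \<le> e} acc (\<lambda>\<sigma>. dev \<sigma> + err \<sigma>) \<and>
    bigO {\<sigma> \<in> posed. dev \<sigma> \<le> e} dev sn.phase \<and>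
    (\<forall>s\<in>coords P. bigO {\<sigma> \<in> posed. dev \<sigma> \<le> e}
      (\<lambda>\<sigma>. a \<sigma> s - lin_acc P (Kpos c) (Kvel c) N (x \<sigma>) (v \<sigma>) s) (\<lambda>\<sigma>. (dev \<sigma>)\<^sup>2 + err \<sigma>))) \<and>
    0 < e \<and> e < 1"
    by (intro eventually_conj[OF cmd_near eventually_conj]) (use NM in auto)
  from eventually_happens'[OF _ this] obtain e0 where
    e0: "\<And>i \<sigma>. \<sigma> \<in> configs \<Longrightarrow> dev \<sigma> \<le> e0 \<Longrightarrow> regular_cmd i \<sigma>"
    and acc: "bigO {\<sigma> \<in> posed. dev \<sigma> \<le> e0} acc (\<lambda>\<sigma>. dev \<sigma> + err \<sigma>)"
    and dev: "bigO {\<sigma> \<in> posed. dev \<sigma> \<le> e0} dev sn.phase"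
    and rO: "\<And>s. s \<in> coords P \<Longrightarrow> bigO {\<sigma> \<in> posed. dev \<sigma> \<le> e0}
      (\<lambda>\<sigma>. a \<sigma> s - lin_acc P (Kpos c) (Kvel c) N (x \<sigma>) (v \<sigma>) s) (\<lambda>\<sigma>. (dev \<sigma>)\<^sup>2 + err \<sigma>)"
    and e01: "0 < e0" "e0 < 1"
    by (auto simp: trivial_limit_at_right_real)
  let ?D = "{\<sigma> \<in> posed. dev \<sigma> \<le> e0}"
  define r where "r \<sigma> s = a \<sigma> s - lin_acc P (Kpos c) (Kvel c) N (x \<sigma>) (v \<sigma>) s" for \<sigma> s
  have D: "\<sigma> \<in> ?D" if "\<sigma> \<in> valid" "dev \<sigma> \<le> e0" for \<sigma>
  proof -
    have "\<sigma> \<in> configs" using that e01 by (simp add: configs_def)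
    then show ?thesis using e0 that regular_cmd_posed by simp
  qed
  \<comment> \<open>\<open>c1\<close> and \<open>c3\<close> compare deviation and phase norm, and
    \<open>c2\<close> bounds the distance from the linear accelerations.\<close>
  obtain c1 where c1: "c1 > 0" "\<And>\<sigma>. \<sigma> \<in> ?D \<Longrightarrow> dev \<sigma> \<le> c1 * sn.phase \<sigma>"
    using bigOE[OF dev sn.phase_nonneg] conf.dev_nonneg by (auto simp: abs_of_nonneg)
  have "bigO ?D (\<lambda>\<sigma>. \<Sum>s\<in>coords P. \<bar>r \<sigma> s\<bar>) (\<lambda>\<sigma>. (dev \<sigma>)\<^sup>2 + err \<sigma>)"
    using rO unfolding r_def by (intro bigO_sum) (auto simp: bigO_def)
  then obtain c2 where c2: "c2 > 0" "\<And>\<sigma>. \<sigma> \<in> ?D \<Longrightarrow> (\<Sum>s\<in>coords P. \<bar>r \<sigma> s\<bar>) \<le> c2 * ((dev \<sigma>)\<^sup>2 + err \<sigma>)"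
    using bigOE[of ?D "\<lambda>\<sigma>. \<Sum>s\<in>coords P. \<bar>r \<sigma> s\<bar>" "\<lambda>\<sigma>. (dev \<sigma>)\<^sup>2 + err \<sigma>"] err_nonneg
    by (auto simp: sum_nonneg)
  have "bigO ?D sn.phase dev" by (rule bigO_subset[OF sn.phase_dev]) auto
  then obtain c3 where c3: "c3 > 0" "\<And>\<sigma>. \<sigma> \<in> ?D \<Longrightarrow> sn.phase \<sigma> \<le> c3 * dev \<sigma>"
    using bigOE[of ?D sn.phase dev] conf.dev_nonneg sn.phase_nonneg by (auto simp: abs_of_nonneg)
  define h where "h = (\<Sum>c\<in>?J. \<Sum>d\<in>?J. \<bar>H c d\<bar>) + 1"
  have h: "h > 0" unfolding h_def by (intro add_nonneg_pos sum_nonneg) auto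
  have bb: "\<bar>bilin ?J H y z\<bar> \<le> h * L2_set y ?J * L2_set z ?J" for y z
    by (rule order_trans[OF bilin_bound[OF finite_phase_coords]])
      (auto simp: h_def L2_set_nonneg distrib_right intro!: mult_nonneg_nonneg)
  \<comment> \<open>The constant left by Young's inequality when the disturbance is paid for with a
    quarter of the squared phase norm.\<close>
  define K where "K = (2 * h * c2)\<^sup>2"
  \<comment> \<open>Small enough for the quadratic remainder to cost at most another quarter of the
    squared phase norm.\<close>
  define e where "e = min e0 (1 / (8 * h * c2 * c1))"
  have e: "e > 0" "e \<le> e0" using h c1 c2 e01 by (auto simp: e_def)
  have small: "2 * h * c2 * (e * c1) \<le> 1 / 4"
  proof -
    have "2 * h * c2 * (e * c1) \<le> 2 * h * c2 * (1 / (8 * h * c2 * c1) * c1)"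
      using h c1 c2 by (intro mult_left_mono mult_right_mono) (auto simp: e_def)
    then show ?thesis using h c1 c2 by simp
  qed
  have B: "\<exists>B. \<forall>\<sigma>. \<sigma> \<in> valid \<longrightarrow> dev \<sigma> \<le> e0 \<longrightarrow> err \<sigma> \<le> 1 \<longrightarrow> norm (dcmd i \<sigma>) \<le> B" for i
  proof -
    let ?D' = "{\<sigma> \<in> ?D. err \<sigma> \<le> 1}"
    have dev1: "bigO ?D' dev (\<lambda>_. 1)"
      using e01 by (intro bigOI1) (auto simp: conf.dev_nonneg)
    have err1: "bigO ?D' err (\<lambda>_. 1)"
      by (intro bigOI1) (auto simp: err_nonneg)
    have "bigO ?D' acc (\<lambda>\<sigma>. dev \<sigma> + err \<sigma>)" by (rule bigO_subset[OF acc]) auto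
    then have acc1: "bigO ?D' acc (\<lambda>_. 1)" by (rule bigO_trans[OF _ bigO_add[OF dev1 err1]])
    have "bigO ?D' sn.G (\<lambda>_. 1)"
      unfolding sn.G_def[abs_def]
      using bigO_add[OF bigO_mult[OF dev1 bigO_add[OF dev1 acc1], unfolded mult_1] err1] .
    then have dG: "bigO ?D' (\<lambda>\<sigma>. dev \<sigma> + sn.G \<sigma>) (\<lambda>_. 1)" by (rule bigO_add[OF dev1])
    have a1: "bigO ?D' (\<lambda>\<sigma>. a \<sigma> s) (\<lambda>_. 1)" if "s \<in> coords P" for s
      by (rule bigO_trans[OF bigO_subset[OF sn.coordinate_acceleration(2)[of N]] dG]) (use NM that in auto)
    have v1: "bigO ?D' (\<lambda>\<sigma>. v \<sigma> s) (\<lambda>_. 1)" if "s \<in> coords P" for s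
      by (rule bigO_trans[OF bigO_subset[OF sn.v_dev[OF that]] dev1]) auto
    have "bigO ?D' (\<lambda>\<sigma>. dcmd i \<sigma> $ b) (\<lambda>_. 1)" for b
      unfolding dcmd_def inputv_def lin_input_def
      by (simp only: vec_lambda_beta) (intro bigO_diff bigO_minus bigO_mat_app a1 v1)
    then have "bigO ?D' (dcmd i) (\<lambda>_. 1)" by (rule bigO_vec)
    then obtain B where "\<And>\<sigma>. \<sigma> \<in> ?D' \<Longrightarrow> norm (dcmd i \<sigma>) \<le> B" unfolding bigO_def by auto
    then show ?thesis using D by (intro exI[of _ B]) auto
  qed
  then obtain B where B: "\<And>i \<sigma>. \<sigma> \<in> valid \<Longrightarrow> dev \<sigma> \<le> e0 \<Longrightarrow> err \<sigma> \<le> 1 \<Longrightarrow> norm (dcmd i \<sigma>) \<le> B i"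
    by metis
  \<comment> \<open>One constant for two purposes: the first entry gives the lower bound of the
    energy, the second the decay, which retains half of the squared phase norm.\<close>
  define p' where "p' = min (p / c1\<^sup>2) (1 / (2 * c1\<^sup>2))"
  have p': "p' > 0" using p c1 by (simp add: p'_def)
  have ph: "(dev \<sigma>)\<^sup>2 \<le> c1\<^sup>2 * (sn.phase \<sigma>)\<^sup>2" if "\<sigma> \<in> ?D" for \<sigma>
    using power_mono[OF c1(2)[OF that] conf.dev_nonneg, of 2] by (simp add: power_mult_distrib)
  have phase: "L2_set (?z \<sigma>) ?J = sn.phase \<sigma>" for \<sigma> by (simp add: sn.phase_def)
  show ?thesis
  proof (rule that[of p' "h * c3\<^sup>2" K e H B])
    show "p' > 0" "h * c3\<^sup>2 > 0" "K > 0" "e > 0"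
      using p' h c3 c2 e by (auto simp: K_def)
    show "\<sigma> \<in> posed \<and> (\<forall>i. regular_cmd i \<sigma>)" if "\<sigma> \<in> valid" "dev \<sigma> \<le> e" for \<sigma>
      using D[of \<sigma>] that e e0[of \<sigma>] by (auto simp: posed_def)
    show "norm (dcmd i \<sigma>) \<le> B i" if "\<sigma> \<in> valid" "dev \<sigma> \<le> e" "err \<sigma> \<le> 1" for i \<sigma>
      using B that e by simp
    show "p' * (dev \<sigma>)\<^sup>2 \<le> payload_energy H \<sigma>" if "\<sigma> \<in> valid" "dev \<sigma> \<le> e" for \<sigma>
    proof -
      have "p' * (dev \<sigma>)\<^sup>2 \<le> p / c1\<^sup>2 * (c1\<^sup>2 * (sn.phase \<sigma>)\<^sup>2)"
        using ph[OF D] that e p by (intro mult_mono) (auto simp: p'_def)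
      also have "\<dots> = p * (L2_set (?z \<sigma>) ?J)\<^sup>2" using c1 by (simp add: phase)
      also have "\<dots> \<le> payload_energy H \<sigma>" unfolding payload_energy_def by (rule low)
      finally show ?thesis .
    qed
    show "payload_energy H \<sigma> \<le> h * c3\<^sup>2 * (dev \<sigma>)\<^sup>2" if "\<sigma> \<in> valid" "dev \<sigma> \<le> e" for \<sigma>
    proof -
      have "payload_energy H \<sigma> \<le> h * sn.phase \<sigma> * sn.phase \<sigma>"
        using bb[of "?z \<sigma>" "?z \<sigma>"] unfolding payload_energy_def phase by simp
      also have "\<dots> = h * (sn.phase \<sigma>)\<^sup>2" by (simp add: power2_eq_square)
      also have "\<dots> \<le> h * (c3 * dev \<sigma>)\<^sup>2"
        using c3(2)[OF D] that e h sn.phase_nonneg by (intro mult_left_mono power_mono) auto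
      finally show ?thesis by (simp add: power_mult_distrib)
    qed
    fix S T t assume val: "(S, T, t) \<in> valid" and de: "dev (S, T, t) \<le> e"
    let ?\<sigma> = "(S, T, t)"
    have \<sigma>: "?\<sigma> \<in> ?D" using D[OF val] de e by simp
    let ?l = "lin_acc P (Kpos c) (Kvel c) N (x ?\<sigma>) (v ?\<sigma>)"
    let ?w = "bilin ?J H (case_sum (v ?\<sigma>) (a ?\<sigma>)) (?z ?\<sigma>) + bilin ?J H (?z ?\<sigma>) (case_sum (v ?\<sigma>) (a ?\<sigma>))"
    have zd: "((\<lambda>s. ?z (S, T, s) c) has_real_derivative case_sum (v ?\<sigma>) (a ?\<sigma>) c) (at t within S)"
      if "c \<in> ?J" for c
      using that x_derivative[OF val] by (auto simp: phase_coords_def)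
    have der: "((\<lambda>s. payload_energy H (S, T, s)) has_real_derivative ?w) (at t within S)"
      unfolding payload_energy_def by (rule bilin_has_derivative[OF zd zd])
    let ?r = "case_sum (\<lambda>_. 0) (r ?\<sigma>)"
    have va: "case_sum (v ?\<sigma>) (a ?\<sigma>) = (\<lambda>c. case_sum (v ?\<sigma>) ?l c + ?r c)"
      by (rule ext) (simp add: r_def split: sum.split)
    \<comment> \<open>Along the linear vector field the Lyapunov equation applies; the rest is due
      to the residual acceleration \<open>?r\<close>, whose position part is zero.\<close>
    have w: "?w = - (sn.phase ?\<sigma>)\<^sup>2 + (bilin ?J H ?r (?z ?\<sigma>) + bilin ?J H (?z ?\<sigma>) ?r)"
      unfolding va bilin_add_left bilin_add_right using lyap[of "v ?\<sigma>" "x ?\<sigma>"] by (simp add: phase)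
    have "(L2_set ?r ?J)\<^sup>2 = (L2_set (r ?\<sigma>) (coords P))\<^sup>2"
      unfolding L2_set_phase_coords by (simp add: L2_set_0')
    then have "L2_set ?r ?J = L2_set (r ?\<sigma>) (coords P)"
      using L2_set_nonneg by (metis power2_eq_iff_nonneg)
    also have "\<dots> \<le> c2 * ((dev ?\<sigma>)\<^sup>2 + err ?\<sigma>)"
      by (rule order_trans[OF L2_set_le_sum_abs c2(2)[OF \<sigma>]])
    finally have r: "L2_set ?r ?J \<le> c2 * ((dev ?\<sigma>)\<^sup>2 + err ?\<sigma>)" .
    let ?f = "sn.phase ?\<sigma>"
    have f0: "?f \<ge> 0" by (rule sn.phase_nonneg)
    have "bilin ?J H ?r (?z ?\<sigma>) \<le> h * L2_set ?r ?J * ?f" "bilin ?J H (?z ?\<sigma>) ?r \<le> h * ?f * L2_set ?r ?J"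
      using bb[of ?r "?z ?\<sigma>"] bb[of "?z ?\<sigma>" ?r] by (simp_all add: phase)
    then have "bilin ?J H ?r (?z ?\<sigma>) + bilin ?J H (?z ?\<sigma>) ?r \<le> 2 * h * ?f * L2_set ?r ?J"
      by (simp add: mult_ac)
    also have "\<dots> \<le> 2 * h * ?f * (c2 * ((dev ?\<sigma>)\<^sup>2 + err ?\<sigma>))"
      using r h f0 by (intro mult_left_mono) auto
    also have "\<dots> = 2 * h * c2 * (dev ?\<sigma> * dev ?\<sigma>) * ?f + (2 * h * c2 * err ?\<sigma>) * ?f"
      by (simp add: power2_eq_square algebra_simps)
    also have "\<dots> \<le> 2 * h * c2 * (e * (c1 * ?f)) * ?f + (2 * h * c2 * err ?\<sigma>) * ?f"
      using h c1 c2(1) de c1(2)[OF \<sigma>] e f0 conf.dev_nonneg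
      by (intro add_right_mono mult_right_mono mult_left_mono mult_mono) auto
    also have "\<dots> = (2 * h * c2 * (e * c1)) * ?f\<^sup>2 + (2 * h * c2 * err ?\<sigma>) * ?f"
      by (simp add: power2_eq_square mult_ac)
    also have "\<dots> \<le> 1 / 4 * ?f\<^sup>2 + (1 / 4 * ?f\<^sup>2 + (2 * h * c2 * err ?\<sigma>)\<^sup>2)"
    proof (intro add_mono mult_right_mono small)
      have "0 \<le> (?f / 2 - 2 * h * c2 * err ?\<sigma>)\<^sup>2" by simp
      then show "(2 * h * c2 * err ?\<sigma>) * ?f \<le> 1 / 4 * ?f\<^sup>2 + (2 * h * c2 * err ?\<sigma>)\<^sup>2"
        by (simp add: power2_diff field_simps power_mult_distrib)
    qed simp
    finally have "?w \<le> - (1 / 2) * ?f\<^sup>2 + K * (err ?\<sigma>)\<^sup>2"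
      unfolding w by (simp add: K_def power_mult_distrib)
    moreover have "p' * (dev ?\<sigma>)\<^sup>2 \<le> 1 / (2 * c1\<^sup>2) * (c1\<^sup>2 * ?f\<^sup>2)"
      using ph[OF \<sigma>] by (intro mult_mono) (auto simp: p'_def)
    then have "p' * (dev ?\<sigma>)\<^sup>2 \<le> (1 / 2) * ?f\<^sup>2" using c1 by simp
    ultimately have "?w \<le> - p' * (dev ?\<sigma>)\<^sup>2 + K * (err ?\<sigma>)\<^sup>2" by simp
    with der show "\<exists>w. ((\<lambda>s. payload_energy H (S, T, s)) has_real_derivative w) (at t within S) \<and>
        w \<le> - p' * (dev ?\<sigma>)\<^sup>2 + K * (err ?\<sigma>)\<^sup>2" by blast
  qed
qed

end

section \<open>Commanded angular velocities and attitude error dynamics\<close>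

lemma norm_vee_le: "norm (vee A) \<le> norm A"
proof (rule power2_le_imp_le)
  show "(norm (vee A))\<^sup>2 \<le> (norm A)\<^sup>2"
    unfolding norm_vector_3_sq norm_matrix_sq by (simp add: vee_def sum_3)
qed simp

context tracking begin

definition regular_at :: "'n instant \<Rightarrow> bool" where
  "regular_at \<sigma> \<longleftrightarrow> \<sigma> \<in> posed \<and> (\<forall>i. regular_cmd i \<sigma>)"

lemma dev_continuous:
  assumes val: "(S, T, t) \<in> valid"
  shows "continuous (at t within S) (\<lambda>s. dev (S, T, s))"
  unfolding dev_def
  by (intro continuous_intros has_vector_derivative_continuous[OF pos0_derivative[OF val]]
      has_vector_derivative_continuous[OF vel0_derivative[OF val]]
      has_vector_derivative_continuous[OF rot0_derivative[OF val]]
      has_vector_derivative_continuous[OF om0_derivative[OF val]]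
      has_vector_derivative_continuous[OF dir_derivative[OF val]]
      has_vector_derivative_continuous[OF ddir_derivative[OF val]]) auto

text \<open>A strict bound on the deviation persists nearby by continuity. This provides the
  neighbourhood on which the commanded attitude is a rotation, so that it can be differentiated as
  one.\<close>

lemma eventually_regular:
  assumes val: "(S, T, t) \<in> valid" and small: "dev (S, T, t) < e"
    and reg: "\<And>\<sigma>. \<sigma> \<in> valid \<Longrightarrow> dev \<sigma> \<le> e \<Longrightarrow> regular_at \<sigma>"
  shows "\<forall>\<^sub>F s in at t within S. regular_at (S, T, s)"
proof -
  have "\<forall>\<^sub>F s in at t within S. dev (S, T, s) < e"
    using dev_continuous[OF val] small unfolding continuous_within by (rule order_tendstoD(2))
  moreover have "\<forall>\<^sub>F s in at t within S. s \<in> S" by (simp add: eventually_at_filter)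
  ultimately show ?thesis
    by eventually_elim (use valid_shift[OF val] reg in force)
qed

lemma cmd_derivative:
  assumes val: "(S, T, t) \<in> valid"
  shows "((\<lambda>s. cmd i (S, T, s)) has_vector_derivative dcmd i (S, T, t)) (at t within S)"
proof -
  let ?f = "\<lambda>s b. lin_input P (Kpos c) (Kvel c) (x (S, T, s)) (v (S, T, s)) (i, b)"
  let ?f' = "\<lambda>b. lin_input P (Kpos c) (Kvel c) (v (S, T, t)) (a (S, T, t)) (i, b)"
  have vec: "inputv u i = (\<Sum>b\<in>UNIV. u (i, b) *\<^sub>R axis b (1::real))" for u :: "'n \<times> 3 \<Rightarrow> real"
    by (simp add: inputv_def vec_eq_iff axis_def sum_3 forall_3)
  have "((\<lambda>s. ?f s b) has_real_derivative ?f' b) (at t within S)" for b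
    unfolding lin_input_def mat_app_def
    by (intro DERIV_diff DERIV_minus DERIV_sum DERIV_cmult x_derivative[OF val])
  then have "((\<lambda>s. ?f s b *\<^sub>R axis b (1::real)) has_vector_derivative ?f' b *\<^sub>R axis b 1) (at t within S)" for b
    unfolding has_real_derivative_iff_has_vector_derivative
    by (rule bounded_linear.has_vector_derivative[OF bounded_linear_scaleR_left])
  then have "((\<lambda>s. \<Sum>b\<in>UNIV. ?f s b *\<^sub>R axis b (1::real)) has_vector_derivative (\<Sum>b\<in>UNIV. ?f' b *\<^sub>R axis b 1)) (at t within S)"
    by (intro has_vector_derivative_sum)
  then have "((\<lambda>s. inputv (lin_input P (Kpos c) (Kvel c) (x (S, T, s)) (v (S, T, s))) i) has_vector_derivative dcmd i (S, T, t)) (at t within S)"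
    unfolding vec dcmd_def .
  from has_vector_derivative_add[OF has_vector_derivative_const this] show ?thesis
    unfolding cmd_def by simp
qed

lemma Rcmd_eq:
  "(S, T, t) \<in> valid \<Longrightarrow> Rcmd i (S, T, t) = attitude_of (thrust_dir (cmd i (S, T, t))) (heading c i t)"
  by (simp add: Rcmd_def Rc_def ctrl_force_cmd)

definition Omc :: "'n \<Rightarrow> 'n instant \<Rightarrow> real^3" where "Omc i = (\<lambda>(S, T, t). Omega_c P c S T i t)"

lemma Rcmd_derivative:
  assumes val: "(S, T, t) \<in> valid" and reg: "regular_at (S, T, t)" "\<forall>\<^sub>F s in at t within S. regular_at (S, T, s)"
  shows "((\<lambda>s. Rcmd i (S, T, s)) has_vector_derivative Rcmd i (S, T, t) ** hat (Omc i (S, T, t))) (at t within S)"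
proof -
  let ?R = "\<lambda>s. Rcmd i (S, T, s)"
  have d: "(?R has_vector_derivative ddt S (Rc P c S T i) t) (at t within S)"
    using valid_motion[OF val] valid_mem[OF val] by (simp add: Rcmd_def closed_loop_def ddt_works)
  have orth: "orthogonal_matrix (?R s)" if "regular_at (S, T, s)" for s
    using that by (auto simp: regular_at_def posed_def rotation_matrix_def)
  have "ddt S (Rc P c S T i) t = ?R t ** hat (vee (transpose (?R t) ** ddt S (Rc P c S T i) t))"
    by (rule rotation_derivative_skew[OF d valid_nontrivial[OF val] valid_mem[OF val]])
      (use reg orth in \<open>auto elim: eventually_mono\<close>)
  then show ?thesis using d by (simp add: Omc_def Omega_c_def Rcmd_def)
qed

lemma heading_derivative:
  assumes "t \<ge> 0" "S \<subseteq> {0..}"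
  shows "(heading c i has_vector_derivative ddt {0..} (heading c i) t) (at t within S)"
proof -
  have "diff_on {0..} (heading c i)"
    using heading_smooth[of i] unfolding smooth_command_def by (metis funpow_0)
  from ddt_works[OF this, of t] assms show ?thesis
    by (auto intro: has_vector_derivative_within_subset)
qed

text \<open>The commanded attitude is Lipschitz in the commanded force and the heading, and the
  derivatives of both are bounded. The resulting constant depends on the quadrotor but not on the
  motion.\<close>

lemma Omc_bounded:
  obtains Y where "Y \<ge> 0"
    "\<And>S T t. (S, T, t) \<in> valid \<Longrightarrow> regular_at (S, T, t) \<Longrightarrow> \<forall>\<^sub>F s in at t within S. regular_at (S, T, s) \<Longrightarrow>
      norm (dcmd i (S, T, t)) \<le> B \<Longrightarrow> norm (Omc i (S, T, t)) \<le> Y"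
proof -
  obtain h where h: "\<And>t. t \<ge> 0 \<Longrightarrow> norm (ddt {0..} (heading c i) t) \<le> h"
    using heading_bounded[of i] unfolding bounded_iff by auto
  obtain K where K: "K > 0" "\<And>A C. norm ((A::real^3^3) ** (C::real^3^3)) \<le> K * (norm A * norm C)"
    using bounded_bilinear_bound[OF bounded_bilinear_matrix_matrix_mult] by blast
  \<comment> \<open>\<open>L\<close> and \<open>M\<close> are the Lipschitz constants with respect
    to heading and commanded force, computed from the margins \<open>hsep / 2\<close> and
    \<open>weight i / 2\<close>.\<close>
  define L where "L = 4 / (hsep / 2) + 2"
  define M where "M = L * (2 / (weight i / 2))"
  have L: "L \<ge> 0" and M: "M \<ge> 0" using hsep(1) weight_pos[of i] by (simp_all add: L_def M_def)
  \<comment> \<open>The factor 2 bounds the norm of a rotation matrix; the absolute value makes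
    \<open>Y\<close> nonnegative whatever the sign of \<open>B\<close>.\<close>
  define Y where "Y = \<bar>K * (2 * (M * B + L * h))\<bar>"
  have "norm (Omc i (S, T, t)) \<le> Y"
    if val: "(S, T, t) \<in> valid" and reg: "regular_at (S, T, t)" "\<forall>\<^sub>F s in at t within S. regular_at (S, T, s)"
      and B: "norm (dcmd i (S, T, t)) \<le> B" for S T t
  proof -
    let ?R = "\<lambda>s. Rcmd i (S, T, s)" and ?R' = "ddt S (Rc P c S T i) t"
    have d: "(?R has_vector_derivative ?R') (at t within S)"
      using valid_motion[OF val] valid_mem[OF val] by (simp add: Rcmd_def closed_loop_def ddt_works)
    have t0: "t \<ge> 0" and S0: "S \<subseteq> {0..}"
      using valid_nonneg[OF val] valid_nonneg[OF valid_shift[OF val]] by auto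
    have lip: "norm (?R s - ?R t) \<le> M * norm (cmd i (S, T, s) - cmd i (S, T, t)) + L * norm (heading c i s - heading c i t)"
      if s: "s \<in> S" and rs: "regular_at (S, T, s)" for s
    proof -
      note vs = valid_shift[OF val s]
      have cs: "weight i / 2 \<le> norm (cmd i (S, T, s))" "hsep / 2 \<le> norm (thrust_dir (cmd i (S, T, s)) \<times> heading c i s)"
        and ct: "weight i / 2 \<le> norm (cmd i (S, T, t))" "hsep / 2 \<le> norm (thrust_dir (cmd i (S, T, t)) \<times> heading c i t)"
        using rs reg(1) by (auto simp: regular_at_def regular_cmd_def)
      have nz: "cmd i (S, T, s) \<noteq> 0" "cmd i (S, T, t) \<noteq> 0" using cs(1) ct(1) weight_pos[of i] by auto
      have "norm (?R s - ?R t) \<le> L * (norm (thrust_dir (cmd i (S, T, s)) - thrust_dir (cmd i (S, T, t))) + norm (heading c i s - heading c i t))"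
        unfolding Rcmd_eq[OF val] Rcmd_eq[OF vs] L_def
        using hsep(1) valid_nonneg[OF vs] t0
        by (intro attitude_of_lipschitz norm_thrust_dir nz heading_unit cs ct) auto
      also have "\<dots> \<le> L * (2 / (weight i / 2) * norm (cmd i (S, T, s) - cmd i (S, T, t)) + norm (heading c i s - heading c i t))"
        using weight_pos[of i] L by (intro mult_left_mono add_right_mono thrust_dir_lipschitz cs nz) auto
      finally show ?thesis by (simp add: M_def distrib_left)
    qed
    have "\<forall>\<^sub>F s in at t within S. s \<in> S" by (simp add: eventually_at_filter)
    with reg(2) have ev: "\<forall>\<^sub>F s in at t within S. norm (?R s - ?R t) \<le> M * norm (cmd i (S, T, s) - cmd i (S, T, t)) + L * norm (heading c i s - heading c i t)"
      by eventually_elim (rule lip)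
    have "norm ?R' \<le> M * norm (dcmd i (S, T, t)) + L * norm (ddt {0..} (heading c i) t)"
      by (rule lipschitz_derivative_bound[OF d cmd_derivative[OF val] heading_derivative[OF t0 S0] valid_nontrivial[OF val] ev])
    also have "\<dots> \<le> M * B + L * h" using B h[OF t0] L M by (intro add_mono mult_left_mono)
    finally have R': "norm ?R' \<le> M * B + L * h" .
    have "rotation_matrix (?R t)" using reg(1) by (auto simp: regular_at_def posed_def)
    then have "(norm (transpose (?R t)))\<^sup>2 \<le> 2\<^sup>2"
      by (simp add: rotation_matrix_def orthogonal_norm_sq orthogonal_matrix_transpose)
    then have RT: "norm (transpose (?R t)) \<le> 2" by (rule power2_le_imp_le) simp
    have "norm (Omc i (S, T, t)) \<le> norm (transpose (?R t) ** ?R')"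
      unfolding Omc_def Omega_c_def Rcmd_def prod.case by (rule norm_vee_le)
    also have "\<dots> \<le> K * (norm (transpose (?R t)) * norm ?R')" by (rule K)
    also have "\<dots> \<le> K * (2 * (M * B + L * h))"
      using RT R' K(1) by (intro mult_left_mono mult_mono) auto
    finally show ?thesis by (simp add: Y_def)
  qed
  then show ?thesis using that[of Y] by (simp add: Y_def)
qed

text \<open>The feedforward terms of the moment remove the commanded angular acceleration from the
  error equation. Here \<open>y\<close> is the commanded angular velocity expressed in the actual
  body frame, which preserves its norm.\<close>

lemma attitude_dynamics:
  assumes val: "(S, T, t) \<in> valid" and reg: "regular_at (S, T, t)" "\<forall>\<^sub>F s in at t within S. regular_at (S, T, s)"
  obtains e' y where
    "((\<lambda>s. Qerr i (S, T, s)) has_vector_derivative Qerr i (S, T, t) ** hat (eOm i (S, T, t))) (at t within S)"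
    "((\<lambda>s. eOm i (S, T, s)) has_vector_derivative e') (at t within S)"
    "norm y = norm (Omc i (S, T, t))"
    "inertiaQ P i *v e' = - ((eOm i (S, T, t) + y) \<times> (inertiaQ P i *v (eOm i (S, T, t) + y)))
       - k_R c *\<^sub>R skew_part (Qerr i (S, T, t)) - k_Omega c *\<^sub>R eOm i (S, T, t)
       + y \<times> (inertiaQ P i *v y) + inertiaQ P i *v (eOm i (S, T, t) \<times> y)"
proof -
  let ?J = "inertiaQ P i" and ?R = "attQ T i" and ?Rc = "Rc P c S T i" and ?Om = "angvQ T i"
    and ?Oc = "Omega_c P c S T i"
  let ?Qt = "transpose (?R t) ** ?Rc t" and ?e = "eOm i (S, T, t)"
  define y where "y = ?Qt *v ?Oc t"
  define e' where "e' = ddt S ?Om t + ?e \<times> y - ?Qt *v ddt S ?Oc t"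
  have mem: "t \<in> S" and cl: "closed_loop P c S T" by (rule valid_mem[OF val], rule valid_motion[OF val])
  have R: "(?R has_vector_derivative ?R t ** hat (?Om t)) (at t within S)" "rotation_matrix (?R t)"
    using valid_kinematics[OF val] mem by (simp_all add: kinematics_def)
  have Rc: "(?Rc has_vector_derivative ?Rc t ** hat (?Oc t)) (at t within S)" "rotation_matrix (?Rc t)"
    using Rcmd_derivative[OF val reg, of i] reg(1) by (auto simp: Rcmd_def Omc_def regular_at_def posed_def)
  have Om: "(?Om has_vector_derivative ddt S ?Om t) (at t within S)"
    using valid_regular[OF val] mem by (simp add: regular_trajectory_def ddt_works)
  have Oc: "(?Oc has_vector_derivative ddt S ?Oc t) (at t within S)"
    using cl mem by (simp add: closed_loop_def ddt_works)
  have eO: "(\<lambda>s. eOm i (S, T, s)) = (\<lambda>s. ?Om s - (transpose (?R s) ** ?Rc s) *v ?Oc s)"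
    by (simp add: eOm_def eOmega_def)
  have Q: "(\<lambda>s. Qerr i (S, T, s)) = (\<lambda>s. transpose (?Rc s) ** ?R s)"
    by (simp add: Qerr_def Rcmd_def RQ_def)
  note der = attitude_error_derivative[OF R Rc Om Oc]
  have sk: "skew_part (Qerr i (S, T, t)) = eR P c S T i t"
    by (simp add: skew_part_def eR_def Qerr_def Rcmd_def RQ_def matrix_transpose_mul transpose_transpose)
  have Omt: "?Om t = ?e + y" by (simp add: eOm_def eOmega_def y_def)
  have "quadrotor_rotation P S T (moment_input P c S T t) t i"
    using cl mem by (simp add: closed_loop_def full_model_def)
  then have "?J *v ddt S ?Om t = - ((?e + y) \<times> (?J *v (?e + y))) - k_R c *\<^sub>R skew_part (Qerr i (S, T, t))
      - k_Omega c *\<^sub>R ?e + y \<times> (?J *v y) + ?J *v (?Qt *v ddt S ?Oc t)"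
    unfolding quadrotor_rotation_def moment_input_def Let_def sk Omt
    by (simp add: mat_vec_simps y_def eOm_def algebra_simps)
  then have eq: "?J *v e' = - ((?e + y) \<times> (?J *v (?e + y))) - k_R c *\<^sub>R skew_part (Qerr i (S, T, t))
      - k_Omega c *\<^sub>R ?e + y \<times> (?J *v y) + ?J *v (?e \<times> y)"
    unfolding e'_def by (simp add: matrix_vector_right_distrib matrix_vector_mult_diff_distrib)
  have "rotation_matrix ?Qt" using R(2) Rc(2) by (rule rotation_matrix_transpose_mult)
  then have ny: "norm y = norm (Omc i (S, T, t))" by (simp add: y_def norm_rotation Omc_def)
  show ?thesis
  proof (rule that[OF _ _ ny eq])
    show "((\<lambda>s. Qerr i (S, T, s)) has_vector_derivative Qerr i (S, T, t) ** hat ?e) (at t within S)"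
      using der(1) unfolding Q by (simp add: eOm_def eOmega_def Qerr_def Rcmd_def RQ_def)
    show "((\<lambda>s. eOm i (S, T, s)) has_vector_derivative e') (at t within S)"
      using der(2) unfolding eO e'_def y_def by (simp add: eOm_def eOmega_def)
  qed
qed

end

section \<open>Comparison of the error measures and the combined Lyapunov function\<close>

lemma sum_nonneg_power2_le:
  fixes f :: "'i \<Rightarrow> real"
  assumes "\<And>i. i \<in> I \<Longrightarrow> f i \<ge> 0"
  shows "(\<Sum>i\<in>I. (f i)\<^sup>2) \<le> (\<Sum>i\<in>I. f i)\<^sup>2"
proof -
  have "L2_set f I \<le> sum f I" using assms by (rule L2_set_le_sum)
  then have "(L2_set f I)\<^sup>2 \<le> (sum f I)\<^sup>2" by (intro power_mono L2_set_nonneg)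
  then show ?thesis by (simp add: L2_set_def sum_nonneg)
qed

context tracking begin

definition rot_err :: "'n instant \<Rightarrow> real" where
  "rot_err \<sigma> = (\<Sum>i\<in>UNIV. (norm (Qerr i \<sigma> - mat 1))\<^sup>2 + (norm (eOm i \<sigma>))\<^sup>2)"

text \<open>The total error with attitude error vectors replaced by distances to the identity; this
  is the quantity kept small by the continuity argument.\<close>

definition total_dev :: "'n instant \<Rightarrow> real" where
  "total_dev \<sigma> = dev \<sigma> + err \<sigma> + (\<Sum>i\<in>UNIV. norm (eOm i \<sigma>))"

lemma rot_err_nonneg: "rot_err \<sigma> \<ge> 0"
  unfolding rot_err_def by (intro sum_nonneg) auto

lemma total_dev_parts: "dev \<sigma> \<le> total_dev \<sigma>" "err \<sigma> \<le> total_dev \<sigma>" "norm (eOm i \<sigma>) \<le> total_dev \<sigma>"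
proof -
  have "norm (eOm i \<sigma>) \<le> (\<Sum>i\<in>UNIV. norm (eOm i \<sigma>))"
    by (intro member_le_sum[where f = "\<lambda>i. norm (eOm i \<sigma>)"]) auto
  moreover have "0 \<le> (\<Sum>i\<in>UNIV. norm (eOm i \<sigma>))" by (intro sum_nonneg) auto
  ultimately show "dev \<sigma> \<le> total_dev \<sigma>" "err \<sigma> \<le> total_dev \<sigma>" "norm (eOm i \<sigma>) \<le> total_dev \<sigma>"
    using conf.dev_nonneg[of \<sigma>] err_nonneg[of \<sigma>] unfolding total_dev_def by linarith+
qed

text \<open>Cauchy-Schwarz: three groups of terms, and one summand per quadrotor in the attitude
  groups, account for the constants.\<close>

lemma err_sq_le: "(err \<sigma>)\<^sup>2 \<le> real CARD('n) * rot_err \<sigma>"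
  and total_dev_sq_le: "(total_dev \<sigma>)\<^sup>2 \<le> 3 * real CARD('n) * ((dev \<sigma>)\<^sup>2 + rot_err \<sigma>)"
  and le_total_dev_sq: "(dev \<sigma>)\<^sup>2 + rot_err \<sigma> \<le> (total_dev \<sigma>)\<^sup>2"
proof -
  let ?n = "\<lambda>i. norm (Qerr i \<sigma> - mat 1)" and ?e = "\<lambda>i. norm (eOm i \<sigma>)" and ?N = "real CARD('n)"
  let ?s = "\<Sum>i\<in>UNIV. ?e i"
  have N: "?N \<ge> 1" by (simp add: Suc_leI)
  have split: "rot_err \<sigma> = (\<Sum>i\<in>UNIV. (?n i)\<^sup>2) + (\<Sum>i\<in>UNIV. (?e i)\<^sup>2)"
    by (simp add: rot_err_def sum.distrib)
  have n: "(err \<sigma>)\<^sup>2 \<le> ?N * (\<Sum>i\<in>UNIV. (?n i)\<^sup>2)" and e: "?s\<^sup>2 \<le> ?N * (\<Sum>i\<in>UNIV. (?e i)\<^sup>2)"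
    using sum_squared_le_sum_of_squares[of ?n "UNIV :: 'n set"]
      sum_squared_le_sum_of_squares[of ?e "UNIV :: 'n set"]
    by (simp_all add: err_def mult.commute)
  have "0 \<le> ?N * (\<Sum>i\<in>UNIV. (?e i)\<^sup>2)" by (intro mult_nonneg_nonneg sum_nonneg) auto
  then show "(err \<sigma>)\<^sup>2 \<le> ?N * rot_err \<sigma>" using n unfolding split distrib_left by linarith
  have d: "(dev \<sigma>)\<^sup>2 \<le> ?N * (dev \<sigma>)\<^sup>2" using N mult_right_mono[of 1 ?N "(dev \<sigma>)\<^sup>2"] by simp
  have "3 * ((dev \<sigma>)\<^sup>2 + (err \<sigma>)\<^sup>2 + ?s\<^sup>2) - (total_dev \<sigma>)\<^sup>2
    = (dev \<sigma> - err \<sigma>)\<^sup>2 + (dev \<sigma> - ?s)\<^sup>2 + (err \<sigma> - ?s)\<^sup>2"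
    unfolding total_dev_def by (simp add: power2_eq_square algebra_simps)
  moreover have "\<dots> \<ge> 0" by simp
  ultimately have "(total_dev \<sigma>)\<^sup>2 \<le> 3 * ((dev \<sigma>)\<^sup>2 + (err \<sigma>)\<^sup>2 + ?s\<^sup>2)" by linarith
  also have "\<dots> \<le> 3 * (?N * (dev \<sigma>)\<^sup>2 + ?N * (\<Sum>i\<in>UNIV. (?n i)\<^sup>2) + ?N * (\<Sum>i\<in>UNIV. (?e i)\<^sup>2))"
    using d n e by (intro mult_left_mono add_mono) auto
  finally show "(total_dev \<sigma>)\<^sup>2 \<le> 3 * ?N * ((dev \<sigma>)\<^sup>2 + rot_err \<sigma>)"
    unfolding split by (simp add: distrib_left mult.assoc)
  have "(\<Sum>i\<in>UNIV. (?n i)\<^sup>2) \<le> (err \<sigma>)\<^sup>2" "(\<Sum>i\<in>UNIV. (?e i)\<^sup>2) \<le> ?s\<^sup>2"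
    unfolding err_def by (intro sum_nonneg_power2_le; simp)+
  moreover have "0 \<le> dev \<sigma> * err \<sigma>" "0 \<le> dev \<sigma> * ?s" "0 \<le> err \<sigma> * ?s"
    using conf.dev_nonneg[of \<sigma>] err_nonneg[of \<sigma>] by (auto intro!: mult_nonneg_nonneg sum_nonneg)
  ultimately show "(dev \<sigma>)\<^sup>2 + rot_err \<sigma> \<le> (total_dev \<sigma>)\<^sup>2"
    unfolding split total_dev_def by (simp add: power2_eq_square algebra_simps)
qed

lemma total_dev_continuous:
  assumes val: "(S, T, t0) \<in> valid"
  shows "continuous_on S (\<lambda>s. total_dev (S, T, s))"
  unfolding continuous_on_eq_continuous_within
proof
  fix t assume "t \<in> S"
  then have vt: "(S, T, t) \<in> valid" by (rule valid_shift[OF val])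
  note cl = valid_motion[OF vt] and mem = valid_mem[OF vt]
  note cont = has_vector_derivative_continuous
  have dR: "(attQ T i has_vector_derivative attQ T i t ** hat (angvQ T i t)) (at t within S)" for i
    using valid_kinematics[OF vt] mem by (simp add: kinematics_def)
  have diff: "diff_on S (angvQ T i)" "diff_on S (Rc P c S T i)" "diff_on S (Omega_c P c S T i)" for i
    using valid_regular[OF vt] cl by (simp_all add: regular_trajectory_def closed_loop_def)
  note R = cont[OF dR] and Om = cont[OF ddt_works[OF diff(1) mem]]
    and Rc = cont[OF ddt_works[OF diff(2) mem]] and Oc = cont[OF ddt_works[OF diff(3) mem]]
  note tr = bounded_linear.continuous[OF bounded_linear_transpose]
  note mm = bounded_bilinear.continuous[OF bounded_bilinear_matrix_matrix_mult]
    and mv = bounded_bilinear.continuous[OF bounded_bilinear_matrix_vector_mult]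
  have Q: "continuous (at t within S) (\<lambda>s. Qerr i (S, T, s))" for i
    unfolding Qerr_def Rcmd_def RQ_def prod.case by (intro mm tr R Rc)
  have e: "continuous (at t within S) (\<lambda>s. eOm i (S, T, s))" for i
    unfolding eOm_def eOmega_def prod.case by (intro continuous_diff mm mv tr R Rc Om Oc)
  show "continuous (at t within S) (\<lambda>s. total_dev (S, T, s))"
    unfolding total_dev_def err_def
    by (intro continuous_add continuous_sum continuous_norm continuous_diff continuous_const
        dev_continuous[OF vt] Q e)
qed

text \<open>The angular velocity of a link is orthogonal to its unit direction, so it has the norm
  of the derivative of that direction; the attitude errors are skew parts.\<close>

lemma total_error_eq:
  assumes val: "(S, T, t) \<in> valid"
  shows "total_error P c S T t = norm (err0 (S, T, t)) + norm (vel0 (S, T, t))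
    + norm (skew_part (rot0 (S, T, t))) + norm (om0 (S, T, t))
    + (\<Sum>i\<in>UNIV. \<Sum>j\<in>links P i. norm (dir i j (S, T, t) - e3) + norm (ddir i j (S, T, t)))
    + (\<Sum>i\<in>UNIV. norm (skew_part (Qerr i (S, T, t))) + norm (eOm i (S, T, t)))"
proof -
  have "ddt S (\<lambda>\<tau>. pos0 T \<tau> - pos_cmd c) t = vel0 (S, T, t)"
    using ddt_eq[OF pos0_derivative[OF val] valid_nontrivial[OF val]] by (simp add: err0_def)
  moreover have "(\<Sum>i\<in>UNIV. \<Sum>j\<in>links P i. norm (dir i j (S, T, t) - e3) + norm (ddir i j (S, T, t)))
    = (\<Sum>i\<in>UNIV. \<Sum>j\<in>links P i. norm (dirL T i j t - e3) + norm (angvL T i j t))"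
    by (intro sum.cong refl) (simp add: norm_ddir[OF val] dir_def)
  moreover have "eR P c S T i t = skew_part (Qerr i (S, T, t))" for i
    by (simp add: skew_part_def eR_def Qerr_def Rcmd_def RQ_def matrix_transpose_mul transpose_transpose)
  ultimately show ?thesis
    by (simp add: total_error_def err0_def rot0_def om0_def eOm_def eR0_def skew_part_def[of "att0 T t"])
qed

lemma Qerr_rotation:
  assumes "(S, T, t) \<in> valid" "(S, T, t) \<in> posed"
  shows "rotation_matrix (Qerr i (S, T, t))"
  unfolding Qerr_def using assms RQ_rotation
  by (intro rotation_matrix_transpose_mult) (auto simp: posed_def)

lemma total_error_le_total_dev:
  assumes val: "(S, T, t) \<in> valid" and pos: "(S, T, t) \<in> posed"
  shows "total_error P c S T t \<le> total_dev (S, T, t)"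
proof -
  have "norm (skew_part (rot0 (S, T, t))) \<le> norm (rot0 (S, T, t) - mat 1)"
    by (rule rotation_error_bounds(1)[OF rot0_rotation[OF val]])
  moreover have "(\<Sum>i\<in>UNIV. norm (skew_part (Qerr i (S, T, t)))) \<le> err (S, T, t)"
    unfolding err_def by (intro sum_mono rotation_error_bounds(1) Qerr_rotation[OF val pos])
  ultimately show ?thesis
    unfolding total_error_eq[OF val] total_dev_def dev_def by (simp add: sum.distrib)
qed

text \<open>This comparison precedes membership in \<open>posed\<close>: it is what places the
  initial instant there.\<close>

lemma dev_le_total_error:
  assumes val: "(S, T, t) \<in> valid" and tr: "(1/2) * trace (mat 1 - att0 T t) < 1"
  shows "dev (S, T, t) \<le> 2 * total_error P c S T t"
proof -
  have "norm (rot0 (S, T, t) - mat 1) \<le> 2 * norm (skew_part (rot0 (S, T, t)))"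
    using rotation_error_bounds(2)[OF rot0_rotation[OF val]] tr by (simp add: rot0_def)
  moreover have "0 \<le> (\<Sum>i\<in>UNIV. \<Sum>j\<in>links P i. norm (dir i j (S, T, t) - e3) + norm (ddir i j (S, T, t)))"
    "0 \<le> (\<Sum>i\<in>UNIV. norm (skew_part (Qerr i (S, T, t))) + norm (eOm i (S, T, t)))"
    by (auto intro!: sum_nonneg)
  ultimately show ?thesis
    unfolding total_error_eq[OF val] dev_def distrib_left
    using norm_ge_zero[of "err0 (S, T, t)"] norm_ge_zero[of "vel0 (S, T, t)"] norm_ge_zero[of "om0 (S, T, t)"]
    by linarith
qed

lemma total_dev_le_total_error:
  assumes val: "(S, T, t) \<in> valid" and pos: "(S, T, t) \<in> posed"
    and tr: "(1/2) * trace (mat 1 - att0 T t) < 1"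
      "\<And>i. (1/2) * trace (mat 1 - transpose (Rc P c S T i t) ** attQ T i t) < 1"
  shows "total_dev (S, T, t) \<le> 2 * total_error P c S T t"
proof -
  have "norm (rot0 (S, T, t) - mat 1) \<le> 2 * norm (skew_part (rot0 (S, T, t)))"
    using rotation_error_bounds(2)[OF rot0_rotation[OF val]] tr(1) by (simp add: rot0_def)
  moreover have "err (S, T, t) \<le> (\<Sum>i\<in>UNIV. 2 * norm (skew_part (Qerr i (S, T, t))))"
    unfolding err_def
  proof (intro sum_mono rotation_error_bounds(2) Qerr_rotation[OF val pos])
    show "(1/2) * trace (mat 1 - Qerr i (S, T, t)) \<le> 1" for i
      using tr(2)[of i] by (simp add: Qerr_def Rcmd_def RQ_def)
  qed
  then have "err (S, T, t) \<le> 2 * (\<Sum>i\<in>UNIV. norm (skew_part (Qerr i (S, T, t))))"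
    by (simp add: sum_distrib_left)
  moreover have "0 \<le> (\<Sum>i\<in>UNIV. \<Sum>j\<in>links P i. norm (dir i j (S, T, t) - e3) + norm (ddir i j (S, T, t)))"
    "0 \<le> (\<Sum>i\<in>UNIV. norm (eOm i (S, T, t)))"
    by (auto intro!: sum_nonneg)
  ultimately show ?thesis
    unfolding total_error_eq[OF val] total_dev_def dev_def sum.distrib[of "\<lambda>i. norm (skew_part (Qerr i (S, T, t)))"] distrib_left
    using norm_ge_zero[of "err0 (S, T, t)"] norm_ge_zero[of "vel0 (S, T, t)"] norm_ge_zero[of "om0 (S, T, t)"]
    by linarith
qed

lemma lyapunov_function:
  obtains W p q r \<epsilon> where "p > 0" "q > 0" "r > 0" "\<epsilon> > 0"
    and "\<And>\<sigma>. \<sigma> \<in> valid \<Longrightarrow> dev \<sigma> < \<epsilon> \<Longrightarrow> \<sigma> \<in> posed"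
    and "\<And>\<sigma>. \<sigma> \<in> valid \<Longrightarrow> total_dev \<sigma> < \<epsilon> \<Longrightarrow> p * (total_dev \<sigma>)\<^sup>2 \<le> W \<sigma>"
    and "\<And>\<sigma>. \<sigma> \<in> valid \<Longrightarrow> total_dev \<sigma> < \<epsilon> \<Longrightarrow> W \<sigma> \<le> q * (total_dev \<sigma>)\<^sup>2"
    and "\<And>S T t. (S, T, t) \<in> valid \<Longrightarrow> total_dev (S, T, t) < \<epsilon> \<Longrightarrow>
      \<exists>w. ((\<lambda>s. W (S, T, s)) has_real_derivative w) (at t within S) \<and> w \<le> - (2 * r) * W (S, T, t)"
proof -
  obtain H p0 q0 K e B where pos: "p0 > 0" "q0 > 0" "K > 0" "e > 0"
    and near: "\<And>\<sigma>. \<sigma> \<in> valid \<Longrightarrow> dev \<sigma> \<le> e \<Longrightarrow> \<sigma> \<in> posed \<and> (\<forall>i. regular_cmd i \<sigma>)"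
    and low: "\<And>\<sigma>. \<sigma> \<in> valid \<Longrightarrow> dev \<sigma> \<le> e \<Longrightarrow> p0 * (dev \<sigma>)\<^sup>2 \<le> payload_energy H \<sigma>"
    and up: "\<And>\<sigma>. \<sigma> \<in> valid \<Longrightarrow> dev \<sigma> \<le> e \<Longrightarrow> payload_energy H \<sigma> \<le> q0 * (dev \<sigma>)\<^sup>2"
    and der: "\<And>S T t. (S, T, t) \<in> valid \<Longrightarrow> dev (S, T, t) \<le> e \<Longrightarrow>
      \<exists>w. ((\<lambda>s. payload_energy H (S, T, s)) has_real_derivative w) (at t within S) \<and>
        w \<le> - p0 * (dev (S, T, t))\<^sup>2 + K * (err (S, T, t))\<^sup>2"
    and B: "\<And>i \<sigma>. \<sigma> \<in> valid \<Longrightarrow> dev \<sigma> \<le> e \<Longrightarrow> err \<sigma> \<le> 1 \<Longrightarrow> norm (dcmd i \<sigma>) \<le> B i"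
    by (rule payload_lyapunov) (rule that)
  have reg: "regular_at \<sigma>" if "\<sigma> \<in> valid" "dev \<sigma> \<le> e" for \<sigma>
    using near[OF that] by (simp add: regular_at_def)
  let ?n = "\<lambda>i \<sigma>. norm (Qerr i \<sigma> - mat 1)" and ?e = "\<lambda>i \<sigma>. norm (eOm i \<sigma>)"
  let ?z = "\<lambda>i \<sigma>. (?n i \<sigma>)\<^sup>2 + (?e i \<sigma>)\<^sup>2"
  have J: "sym_pos_def (inertiaQ P i)" for i using plant by (simp add: admissible_plant_def)
  \<comment> \<open>Bundles everything needed about one quadrotor, so that its constants can be
    chosen separately for each \<open>i\<close>.\<close>
  define good where "good i k p q d \<longleftrightarrow> p > 0 \<and> q > 0 \<and> d > 0 \<and>
    (\<forall>\<sigma>. rotation_matrix (Qerr i \<sigma>) \<longrightarrow>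
      p * ?z i \<sigma> \<le> att_energy (inertiaQ P i) (k_R c) k (Qerr i \<sigma>) (eOm i \<sigma>) \<and>
      att_energy (inertiaQ P i) (k_R c) k (Qerr i \<sigma>) (eOm i \<sigma>) \<le> q * ?z i \<sigma>) \<and>
    (\<forall>S T t. (S, T, t) \<in> valid \<longrightarrow> dev (S, T, t) < e \<longrightarrow> err (S, T, t) \<le> 1 \<longrightarrow> ?e i (S, T, t) \<le> 1 \<longrightarrow>
      (\<exists>w. ((\<lambda>s. att_energy (inertiaQ P i) (k_R c) k (Qerr i (S, T, s)) (eOm i (S, T, s))) has_real_derivative w) (at t within S)
        \<and> w \<le> - d * ?z i (S, T, t)))" for i k p q d
  have "\<exists>k p q d. good i k p q d" for i
  proof -
    obtain Y where Y: "Y \<ge> 0"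
      "\<And>S T t. (S, T, t) \<in> valid \<Longrightarrow> regular_at (S, T, t) \<Longrightarrow> \<forall>\<^sub>F s in at t within S. regular_at (S, T, s) \<Longrightarrow>
      norm (dcmd i (S, T, t)) \<le> B i \<Longrightarrow> norm (Omc i (S, T, t)) \<le> Y"
      by (rule Omc_bounded[of i "B i"]) (rule that)
    obtain k p q d where pqd: "p > 0" "q > 0" "d > 0"
      and 1: "\<And>Q e. rotation_matrix Q \<Longrightarrow>
        p * ((norm (Q - mat 1))\<^sup>2 + (norm e)\<^sup>2) \<le> att_energy (inertiaQ P i) (k_R c) k Q e"
      and 2: "\<And>Q e. rotation_matrix Q \<Longrightarrow>
        att_energy (inertiaQ P i) (k_R c) k Q e \<le> q * ((norm (Q - mat 1))\<^sup>2 + (norm e)\<^sup>2)"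
      and 3: "\<And>Q e y. rotation_matrix Q \<Longrightarrow> norm (Q - mat 1) \<le> 1 \<Longrightarrow> norm e \<le> 1 \<Longrightarrow> norm y \<le> Y \<Longrightarrow>
        att_rate (inertiaQ P i) (k_R c) k Q e (- ((e + y) \<times> (inertiaQ P i *v (e + y))) - k_R c *\<^sub>R skew_part Q
          - k_Omega c *\<^sub>R e + y \<times> (inertiaQ P i *v y) + inertiaQ P i *v (e \<times> y))
        \<le> - d * ((norm (Q - mat 1))\<^sup>2 + (norm e)\<^sup>2)"
      by (rule att_energy_decay[OF J[of i] k_pos Y(1)]) (rule that)
    have "\<exists>w. ((\<lambda>s. att_energy (inertiaQ P i) (k_R c) k (Qerr i (S, T, s)) (eOm i (S, T, s))) has_real_derivative w) (at t within S)
        \<and> w \<le> - d * ?z i (S, T, t)"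
      if val: "(S, T, t) \<in> valid" and small: "dev (S, T, t) < e" "err (S, T, t) \<le> 1" "?e i (S, T, t) \<le> 1" for S T t
    proof -
      have r1: "regular_at (S, T, t)" using reg[OF val] small by simp
      have r2: "\<forall>\<^sub>F s in at t within S. regular_at (S, T, s)"
        by (rule eventually_regular[OF val small(1) reg])
      obtain e' y where dQ: "((\<lambda>s. Qerr i (S, T, s)) has_vector_derivative Qerr i (S, T, t) ** hat (eOm i (S, T, t))) (at t within S)"
        and de: "((\<lambda>s. eOm i (S, T, s)) has_vector_derivative e') (at t within S)"
        and ny: "norm y = norm (Omc i (S, T, t))"
        and Je: "inertiaQ P i *v e' = - ((eOm i (S, T, t) + y) \<times> (inertiaQ P i *v (eOm i (S, T, t) + y)))
         - k_R c *\<^sub>R skew_part (Qerr i (S, T, t)) - k_Omega c *\<^sub>R eOm i (S, T, t)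
         + y \<times> (inertiaQ P i *v y) + inertiaQ P i *v (eOm i (S, T, t) \<times> y)"
        by (rule attitude_dynamics[OF val r1 r2, of i]) (rule that)
      have "norm y \<le> Y" unfolding ny using small by (intro Y(2)[OF val r1 r2] B[OF val]) auto
      moreover have "?n i (S, T, t) \<le> 1" using norm_Qerr_le_err small(2) by (rule order_trans)
      moreover have "rotation_matrix (Qerr i (S, T, t))"
        using r1 by (intro Qerr_rotation[OF val]) (simp add: regular_at_def)
      ultimately show ?thesis
        using att_energy_derivative[OF dQ de J[of i], where k = "k_R c" and c = k] 3 small(3) unfolding Je by blast
    qed
    then have "good i k p q d" unfolding good_def using pqd 1 2 by blast
    then show ?thesis by blast
  qed
  then obtain k p q d where g: "\<And>i. good i (k i) (p i) (q i) (d i)" by metis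
  note gd = g[unfolded good_def]
  \<comment> \<open>The weighted attitude decay is \<open>K * CARD('n) + 1\<close> times the squared
    errors: the first part pays for the disturbance \<open>K * err\<^sup>2\<close> by
    Cauchy-Schwarz, and the 1 survives as decay.\<close>
  define \<kappa> where "\<kappa> i = (K * real CARD('n) + 1) / d i" for i
  have \<kappa>: "\<kappa> i > 0" "\<kappa> i * d i = K * real CARD('n) + 1" for i
    using gd[of i] pos by (simp_all add: \<kappa>_def add_pos_pos)
  let ?att = "\<lambda>i \<sigma>. att_energy (inertiaQ P i) (k_R c) (k i) (Qerr i \<sigma>) (eOm i \<sigma>)"
  define W where "W \<sigma> = payload_energy H \<sigma> + (\<Sum>i\<in>UNIV. \<kappa> i * ?att i \<sigma>)" for \<sigma>
  define pm where "pm = Min (insert p0 (range (\<lambda>i. \<kappa> i * p i)))"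
  define qM where "qM = q0 + (\<Sum>i\<in>UNIV. \<kappa> i * q i)"
  have pm: "pm > 0" "pm \<le> p0" "pm \<le> \<kappa> i * p i" for i
  proof -
    have "\<kappa> i * p i > 0" for i using \<kappa>(1)[of i] gd[of i] by simp
    then show "pm > 0" using pos(1) by (auto simp: pm_def Min_gr_iff simp del: Min_insert)
    show "pm \<le> p0" "pm \<le> \<kappa> i * p i" unfolding pm_def by (rule Min_le; simp)+
  qed
  have qnn: "\<kappa> i * q i \<ge> 0" for i using \<kappa>(1)[of i] gd[of i] by simp
  have qM: "qM > 0" "q0 \<le> qM" "\<kappa> i * q i \<le> qM" for i
  proof -
    have "(\<Sum>i\<in>UNIV. \<kappa> i * q i) \<ge> 0" by (intro sum_nonneg qnn)
    moreover have "\<kappa> i * q i \<le> (\<Sum>i\<in>UNIV. \<kappa> i * q i)" by (intro member_le_sum qnn) auto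
    ultimately show "qM > 0" "q0 \<le> qM" "\<kappa> i * q i \<le> qM" using pos(2) by (simp_all add: qM_def)
  qed
  \<comment> \<open>The bound 1 keeps attitude and angular velocity errors in the range where the
    attitude energies decay.\<close>
  define \<epsilon> where "\<epsilon> = min e 1"
  have \<epsilon>: "\<epsilon> > 0" "\<epsilon> \<le> e" "\<epsilon> \<le> 1" using pos by (auto simp: \<epsilon>_def)
  have small: "dev \<sigma> < e \<and> err \<sigma> \<le> 1 \<and> ?e i \<sigma> \<le> 1" if "total_dev \<sigma> < \<epsilon>" for \<sigma> i
    using total_dev_parts(1,2)[of \<sigma>] total_dev_parts(3)[where i = i and \<sigma> = \<sigma>] that \<epsilon> by linarith
  have rot: "rotation_matrix (Qerr i \<sigma>)" if "\<sigma> \<in> valid" "total_dev \<sigma> < \<epsilon>" for \<sigma> i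
  proof -
    obtain S T t where \<sigma>: "\<sigma> = (S, T, t)" by (cases \<sigma>)
    show ?thesis using that near[of \<sigma>] small[OF that(2)] Qerr_rotation unfolding \<sigma> by fastforce
  qed
  have gz: "p i * ?z i \<sigma> \<le> ?att i \<sigma>" "?att i \<sigma> \<le> q i * ?z i \<sigma>" if "\<sigma> \<in> valid" "total_dev \<sigma> < \<epsilon>" for \<sigma> i
    using gd[of i] rot[OF that, of i] by blast+
  have Wlow: "pm * ((dev \<sigma>)\<^sup>2 + rot_err \<sigma>) \<le> W \<sigma>" if val: "\<sigma> \<in> valid" and sz: "total_dev \<sigma> < \<epsilon>" for \<sigma>
  proof -
    have "pm * (dev \<sigma>)\<^sup>2 \<le> p0 * (dev \<sigma>)\<^sup>2" using pm(2) by (intro mult_right_mono) auto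
    moreover have "p0 * (dev \<sigma>)\<^sup>2 \<le> payload_energy H \<sigma>" using low[OF val] small[OF sz] by (simp add: less_imp_le)
    moreover have "pm * rot_err \<sigma> \<le> (\<Sum>i\<in>UNIV. \<kappa> i * ?att i \<sigma>)"
      unfolding rot_err_def sum_distrib_left
    proof (rule sum_mono)
      fix i
      have "pm * ?z i \<sigma> \<le> \<kappa> i * p i * ?z i \<sigma>" using pm(3) by (intro mult_right_mono) auto
      also have "\<dots> = \<kappa> i * (p i * ?z i \<sigma>)" by simp
      also have "\<dots> \<le> \<kappa> i * ?att i \<sigma>"
        by (rule mult_left_mono[OF gz(1)[OF val sz] less_imp_le[OF \<kappa>(1)]])
      finally show "pm * ?z i \<sigma> \<le> \<kappa> i * ?att i \<sigma>" .
    qed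
    ultimately show ?thesis unfolding W_def distrib_left by linarith
  qed
  have Wup: "W \<sigma> \<le> qM * ((dev \<sigma>)\<^sup>2 + rot_err \<sigma>)" if val: "\<sigma> \<in> valid" and sz: "total_dev \<sigma> < \<epsilon>" for \<sigma>
  proof -
    have "q0 * (dev \<sigma>)\<^sup>2 \<le> qM * (dev \<sigma>)\<^sup>2" using qM(2) by (intro mult_right_mono) auto
    moreover have "payload_energy H \<sigma> \<le> q0 * (dev \<sigma>)\<^sup>2" using up[OF val] small[OF sz] by (simp add: less_imp_le)
    moreover have "(\<Sum>i\<in>UNIV. \<kappa> i * ?att i \<sigma>) \<le> qM * rot_err \<sigma>"
      unfolding rot_err_def sum_distrib_left
    proof (rule sum_mono)
      fix i
      have "\<kappa> i * ?att i \<sigma> \<le> \<kappa> i * (q i * ?z i \<sigma>)"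
        by (rule mult_left_mono[OF gz(2)[OF val sz] less_imp_le[OF \<kappa>(1)]])
      also have "\<dots> = \<kappa> i * q i * ?z i \<sigma>" by simp
      also have "\<dots> \<le> qM * ?z i \<sigma>" using qM(3) by (intro mult_right_mono) auto
      finally show "\<kappa> i * ?att i \<sigma> \<le> qM * ?z i \<sigma>" .
    qed
    ultimately show ?thesis unfolding W_def distrib_left by linarith
  qed
  \<comment> \<open>The common decay coefficient of the payload part, \<open>p0\<close>, and of the
    attitude part, 1; dividing by the upper constant \<open>qM\<close> expresses it through
    \<open>W\<close>.\<close>
  define m where "m = min p0 1"
  have m: "m > 0" "m \<le> p0" "m \<le> 1" using pos by (auto simp: m_def)
  show ?thesis
  proof (rule that[of "pm / (3 * real CARD('n))" qM "m / (2 * qM)" \<epsilon> W])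
    show "pm / (3 * real CARD('n)) > 0" "qM > 0" "m / (2 * qM) > 0" "\<epsilon> > 0"
      using pm(1) qM(1) m \<epsilon> by auto
    show "\<sigma> \<in> posed" if "\<sigma> \<in> valid" "dev \<sigma> < \<epsilon>" for \<sigma>
      using near[of \<sigma>] that \<epsilon> by auto
    show "pm / (3 * real CARD('n)) * (total_dev \<sigma>)\<^sup>2 \<le> W \<sigma>" if "\<sigma> \<in> valid" "total_dev \<sigma> < \<epsilon>" for \<sigma>
    proof -
      have "pm / (3 * real CARD('n)) * (total_dev \<sigma>)\<^sup>2
        \<le> pm / (3 * real CARD('n)) * (3 * real CARD('n) * ((dev \<sigma>)\<^sup>2 + rot_err \<sigma>))"
        using pm(1) by (intro mult_left_mono total_dev_sq_le) auto
      also have "\<dots> = pm * ((dev \<sigma>)\<^sup>2 + rot_err \<sigma>)" by simp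
      finally show ?thesis using Wlow[OF that] by simp
    qed
    show "W \<sigma> \<le> qM * (total_dev \<sigma>)\<^sup>2" if "\<sigma> \<in> valid" "total_dev \<sigma> < \<epsilon>" for \<sigma>
      by (rule order_trans[OF Wup[OF that] mult_left_mono[OF le_total_dev_sq]]) (use qM(1) in simp)
    fix S T t assume val: "(S, T, t) \<in> valid" and sz: "total_dev (S, T, t) < \<epsilon>"
    let ?\<sigma> = "(S, T, t)"
    have sm: "dev ?\<sigma> < e" "err ?\<sigma> \<le> 1" "?e i ?\<sigma> \<le> 1" for i using small[OF sz] by auto
    obtain w0 where w0: "((\<lambda>s. payload_energy H (S, T, s)) has_real_derivative w0) (at t within S)"
      "w0 \<le> - p0 * (dev ?\<sigma>)\<^sup>2 + K * (err ?\<sigma>)\<^sup>2"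
      using der[OF val] sm(1) by auto
    have "\<forall>i. \<exists>w. ((\<lambda>s. ?att i (S, T, s)) has_real_derivative w) (at t within S) \<and> w \<le> - d i * ?z i ?\<sigma>"
      using gd val sm by blast
    from choice[OF this] obtain w where w: "\<And>i. ((\<lambda>s. ?att i (S, T, s)) has_real_derivative w i) (at t within S)"
      "\<And>i. w i \<le> - d i * ?z i ?\<sigma>" by blast
    have dW: "((\<lambda>s. W (S, T, s)) has_real_derivative (w0 + (\<Sum>i\<in>UNIV. \<kappa> i * w i))) (at t within S)"
      unfolding W_def by (intro DERIV_add w0 DERIV_sum DERIV_cmult w)
    have "(\<Sum>i\<in>UNIV. \<kappa> i * w i) \<le> (\<Sum>i\<in>UNIV. - (K * real CARD('n) + 1) * ?z i ?\<sigma>)"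
    proof (rule sum_mono)
      fix i
      have "\<kappa> i * w i \<le> \<kappa> i * (- d i * ?z i ?\<sigma>)" using w(2) \<kappa>(1)[of i] by (intro mult_left_mono) auto
      also have "\<dots> = - (\<kappa> i * d i) * ?z i ?\<sigma>" by simp
      finally show "\<kappa> i * w i \<le> - (K * real CARD('n) + 1) * ?z i ?\<sigma>" unfolding \<kappa>(2) .
    qed
    also have "\<dots> = - (K * real CARD('n) + 1) * rot_err ?\<sigma>"
      unfolding rot_err_def by (rule sum_distrib_left[symmetric])
    also have "\<dots> = - (K * (real CARD('n) * rot_err ?\<sigma>)) - rot_err ?\<sigma>" by (simp add: algebra_simps)
    finally have 1: "(\<Sum>i\<in>UNIV. \<kappa> i * w i) \<le> - (K * (real CARD('n) * rot_err ?\<sigma>)) - rot_err ?\<sigma>" .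
    have 2: "K * (err ?\<sigma>)\<^sup>2 \<le> K * (real CARD('n) * rot_err ?\<sigma>)"
      using pos(3) by (intro mult_left_mono err_sq_le) auto
    have 3: "m * (dev ?\<sigma>)\<^sup>2 \<le> p0 * (dev ?\<sigma>)\<^sup>2" "m * rot_err ?\<sigma> \<le> 1 * rot_err ?\<sigma>"
      using m rot_err_nonneg by (intro mult_right_mono; simp)+
    have "w0 + (\<Sum>i\<in>UNIV. \<kappa> i * w i) \<le> - (m * ((dev ?\<sigma>)\<^sup>2 + rot_err ?\<sigma>))"
      using w0(2) 1 2 3 unfolding distrib_left by linarith
    also have "\<dots> \<le> - (m * (W ?\<sigma> / qM))"
      using Wup[OF val sz] m(1) qM(1) by (simp add: divide_le_eq mult.commute)
    also have "\<dots> = - (2 * (m / (2 * qM))) * W ?\<sigma>" using qM(1) by simp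
    finally show "\<exists>w. ((\<lambda>s. W (S, T, s)) has_real_derivative w) (at t within S) \<and>
        w \<le> - (2 * (m / (2 * qM))) * W ?\<sigma>" using dW by blast
  qed
qed

theorem exponential_stability:
  "\<exists>\<delta>>0. \<exists>C>0. \<exists>r>0. \<forall>t0\<ge>0. \<forall>S T.
     motion_interval t0 S \<longrightarrow> closed_loop P c S T \<longrightarrow>
     total_error P c S T t0 < \<delta> \<longrightarrow>
     (1/2) * trace (mat 1 - att0 T t0) < 1 \<longrightarrow>
     (\<forall>i. (1/2) * trace (mat 1 - transpose (Rc P c S T i t0) ** attQ T i t0) < 1) \<longrightarrow>
     (\<forall>t\<in>S. total_error P c S T t \<le> C * exp (- r * (t - t0)) * total_error P c S T t0)"
proof -
  obtain W p q r \<epsilon> where pos: "p > 0" "q > 0" "r > 0" "\<epsilon> > 0"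
    and near: "\<And>\<sigma>. \<sigma> \<in> valid \<Longrightarrow> dev \<sigma> < \<epsilon> \<Longrightarrow> \<sigma> \<in> posed"
    and low: "\<And>\<sigma>. \<sigma> \<in> valid \<Longrightarrow> total_dev \<sigma> < \<epsilon> \<Longrightarrow> p * (total_dev \<sigma>)\<^sup>2 \<le> W \<sigma>"
    and up: "\<And>\<sigma>. \<sigma> \<in> valid \<Longrightarrow> total_dev \<sigma> < \<epsilon> \<Longrightarrow> W \<sigma> \<le> q * (total_dev \<sigma>)\<^sup>2"
    and der: "\<And>S T t. (S, T, t) \<in> valid \<Longrightarrow> total_dev (S, T, t) < \<epsilon> \<Longrightarrow>
      \<exists>w. ((\<lambda>s. W (S, T, s)) has_real_derivative w) (at t within S) \<and> w \<le> - (2 * r) * W (S, T, t)"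
    by (rule lyapunov_function) (rule that)
  let ?k = "sqrt (q / p)"
  \<comment> \<open>The factors 2 stem from comparing \<open>total_dev\<close> with the total error
    at the initial time; the two entries meet the two initial conditions of the continuity
    argument.\<close>
  define \<delta> where "\<delta> = min (\<epsilon> / 2) (\<epsilon> / (2 * ?k))"
  have k: "?k > 0" using pos by simp
  have \<delta>: "\<delta> > 0" using pos k by (simp add: \<delta>_def)
  have "total_error P c S T t \<le> (2 * ?k) * exp (- r * (t - t0)) * total_error P c S T t0"
    if t0: "t0 \<ge> 0" and S: "motion_interval t0 S" and cl: "closed_loop P c S T"
      and E: "total_error P c S T t0 < \<delta>" and tr: "(1/2) * trace (mat 1 - att0 T t0) < 1"
      "\<And>i. (1/2) * trace (mat 1 - transpose (Rc P c S T i t0) ** attQ T i t0) < 1"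
      and t: "t \<in> S" for t0 S T t
  proof -
    have val: "(S, T, s) \<in> valid" if "s \<in> S" for s
      using that t0 S cl by (auto simp: valid_def)
    note v0 = val[OF motion_intervalD(1)[OF S]]
    let ?E = "total_error P c S T t0"
    have "2 * ?E < \<epsilon>" using E by (simp add: \<delta>_def)
    \<comment> \<open>The payload and link errors alone decide whether the commanded attitudes are
      rotations; the attitude errors of the quadrotors can be compared only after that.\<close>
    then have "dev (S, T, t0) < \<epsilon>" using dev_le_total_error[OF v0 tr(1)] by linarith
    then have total_dev: "total_dev (S, T, t0) \<le> 2 * ?E"
      by (intro total_dev_le_total_error[OF v0 near[OF v0] tr])
    have "?k * (2 * ?E) < \<epsilon>"
    proof -
      have "?E * (2 * ?k) < \<epsilon>" using E k by (simp add: \<delta>_def pos_less_divide_eq)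
      then show ?thesis by (simp add: mult_ac)
    qed
    moreover have "?k * total_dev (S, T, t0) \<le> ?k * (2 * ?E)" using total_dev k by (intro mult_left_mono) auto
    ultimately have init: "total_dev (S, T, t0) < \<epsilon>" "?k * total_dev (S, T, t0) < \<epsilon>"
      using total_dev \<open>2 * ?E < \<epsilon>\<close> by linarith+
    have nn: "0 \<le> total_dev (S, T, s)" for s using total_dev_parts(1) conf.dev_nonneg by (rule order_trans[rotated])
    note barrier = exponential_decay_barrier[OF S total_dev_continuous[OF v0] nn pos(1,2),
        where W = "\<lambda>s. W (S, T, s)" and \<epsilon> = \<epsilon> and r = r, OF _ _ _ _ init t]
    have "total_dev (S, T, t) < \<epsilon>"
      by (rule barrier(1)) (use low up der val pos in auto)
    \<comment> \<open>This direction of the comparison holds at every rotation angle; the trace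
      conditions have done their work at \<open>t0\<close>.\<close>
    then have "total_error P c S T t \<le> total_dev (S, T, t)"
      using total_dev_parts(1)[of "(S, T, t)"] by (intro total_error_le_total_dev[OF val[OF t]] near val t) simp
    also have "\<dots> \<le> ?k * exp (- r * (t - t0)) * total_dev (S, T, t0)"
      by (rule barrier(2)) (use low up der val pos in auto)
    also have "\<dots> \<le> ?k * exp (- r * (t - t0)) * (2 * ?E)"
      using total_dev k by (intro mult_left_mono) auto
    finally show ?thesis by (simp add: mult_ac)
  qed
  then show ?thesis
    using \<delta> k pos(3) by (intro exI[of _ \<delta>] exI[of _ "2 * ?k"] exI[of _ r] conjI) auto
qed

end

theorem proposition3:
  fixes P :: "'n::finite plant" and c :: "'n controller"
  assumes plant: "admissible_plant P"
    and equilibrium: "(\<Sum>i\<in>UNIV. rho P i) \<times> e3 = 0"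
    and gains: "lin_asymptotically_stable P (Kpos c) (Kvel c)"
    and k_pos: "k_R c > 0" "k_Omega c > 0"
    and heading_smooth: "\<And>i. smooth_command (heading c i)"
    and heading_unit: "\<And>i t. t \<ge> 0 \<Longrightarrow> norm (heading c i t) = 1"
    and heading_bounded: "\<And>i. bounded (ddt {0..} (heading c i) ` {0..})"
    and heading_not_parallel:
      "\<exists>\<epsilon>>0. \<forall>i. \<forall>t\<ge>0.
         \<epsilon> \<le> norm (thrust_dir (force P (Kpos c) (Kvel c) i (\<lambda>_. 0) (\<lambda>_. 0)) \<times> heading c i t)"
  shows "\<exists>\<delta>>0. \<exists>C>0. \<exists>r>0. \<forall>t0\<ge>0. \<forall>S T.
     motion_interval t0 S \<longrightarrow> closed_loop P c S T \<longrightarrow>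
     total_error P c S T t0 < \<delta> \<longrightarrow>
     (1/2) * trace (mat 1 - att0 T t0) < 1 \<longrightarrow>
     (\<forall>i. (1/2) * trace (mat 1 - transpose (Rc P c S T i t0) ** attQ T i t0) < 1) \<longrightarrow>
     (\<forall>t\<in>S. total_error P c S T t \<le> C * exp (- r * (t - t0)) * total_error P c S T t0)"
proof -
  interpret tracking P c
    using assms by unfold_locales
  show ?thesis by (rule exponential_stability)
qed

end
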